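(* Let $u:[0,1]\to\mathbb{R}$ be piecewise continuous. Then Problem $(P)$ admits a solution that is a Lipschitz continuous function $[0,1]\to[0,1]$. Furthermore, if $u$ is also single-crossing, then any optimal solution $p$ of Problem $(P)$ is of one of the following two kinds: (i) pure boundary solution: $p(t)=0$ for all $t\in[0,1]$, or $p(t)=1$ for all $t\in[0,1]$; (ii) strict interior solution: $0<p(t)<1$ for all $t\in[0,1]$.
   Context: Piecewise continuous: $u:[0,1]\to\mathbb{R}$ is piecewise continuous if there are $0=t_0<t_1<\dots<t_N=1$ such that $u$ is continuous on each $(t_i,t_{i+1})$, $i=0,\dots,N-1$, the left limits of $u$ exist and are finite at $t_1,\dots,t_N$, and the right limits exist and are finite at $t_0,\dots,t_{N-1}$. Single-crossing: there exists $t_u\in[0,1]$ with $u(t)<0$ on $[0,t_u)$ and $u(t)>0$ on $(t_u,1]$. Problem $(P)$: minimize over absolutely continuous $p:[0,1]\to[0,1]$ the functional $$J^P[p]=\int_0^1 \left(\frac{(p'(t))^2}{p(t)(1-p(t))}-u(t)p(t)\right)dt,$$ where the quotient is taken to be $0$ if $p(t)\in\{0,1\}$ and $p'(t)=0$, and $+\infty$ if $p(t)\in\{0,1\}$ and $p'(t)\neq0$. An (optimal) solution is a $p_*$ with $J^P[p_*]<+\infty$ and $J^P[p_*]\le J^P[p]$ for all absolutely continuous $p:[0,1]\to[0,1]$. *)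

theory Defs
  imports "HOL-Analysis.Analysis"
begin

text \<open>
  Functions on the unit interval are represented by functions \<open>real \<Rightarrow> real\<close>.
  None of the notions below depends on values outside \<open>{0..1}\<close>, except that the value of the
  integrand at the two endpoints may (through \<^const>\<open>deriv\<close>), which does not affect the integral.
\<close>

text \<open>\<open>N \<ge> 1\<close> is implied by \<open>\<tau> 0 \<noteq> \<tau> N\<close>.\<close>

definition piecewise_continuous :: "(real \<Rightarrow> real) \<Rightarrow> bool" where
  "piecewise_continuous u \<longleftrightarrow>
     (\<exists>(N::nat) (\<tau> :: nat \<Rightarrow> real). \<tau> 0 = 0 \<and> \<tau> N = 1 \<and>
        (\<forall>i<N. \<tau> i < \<tau> (Suc i) \<and>
               continuous_on {\<tau> i<..<\<tau> (Suc i)} u \<and>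
               (\<exists>l::real. (u \<longlongrightarrow> l) (at_left (\<tau> (Suc i)))) \<and>
               (\<exists>r::real. (u \<longlongrightarrow> r) (at_right (\<tau> i)))))"

definition single_crossing :: "(real \<Rightarrow> real) \<Rightarrow> bool" where
  "single_crossing u \<longleftrightarrow>
     (\<exists>s\<in>{0..1}. (\<forall>t\<in>{0..<s}. u t < 0) \<and> (\<forall>t\<in>{s<..1}. u t > 0))"

text \<open>The classical \<open>\<epsilon>\<close>-\<open>\<delta>\<close> notion for functions; the library's
  \<^const>\<open>absolutely_continuous\<close> is the one for measures.\<close>

definition abs_continuous_on :: "real set \<Rightarrow> (real \<Rightarrow> real) \<Rightarrow> bool" where
  "abs_continuous_on S f \<longleftrightarrow>
     (\<forall>\<epsilon>>0. \<exists>\<delta>>0. \<forall>(n::nat) (a :: nat \<Rightarrow> real) (b :: nat \<Rightarrow> real).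
        (\<forall>i<n. a i \<le> b i \<and> {a i..b i} \<subseteq> S) \<and>
        disjoint_family_on (\<lambda>i. {a i<..<b i}) {..<n} \<and>
        (\<Sum>i<n. b i - a i) < \<delta>
        \<longrightarrow> (\<Sum>i<n. \<bar>f (b i) - f (a i)\<bar>) < \<epsilon>)"

text \<open>The quotient \<open>v\<^sup>2 / (q (1 - q))\<close> for \<open>q \<in> [0,1]\<close>, with its conventions at
  \<open>q \<in> {0, 1}\<close>.\<close>

definition quotient_term :: "real \<Rightarrow> real \<Rightarrow> ereal" where
  "quotient_term q v =
     (if q \<in> {0, 1} then (if v = 0 then 0 else \<infinity>)
      else ereal (v\<^sup>2 / (q * (1 - q))))"

text \<open>Lebesgue integral of an extended-real function: integral of the positive part minus integral
  of the negative part (\<^const>\<open>e2ennreal\<close> maps negative numbers to \<open>0\<close>).  It has its usual meaning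
  whenever one of the two integrals is finite.\<close>

definition ereal_integral :: "'a measure \<Rightarrow> ('a \<Rightarrow> ereal) \<Rightarrow> ereal" where
  "ereal_integral M f =
     enn2ereal (\<integral>\<^sup>+x. e2ennreal (f x) \<partial>M) - enn2ereal (\<integral>\<^sup>+x. e2ennreal (- f x) \<partial>M)"

text \<open>For absolutely continuous \<open>p\<close> the derivative exists almost everywhere, so the unspecified value
  of \<^const>\<open>deriv\<close> at the remaining points is irrelevant.  The negative part of the integrand is
  bounded by \<open>\<bar>u\<bar>\<close>.\<close>

definition J :: "(real \<Rightarrow> real) \<Rightarrow> (real \<Rightarrow> real) \<Rightarrow> ereal" where
  "J u p = ereal_integral (lebesgue_on {0..1})
     (\<lambda>t. quotient_term (p t) (deriv p t) - ereal (u t * p t))"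

definition admissible :: "(real \<Rightarrow> real) \<Rightarrow> bool" where
  "admissible p \<longleftrightarrow> abs_continuous_on {0..1} p \<and> (\<forall>t\<in>{0..1}. p t \<in> {0..1})"

definition optimal_solution :: "(real \<Rightarrow> real) \<Rightarrow> (real \<Rightarrow> real) \<Rightarrow> bool" where
  "optimal_solution u p \<longleftrightarrow>
     admissible p \<and> J u p < \<infinity> \<and> (\<forall>q. admissible q \<longrightarrow> J u p \<le> J u q)"

definition pure_boundary :: "(real \<Rightarrow> real) \<Rightarrow> bool" where
  "pure_boundary p \<longleftrightarrow> (\<forall>t\<in>{0..1}. p t = 0) \<or> (\<forall>t\<in>{0..1}. p t = 1)"

definition strict_interior :: "(real \<Rightarrow> real) \<Rightarrow> bool" where
  "strict_interior p \<longleftrightarrow> (\<forall>t\<in>{0..1}. 0 < p t \<and> p t < 1)"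

end

theory Submission
  imports Defs "HOL-Complex_Analysis.Great_Picard"
begin

text \<open>
  In the angular coordinate \<open>f = arcsin (2 p - 1)\<close>, so that \<open>p = (1 + sin f) / 2\<close>, the quotient
  \<open>p'\<^sup>2 / (p (1 - p))\<close> becomes \<open>f'\<^sup>2\<close>, and the functional becomes the Dirichlet energy of \<open>f\<close> plus
  a bounded potential term.  The bound \<open>\<Sum> (f b - f a)\<^sup>2 / (b - a) \<le> B\<close> over disjoint intervals
  characterizes \<open>\<integral> f'\<^sup>2 \<le> B\<close> and passes to pointwise limits, so a minimizing sequence converges
  (Arzela--Ascoli) to a minimizer.

  Any real-valued \<open>f\<close> is a competitor, because \<open>(1 + sin f) / 2\<close> folds it back into \<open>[0, 1]\<close>.  Hence the
  angle of an optimal \<open>p\<close> satisfies the free Euler--Lagrange equation \<open>f'' = - u cos f / 4\<close>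
  with \<open>f' = 0\<close> at both ends; in particular \<open>f\<close> is Lipschitz.  If \<open>p\<close> touches \<open>0\<close> or \<open>1\<close>, then \<open>f\<close> touches
  the equilibrium \<open>- pi/2\<close> or \<open>pi/2\<close> with zero velocity, and uniqueness for the
  equation makes it constant.
\<close>

subsection \<open>Absolute continuity\<close>

text \<open>\<open>J\<close> is formed with \<open>deriv\<close>, whereas the energy is controlled
  through increments. The link is Lebesgue's theorem that an absolutely continuous function is the
  integral of its almost everywhere derivative. It is derived from Radon-Nikodym densities of two
  monotone parts, and the translation between \<open>p\<close> and its angle rests on it.

  The obstacle in that translation is that \<open>arcsin\<close> is not Lipschitz near
  \<open>-1\<close> and \<open>1\<close>, so absolute continuity of the angle does not follow from
  that of \<open>p\<close>; it is a consequence of finite energy. This is why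
  \<open>energy_bound\<close> is phrased without derivatives: a bound uniform in a regularization
  survives in the limit, and Cauchy-Schwarz then returns absolute continuity.

  Since \<open>u\<close> may jump, the Euler-Lagrange equation is kept in integrated form. The
  velocity of the angle at a point becomes an integral of the force \<open>u cos f\<close>, and
  uniqueness at an equilibrium comes from the bound of \<open>\<bar>cos f\<bar>\<close> by the
  distance of \<open>f\<close> to that equilibrium.\<close>

lemma abs_continuous_onE:
  assumes "abs_continuous_on S f" "e > 0"
  obtains d where "d > 0"
    "\<And>(n::nat) a b. \<lbrakk>\<forall>i<n. a i \<le> b i \<and> {a i..b i} \<subseteq> S;
        disjoint_family_on (\<lambda>i. {a i<..<b i}) {..<n}; (\<Sum>i<n. b i - a i) < d\<rbrakk>
      \<Longrightarrow> (\<Sum>i<n. \<bar>f (b i) - f (a i)\<bar>) < e"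
proof -
  have "\<exists>d>0. \<forall>(n::nat) a b. (\<forall>i<n. a i \<le> b i \<and> {a i..b i} \<subseteq> S) \<and>
        disjoint_family_on (\<lambda>i. {a i<..<b i}) {..<n} \<and> (\<Sum>i<n. b i - a i) < d
      \<longrightarrow> (\<Sum>i<n. \<bar>f (b i) - f (a i)\<bar>) < e"
    using assms(1)[unfolded abs_continuous_on_def, rule_format, OF assms(2)] .
  then show thesis using that by blast
qed

text \<open>Transport along an enumeration of \<open>K\<close>. Later families are indexed by pairs
  (interval, gap of its partition) and by the intervals themselves, where renumbering by hand would
  be awkward.\<close>

lemma abs_continuous_on_finite_family:
  fixes f :: "real \<Rightarrow> real"
  assumes "abs_continuous_on S f" "e > 0"
  obtains d where "d > 0"
    "\<And>(K::'i set) a b. \<lbrakk>finite K; \<And>k. k \<in> K \<Longrightarrow> a k \<le> b k \<and> {a k..b k} \<subseteq> S;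
        disjoint_family_on (\<lambda>k. {a k<..<b k}) K; (\<Sum>k\<in>K. b k - a k) < d\<rbrakk>
      \<Longrightarrow> (\<Sum>k\<in>K. \<bar>f (b k) - f (a k)\<bar>) < e"
proof -
  obtain d where d: "d > 0" and
    D: "\<And>(n::nat) a b. \<lbrakk>\<forall>i<n. a i \<le> b i \<and> {a i..b i} \<subseteq> S;
        disjoint_family_on (\<lambda>i. {a i<..<b i}) {..<n}; (\<Sum>i<n. b i - a i) < d\<rbrakk>
      \<Longrightarrow> (\<Sum>i<n. \<bar>f (b i) - f (a i)\<bar>) < e"
    by (rule abs_continuous_onE[OF assms]) blast
  show thesis
  proof (rule that[OF d])
    fix K :: "'i set" and a b
    assume K: "finite K" "\<And>k. k \<in> K \<Longrightarrow> a k \<le> b k \<and> {a k..b k} \<subseteq> S"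
      and disj: "disjoint_family_on (\<lambda>k. {a k<..<b k}) K"
      and lt: "(\<Sum>k\<in>K. b k - a k) < d"
    obtain h where h: "bij_betw h {..<card K} K"
      using ex_bij_betw_nat_finite[OF K(1)] by (auto simp: atLeast0LessThan)
    have hK: "h i \<in> K" if "i < card K" for i
      using h that by (auto simp: bij_betw_def)
    have "(\<Sum>i<card K. \<bar>f (b (h i)) - f (a (h i))\<bar>) < e"
    proof (rule D)
      show "\<forall>i<card K. a (h i) \<le> b (h i) \<and> {a (h i)..b (h i)} \<subseteq> S"
        using K(2) hK by blast
      show "disjoint_family_on (\<lambda>i. {a (h i)<..<b (h i)}) {..<card K}"
        unfolding disjoint_family_on_def
      proof (intro ballI impI)
        fix i j assume ij: "i \<in> {..<card K}" "j \<in> {..<card K}" "i \<noteq> j"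
        then have "h i \<noteq> h j"
          using h by (auto simp: bij_betw_def inj_on_def)
        then show "{a (h i)<..<b (h i)} \<inter> {a (h j)<..<b (h j)} = {}"
          using disj ij hK unfolding disjoint_family_on_def by blast
      qed
      show "(\<Sum>i<card K. b (h i) - a (h i)) < d"
        using lt sum.reindex_bij_betw[OF h, of "\<lambda>k. b k - a k"] by simp
    qed
    then show "(\<Sum>k\<in>K. \<bar>f (b k) - f (a k)\<bar>) < e"
      using sum.reindex_bij_betw[OF h, of "\<lambda>k. \<bar>f (b k) - f (a k)\<bar>"] by simp
  qed
qed

lemma abs_continuous_on_imp_continuous_on:
  assumes "abs_continuous_on {c..d} f"
  shows "continuous_on {c..d} f"
  unfolding continuous_on_iff
proof (intro ballI allI impI)
  fix x e :: real assume x: "x \<in> {c..d}" and e: "0 < e"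
  obtain \<delta> where \<delta>: "\<delta> > 0" and
    D: "\<And>(K::unit set) a b. \<lbrakk>finite K; \<And>k. k \<in> K \<Longrightarrow> a k \<le> b k \<and> {a k..b k} \<subseteq> {c..d};
        disjoint_family_on (\<lambda>k. {a k<..<b k}) K; (\<Sum>k\<in>K. b k - a k) < \<delta>\<rbrakk>
      \<Longrightarrow> (\<Sum>k\<in>K. \<bar>f (b k) - f (a k)\<bar>) < e"
    by (rule abs_continuous_on_finite_family[OF assms e]) blast
  have *: "\<bar>f y - f x\<bar> < e" if "x \<in> {c..d}" "y \<in> {c..d}" "x \<le> y" "y - x < \<delta>" for x y
    using D[of "{()}" "\<lambda>_. x" "\<lambda>_. y"] that by (auto simp: disjoint_family_on_def)
  show "\<exists>\<delta>>0. \<forall>x'\<in>{c..d}. dist x' x < \<delta> \<longrightarrow> dist (f x') (f x) < e"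
  proof (intro exI[of _ \<delta>] conjI ballI impI \<delta>)
    fix x' assume x': "x' \<in> {c..d}" "dist x' x < \<delta>"
    then show "dist (f x') (f x) < e"
      using *[of x x'] *[of x' x] x by (cases "x \<le> x'") (auto simp: dist_real_def abs_minus_commute)
  qed
qed

lemma abs_continuous_on_add:
  assumes "abs_continuous_on S f" "abs_continuous_on S g"
  shows "abs_continuous_on S (\<lambda>x. f x + g x)"
  unfolding abs_continuous_on_def
proof (intro allI impI)
  fix e :: real assume e: "e > 0"
  obtain d1 where d1: "d1 > 0" and
    1: "\<And>(n::nat) a b. \<lbrakk>\<forall>i<n. a i \<le> b i \<and> {a i..b i} \<subseteq> S;
        disjoint_family_on (\<lambda>i. {a i<..<b i}) {..<n}; (\<Sum>i<n. b i - a i) < d1\<rbrakk>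
      \<Longrightarrow> (\<Sum>i<n. \<bar>f (b i) - f (a i)\<bar>) < e/2"
    by (rule abs_continuous_onE[OF assms(1) half_gt_zero[OF e]]) blast
  obtain d2 where d2: "d2 > 0" and
    2: "\<And>(n::nat) a b. \<lbrakk>\<forall>i<n. a i \<le> b i \<and> {a i..b i} \<subseteq> S;
        disjoint_family_on (\<lambda>i. {a i<..<b i}) {..<n}; (\<Sum>i<n. b i - a i) < d2\<rbrakk>
      \<Longrightarrow> (\<Sum>i<n. \<bar>g (b i) - g (a i)\<bar>) < e/2"
    by (rule abs_continuous_onE[OF assms(2) half_gt_zero[OF e]]) blast
  show "\<exists>\<delta>>0. \<forall>(n::nat) a b. (\<forall>i<n. a i \<le> b i \<and> {a i..b i} \<subseteq> S) \<and>
        disjoint_family_on (\<lambda>i. {a i<..<b i}) {..<n} \<and> (\<Sum>i<n. b i - a i) < \<delta>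
        \<longrightarrow> (\<Sum>i<n. \<bar>f (b i) + g (b i) - (f (a i) + g (a i))\<bar>) < e"
  proof (intro exI[of _ "min d1 d2"] conjI allI impI)
    fix n :: nat and a b :: "nat \<Rightarrow> real"
    assume A: "(\<forall>i<n. a i \<le> b i \<and> {a i..b i} \<subseteq> S) \<and>
        disjoint_family_on (\<lambda>i. {a i<..<b i}) {..<n} \<and> (\<Sum>i<n. b i - a i) < min d1 d2"
    have "(\<Sum>i<n. \<bar>f (b i) + g (b i) - (f (a i) + g (a i))\<bar>)
        \<le> (\<Sum>i<n. \<bar>f (b i) - f (a i)\<bar> + \<bar>g (b i) - g (a i)\<bar>)"
      by (intro sum_mono) linarith
    also have "\<dots> < e"
      using 1[of n a b] 2[of n a b] A by (simp add: sum.distrib)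
    finally show "(\<Sum>i<n. \<bar>f (b i) + g (b i) - (f (a i) + g (a i))\<bar>) < e" .
  qed (use d1 d2 in auto)
qed

lemma abs_continuous_on_lipschitz_compose:
  assumes f: "abs_continuous_on S f" and L: "L-lipschitz_on T h" and fT: "f ` S \<subseteq> T"
  shows "abs_continuous_on S (\<lambda>x. h (f x))"
  unfolding abs_continuous_on_def
proof (intro allI impI)
  fix e :: real assume e: "e > 0"
  have L0: "L \<ge> 0" using L lipschitz_on_nonneg by blast
  \<comment> \<open>\<open>L + 1\<close> instead of \<open>L\<close>, because the Lipschitz constant
    may be zero.\<close>
  then have e': "e / (L + 1) > 0" using e by simp
  obtain d where d: "d > 0" and
    D: "\<And>(n::nat) a b. \<lbrakk>\<forall>i<n. a i \<le> b i \<and> {a i..b i} \<subseteq> S;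
        disjoint_family_on (\<lambda>i. {a i<..<b i}) {..<n}; (\<Sum>i<n. b i - a i) < d\<rbrakk>
      \<Longrightarrow> (\<Sum>i<n. \<bar>f (b i) - f (a i)\<bar>) < e / (L + 1)"
    by (rule abs_continuous_onE[OF f e']) blast
  show "\<exists>\<delta>>0. \<forall>(n::nat) a b. (\<forall>i<n. a i \<le> b i \<and> {a i..b i} \<subseteq> S) \<and>
        disjoint_family_on (\<lambda>i. {a i<..<b i}) {..<n} \<and> (\<Sum>i<n. b i - a i) < \<delta>
        \<longrightarrow> (\<Sum>i<n. \<bar>h (f (b i)) - h (f (a i))\<bar>) < e"
  proof (intro exI[of _ d] conjI allI impI d)
    fix n :: nat and a b :: "nat \<Rightarrow> real"
    assume A: "(\<forall>i<n. a i \<le> b i \<and> {a i..b i} \<subseteq> S) \<and>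
        disjoint_family_on (\<lambda>i. {a i<..<b i}) {..<n} \<and> (\<Sum>i<n. b i - a i) < d"
    have "(\<Sum>i<n. \<bar>h (f (b i)) - h (f (a i))\<bar>) \<le> (\<Sum>i<n. L * \<bar>f (b i) - f (a i)\<bar>)"
    proof (rule sum_mono)
      fix i assume "i \<in> {..<n}"
      then have "a i \<le> b i" "{a i..b i} \<subseteq> S" using A by auto
      then have "a i \<in> S" "b i \<in> S" by auto
      then show "\<bar>h (f (b i)) - h (f (a i))\<bar> \<le> L * \<bar>f (b i) - f (a i)\<bar>"
        using lipschitz_onD[OF L, of "f (b i)" "f (a i)"] fT by (auto simp: dist_real_def)
    qed
    also have "\<dots> \<le> (L + 1) * (\<Sum>i<n. \<bar>f (b i) - f (a i)\<bar>)"
      by (simp add: sum_distrib_left[symmetric] mult_right_mono sum_nonneg)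
    also have "\<dots> < (L + 1) * (e / (L + 1))"
      using D[of n a b] A L0 by (intro mult_strict_left_mono) auto
    finally show "(\<Sum>i<n. \<bar>h (f (b i)) - h (f (a i))\<bar>) < e"
      using L0 by simp
  qed
qed

lemma abs_continuous_on_minus:
  assumes "abs_continuous_on S f"
  shows "abs_continuous_on S (\<lambda>x. - f x)"
  using assms unfolding abs_continuous_on_def by (simp add: abs_minus_commute)

subsection \<open>Total variation\<close>

text \<open>Partitions are lists, so that inserting a cut point and splitting at it are inductions
  along the list.\<close>

fun list_variation :: "(real \<Rightarrow> real) \<Rightarrow> real list \<Rightarrow> real" where
  "list_variation f [] = 0"
| "list_variation f [x] = 0"
| "list_variation f (x # y # zs) = \<bar>f y - f x\<bar> + list_variation f (y # zs)"

lemma list_variation_Cons_le: "list_variation f xs \<le> list_variation f (x # xs)"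
  by (cases xs) auto

text \<open>Triangle inequality at the junction: the increment from the last point of
  \<open>xs\<close> to the first point of \<open>ys\<close> is replaced by the detour through
  \<open>c\<close>.\<close>

lemma list_variation_insert_le:
  "list_variation f (xs @ ys) \<le> list_variation f (xs @ [c]) + list_variation f (c # ys)"
proof (induction f xs rule: list_variation.induct)
  case (1 f)
  then show ?case using list_variation_Cons_le[of f ys c] by simp
next
  case (2 f x)
  then show ?case by (cases ys) auto
qed auto

lemma list_variation_snoc2:
  "list_variation f (xs @ [a, b]) = list_variation f (xs @ [a]) + \<bar>f b - f a\<bar>"
  by (induction f xs rule: list_variation.induct) auto

lemma list_variation_snoc_le: "list_variation f xs \<le> list_variation f (xs @ [a])"
  by (induction f xs rule: list_variation.induct) auto

lemma list_variation_nth: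
  "list_variation f xs = (\<Sum>j<length xs - 1. \<bar>f (xs ! Suc j) - f (xs ! j)\<bar>)"
  by (induction f xs rule: list_variation.induct) (auto simp: sum.lessThan_Suc_shift simp del: sum.lessThan_Suc)

lemma sum_nth_diff:
  fixes xs :: "real list"
  shows "(\<Sum>j<length xs - 1. xs ! Suc j - xs ! j) = (if xs = [] then 0 else last xs - hd xs)"
proof (cases "xs = []")
  case False
  then show ?thesis
    using sum_lessThan_telescope[of "\<lambda>j. xs ! j" "length xs - 1"]
    by (simp add: last_conv_nth hd_conv_nth)
qed simp

lemma disjoint_family_sorted_list:
  fixes xs :: "real list"
  assumes "sorted xs" "j < length xs - 1" "k < length xs - 1" "j \<noteq> k"
  shows "{xs ! j<..<xs ! Suc j} \<inter> {xs ! k<..<xs ! Suc k} = {}"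
proof -
  have *: "xs ! Suc j \<le> xs ! k" if "j < k" "k < length xs - 1" for j k
    using sorted_nth_mono[OF assms(1), of "Suc j" k] that by auto
  show ?thesis using *[of j k] *[of k j] assms by (auto simp: less_le_not_le neq_iff)
qed

lemma sorted_filter_split:
  fixes xs :: "real list"
  assumes "sorted xs"
  shows "xs = filter (\<lambda>x. x \<le> c) xs @ filter (\<lambda>x. c < x) xs"
  using assms
proof (induction xs)
  case (Cons x xs)
  show ?case
  proof (cases "x \<le> c")
    case False
    then have "filter (\<lambda>x. x \<le> c) xs = []" "filter (\<lambda>x. c < x) xs = xs"
      using Cons.prems by (auto simp: filter_empty_conv filter_id_conv)
    then show ?thesis using False by simp
  qed (use Cons in auto)
qed simp

lemma list_variation_split_le:
  assumes "sorted xs"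
  shows "list_variation f xs \<le> list_variation f (filter (\<lambda>x. x \<le> c) xs @ [c])
            + list_variation f (c # filter (\<lambda>x. c < x) xs)"
  using list_variation_insert_le[of f "filter (\<lambda>x. x \<le> c) xs" "filter (\<lambda>x. c < x) xs" c]
    sorted_filter_split[OF assms, of c] by simp

text \<open>The families \<open>L i\<close> of partition points of disjoint intervals combine to one family of disjoint
  intervals, to which absolute continuity applies.\<close>

lemma abs_continuous_on_list_variation:
  assumes "abs_continuous_on {c..d} f" "e > 0"
  obtains \<delta> where "\<delta> > 0"
    "\<And>(n::nat) a b L. \<lbrakk>\<And>i. i < n \<Longrightarrow> a i \<le> b i \<and> {a i..b i} \<subseteq> {c..d};
        disjoint_family_on (\<lambda>k. {a k<..<b k}) {..<n}; (\<Sum>k<n. b k - a k) < \<delta>;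
        \<And>i. i < n \<Longrightarrow> sorted (L i) \<and> set (L i) \<subseteq> {a i..b i}\<rbrakk>
      \<Longrightarrow> (\<Sum>i<n. list_variation f (L i)) < e"
proof -
  obtain \<delta> where \<delta>: "\<delta> > 0" and
    D: "\<And>(K::(nat \<times> nat) set) a b. \<lbrakk>finite K; \<And>k. k \<in> K \<Longrightarrow> a k \<le> b k \<and> {a k..b k} \<subseteq> {c..d};
        disjoint_family_on (\<lambda>k. {a k<..<b k}) K; (\<Sum>k\<in>K. b k - a k) < \<delta>\<rbrakk>
      \<Longrightarrow> (\<Sum>k\<in>K. \<bar>f (b k) - f (a k)\<bar>) < e"
    by (rule abs_continuous_on_finite_family[OF assms]) blast
  show thesis
  proof (rule that[OF \<delta>])
    fix n :: nat and a b :: "nat \<Rightarrow> real" and L :: "nat \<Rightarrow> real list"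
    assume ab: "\<And>i. i < n \<Longrightarrow> a i \<le> b i \<and> {a i..b i} \<subseteq> {c..d}"
      and disj: "disjoint_family_on (\<lambda>k. {a k<..<b k}) {..<n}"
      and lt: "(\<Sum>k<n. b k - a k) < \<delta>"
      and L: "\<And>i. i < n \<Longrightarrow> sorted (L i) \<and> set (L i) \<subseteq> {a i..b i}"
    define K where "K = Sigma {..<n} (\<lambda>i. {..<length (L i) - 1})"
    define A where "A = (\<lambda>(i,j). L i ! j)"
    define B where "B = (\<lambda>(i,j). L i ! Suc j)"
    have mem: "L i ! j \<in> {a i..b i}" if "i < n" "j < length (L i)" for i j
      using L[OF that(1)] that(2) nth_mem by blast
    have "(\<Sum>k\<in>K. \<bar>f (B k) - f (A k)\<bar>) < e"
    proof (rule D)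
      show "finite K" by (simp add: K_def)
      show "A k \<le> B k \<and> {A k..B k} \<subseteq> {c..d}" if kK: "k \<in> K" for k
      proof -
        obtain i j where k: "k = (i,j)" "i < n" "j < length (L i) - 1"
          using kK by (auto simp: K_def)
        have "L i ! j \<le> L i ! Suc j"
          using L[OF k(2)] k(3) by (intro sorted_nth_mono) auto
        moreover have "L i ! j \<in> {a i..b i}" "L i ! Suc j \<in> {a i..b i}"
          using mem k by auto
        ultimately show ?thesis using ab[OF k(2)] by (auto simp: A_def B_def k(1))
      qed
      show "disjoint_family_on (\<lambda>k. {A k<..<B k}) K"
        unfolding disjoint_family_on_def
      proof (intro ballI impI)
        fix k k' assume kk: "k \<in> K" "k' \<in> K" "k \<noteq> k'"
        obtain i j where k: "k = (i,j)" "i < n" "j < length (L i) - 1"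
          using kk by (auto simp: K_def)
        obtain i' j' where k': "k' = (i',j')" "i' < n" "j' < length (L i') - 1"
          using kk by (auto simp: K_def)
        show "{A k<..<B k} \<inter> {A k'<..<B k'} = {}"
        proof (cases "i = i'")
          case True
          then show ?thesis
            using disjoint_family_sorted_list[of "L i" j j'] L[OF k(2)] k k' kk
            by (auto simp: A_def B_def)
        next
          case False
          have sub: "{L i ! j<..<L i ! Suc j} \<subseteq> {a i<..<b i}"
            if "i < n" "j < length (L i) - 1" for i j
            using mem[OF that(1), of j] mem[OF that(1), of "Suc j"] that(2)
            by (simp add: greaterThanLessThan_subseteq_greaterThanLessThan)
          have "{A k<..<B k} \<subseteq> {a i<..<b i}"
            using sub[OF k(2,3)] k by (simp add: A_def B_def)
          moreover have "{A k'<..<B k'} \<subseteq> {a i'<..<b i'}"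
            using sub[OF k'(2,3)] k' by (simp add: A_def B_def)
          moreover have "{a i<..<b i} \<inter> {a i'<..<b i'} = {}"
            using disj False k k' unfolding disjoint_family_on_def by auto
          ultimately show ?thesis by blast
        qed
      qed
      have "(\<Sum>k\<in>K. B k - A k) = (\<Sum>i<n. \<Sum>j<length (L i) - 1. L i ! Suc j - L i ! j)"
        by (simp add: K_def A_def B_def sum.Sigma split_def)
      also have "\<dots> \<le> (\<Sum>i<n. b i - a i)"
      proof (rule sum_mono)
        fix i assume "i \<in> {..<n}"
        then have i: "i < n" by simp
        show "(\<Sum>j<length (L i) - 1. L i ! Suc j - L i ! j) \<le> b i - a i"
        proof (cases "L i = []")
          case False
          then have "last (L i) \<in> {a i..b i}" "hd (L i) \<in> {a i..b i}"
            using L[OF i] by (meson hd_in_set last_in_set subsetD)+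
          then show ?thesis unfolding sum_nth_diff using False by auto
        qed (use ab[OF i] in simp)
      qed
      finally show "(\<Sum>k\<in>K. B k - A k) < \<delta>" using lt by simp
    qed
    moreover have "(\<Sum>k\<in>K. \<bar>f (B k) - f (A k)\<bar>) = (\<Sum>i<n. list_variation f (L i))"
      by (simp add: K_def A_def B_def sum.Sigma split_def list_variation_nth)
    ultimately show "(\<Sum>i<n. list_variation f (L i)) < e" by simp
  qed
qed

text \<open>Absolute continuity with \<open>e = 1\<close> bounds the variation by \<open>1\<close>
  on every block of length \<open>h = 1 / (m + 1) < \<delta>\<close>. Induction over the
  \<open>m + 1\<close> blocks, cutting the list at \<open>k * h\<close>, adds these bounds
  up.\<close>

lemma abs_continuous_on_bounded_variation:
  assumes "abs_continuous_on {0..1} f"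
  obtains B where "\<And>xs. \<lbrakk>sorted xs; set xs \<subseteq> {0..1}\<rbrakk> \<Longrightarrow> list_variation f xs \<le> B"
proof -
  obtain \<delta> where \<delta>: "\<delta> > 0" and
    D: "\<And>(n::nat) a b L. \<lbrakk>\<And>i. i < n \<Longrightarrow> a i \<le> b i \<and> {a i..b i} \<subseteq> {0..1};
        disjoint_family_on (\<lambda>k. {a k<..<b k}) {..<n}; (\<Sum>k<n. b k - a k) < \<delta>;
        \<And>i. i < n \<Longrightarrow> sorted (L i) \<and> set (L i) \<subseteq> {a i..b i}\<rbrakk>
      \<Longrightarrow> (\<Sum>i<n. list_variation f (L i)) < 1"
    by (rule abs_continuous_on_list_variation[OF assms zero_less_one]) blast
  obtain m where m: "inverse (real (Suc m)) < \<delta>"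
    using reals_Archimedean[OF \<delta>] by auto
  define h where "h = inverse (real (Suc m))"
  have h: "h > 0" "h < \<delta>" using m by (auto simp: h_def)
  have bd: "list_variation f xs \<le> real k"
    if "k \<le> Suc m" "sorted xs" "set xs \<subseteq> {0..real k * h}" for k xs
    using that
  proof (induction k arbitrary: xs)
    case 0
    have "list_variation f ys = 0" if "set ys \<subseteq> {0}" for ys
      using that by (induction f ys rule: list_variation.induct) auto
    then show ?case using 0 by simp
  next
    case (Suc k)
    let ?c = "real k * h"
    let ?xs = "filter (\<lambda>x. x \<le> ?c) xs @ [?c]" and ?ys = "?c # filter (\<lambda>x. ?c < x) xs"
    have "list_variation f ?xs \<le> real k"
      using Suc.prems h by (intro Suc.IH) (auto simp: sorted_append sorted_wrt_filter)
    moreover have "list_variation f ?ys < 1"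
    proof -
      have "real (Suc k) * h \<le> real (Suc m) * h"
        using Suc.prems h by (intro mult_right_mono) auto
      also have "\<dots> = 1" by (simp add: h_def)
      finally have "real (Suc k) * h \<le> 1" .
      moreover have "{x \<in> set xs. h * real k < x} \<subseteq> {h * real k..h + h * real k}"
        using Suc.prems(3) by (auto simp: algebra_simps)
      ultimately show ?thesis
        using D[of 1 "\<lambda>_. ?c" "\<lambda>_. real (Suc k) * h" "\<lambda>_. ?ys"] Suc.prems h
        by (auto simp: disjoint_family_on_def algebra_simps sorted_wrt_filter)
    qed
    ultimately show ?case
      using list_variation_split_le[OF Suc.prems(2), of f ?c] by simp
  qed
  show thesis
    by (rule that[of "real (Suc m)"]) (use bd[of "Suc m"] in \<open>auto simp: h_def\<close>)
qed

text \<open>\<open>V\<close> is the total variation of \<open>f\<close> on \<open>{0..x}\<close>.\<close>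

lemma abs_continuous_on_monotone_decomposition:
  assumes f: "abs_continuous_on {0..1} f"
  obtains V where "abs_continuous_on {0..1} V"
    "\<And>x y. \<lbrakk>0 \<le> x; x \<le> y; y \<le> 1\<rbrakk> \<Longrightarrow> \<bar>f y - f x\<bar> \<le> V y - V x"
proof -
  define T where "T x = {list_variation f xs | xs. sorted xs \<and> set xs \<subseteq> {0..x}}" for x
  define V where "V x = Sup (T x)" for x
  obtain B where B: "\<And>xs. \<lbrakk>sorted xs; set xs \<subseteq> {0..1}\<rbrakk> \<Longrightarrow> list_variation f xs \<le> B"
    using abs_continuous_on_bounded_variation[OF f] by blast
  have bdd: "bdd_above (T x)" if "x \<le> 1" for x
    unfolding T_def by (rule bdd_aboveI[of _ B]) (use B that in force)
  have ne: "T x \<noteq> {}" for x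
    unfolding T_def by (auto intro!: exI[of _ "[]"])
  have upper: "list_variation f xs \<le> V x" if "sorted xs" "set xs \<subseteq> {0..x}" "x \<le> 1" for xs x
    unfolding V_def by (rule cSup_upper[OF _ bdd]) (use that in \<open>auto simp: T_def\<close>)
  have jump: "\<bar>f y - f x\<bar> \<le> V y - V x" if "0 \<le> x" "x \<le> y" "y \<le> 1" for x y
  proof -
    \<comment> \<open>Appending \<open>x, y\<close> to any partition of \<open>{0..x}\<close> gives
      a partition of \<open>{0..y}\<close> that gains at least the increment of
      \<open>f\<close>.\<close>
    have "V x \<le> V y - \<bar>f y - f x\<bar>"
      unfolding V_def[of x]
    proof (rule cSup_least[OF ne])
      fix v assume "v \<in> T x"
      then obtain xs where xs: "v = list_variation f xs" "sorted xs" "set xs \<subseteq> {0..x}"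
        by (auto simp: T_def)
      have "list_variation f (xs @ [x, y]) \<le> V y"
        by (rule upper) (use xs that in \<open>force simp: sorted_append\<close>)+
      then show "v \<le> V y - \<bar>f y - f x\<bar>"
        using list_variation_snoc2[of f xs x y] list_variation_snoc_le[of f xs x] xs by simp
    qed
    then show ?thesis by simp
  qed
  \<comment> \<open>Cut a nearly optimal partition of \<open>{0..y}\<close> at \<open>x\<close>: its
    left part costs at most \<open>V x\<close>, so its right part nearly attains
    \<open>V y - V x\<close>. The absolute continuity of \<open>V\<close> is thereby reduced to
    variations of \<open>f\<close> along finite lists.\<close>
  have approx: "\<exists>xs. sorted xs \<and> set xs \<subseteq> {x..y} \<and> V y - V x \<le> list_variation f xs + \<eta>"
    if xy: "0 \<le> x" "x \<le> y" "y \<le> 1" "\<eta> > 0" for x y \<eta>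
  proof -
    obtain v where "v \<in> T y" "V y - \<eta> < v"
      using less_cSup_iff[OF ne bdd, of y "V y - \<eta>"] xy by (auto simp: V_def)
    then obtain xs where xs: "V y - \<eta> < list_variation f xs" "sorted xs" "set xs \<subseteq> {0..y}"
      by (auto simp: T_def)
    have "list_variation f (filter (\<lambda>z. z \<le> x) xs @ [x]) \<le> V x"
      by (rule upper) (use xs that in \<open>auto simp: sorted_append sorted_wrt_filter\<close>)
    then have "V y - V x \<le> list_variation f (x # filter (\<lambda>z. x < z) xs) + \<eta>"
      using list_variation_split_le[OF xs(2), of f x] xs(1) by simp
    then show ?thesis
      using xs that by (intro exI[of _ "x # filter (\<lambda>z. x < z) xs"]) (auto simp: sorted_wrt_filter)
  qed
  have "abs_continuous_on {0..1} V"
    unfolding abs_continuous_on_def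
  proof (intro allI impI)
    fix e :: real assume e: "e > 0"
    obtain \<delta> where \<delta>: "\<delta> > 0" and
      D: "\<And>(n::nat) a b L. \<lbrakk>\<And>i. i < n \<Longrightarrow> a i \<le> b i \<and> {a i..b i} \<subseteq> {0..1};
        disjoint_family_on (\<lambda>k. {a k<..<b k}) {..<n}; (\<Sum>k<n. b k - a k) < \<delta>;
        \<And>i. i < n \<Longrightarrow> sorted (L i) \<and> set (L i) \<subseteq> {a i..b i}\<rbrakk>
      \<Longrightarrow> (\<Sum>i<n. list_variation f (L i)) < e/2"
      by (rule abs_continuous_on_list_variation[OF f half_gt_zero[OF e]]) blast
    show "\<exists>\<delta>>0. \<forall>(n::nat) a b. (\<forall>i<n. a i \<le> b i \<and> {a i..b i} \<subseteq> {0..1}) \<and>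
        disjoint_family_on (\<lambda>i. {a i<..<b i}) {..<n} \<and> (\<Sum>i<n. b i - a i) < \<delta>
        \<longrightarrow> (\<Sum>i<n. \<bar>V (b i) - V (a i)\<bar>) < e"
    proof (intro exI[of _ \<delta>] conjI allI impI \<delta>)
      fix n :: nat and a b :: "nat \<Rightarrow> real"
      assume A: "(\<forall>i<n. a i \<le> b i \<and> {a i..b i} \<subseteq> {0..1}) \<and>
        disjoint_family_on (\<lambda>i. {a i<..<b i}) {..<n} \<and> (\<Sum>i<n. b i - a i) < \<delta>"
      have ab: "0 \<le> a i" "a i \<le> b i" "b i \<le> 1" if "i < n" for i
        using A that by (auto simp: subset_iff)
      \<comment> \<open>The slack \<open>e/2\<close> is shared among the \<open>n\<close> intervals;
        \<open>n + 1\<close> covers \<open>n = 0\<close>.\<close>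
      define \<eta> where "\<eta> = e / (2 * (real n + 1))"
      have \<eta>: "\<eta> > 0" using e by (simp add: \<eta>_def)
      have "\<forall>i. \<exists>xs. i < n \<longrightarrow> sorted xs \<and> set xs \<subseteq> {a i..b i} \<and> V (b i) - V (a i) \<le> list_variation f xs + \<eta>"
        using approx[OF ab \<eta>] by blast
      then obtain L where L: "\<And>i. i < n \<Longrightarrow> sorted (L i) \<and> set (L i) \<subseteq> {a i..b i} \<and>
          V (b i) - V (a i) \<le> list_variation f (L i) + \<eta>" by metis
      have "(\<Sum>i<n. \<bar>V (b i) - V (a i)\<bar>) \<le> (\<Sum>i<n. list_variation f (L i) + \<eta>)"
      proof (rule sum_mono)
        fix i assume "i \<in> {..<n}"
        then show "\<bar>V (b i) - V (a i)\<bar> \<le> list_variation f (L i) + \<eta>"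
          using L[of i] jump[OF ab[of i]] by auto
      qed
      also have "\<dots> = (\<Sum>i<n. list_variation f (L i)) + real n * \<eta>"
        by (simp add: sum.distrib)
      also have "\<dots> < e/2 + real n * \<eta>"
        using D[of n a b L] A L by simp
      also have "\<dots> \<le> e"
        using e by (simp add: \<eta>_def field_simps)
      finally show "(\<Sum>i<n. \<bar>V (b i) - V (a i)\<bar>) < e" .
    qed
  qed
  then show thesis using that jump by blast
qed

subsection \<open>Absolutely continuous functions are indefinite integrals\<close>

text \<open>Cover the null set by countably many non-overlapping intervals of total length below
  \<open>\<delta>\<close>. The Stieltjes measure of an interval is an increment of \<open>F\<close>,
  so absolute continuity bounds every finite union by \<open>e\<close>, and continuity from below
  extends this to the whole cover.\<close>

lemma abs_continuous_on_null_interval_measure: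
  assumes F: "abs_continuous_on {0..1} F"
    and G_mono: "mono G" and G_cont: "continuous_on UNIV G" and FG: "\<And>x. x \<in> {0..1} \<Longrightarrow> G x = F x"
    and A: "A \<in> null_sets lborel"
  shows "emeasure (interval_measure G) (A \<inter> {0..1}) = 0"
proof -
  let ?\<mu> = "interval_measure G"
  have Icc: "emeasure ?\<mu> {a..b} = ennreal (G b - G a)" if "a \<le> b" for a b
    using emeasure_interval_measure_Icc[of a b G] that G_mono G_cont by (auto simp: mono_def)
  have "emeasure ?\<mu> (A \<inter> {0..1}) \<le> ennreal e" if e: "e > 0" for e
  proof -
    obtain \<delta> where \<delta>: "\<delta> > 0" and
      D: "\<And>(K::real set set) a b. \<lbrakk>finite K; \<And>k. k \<in> K \<Longrightarrow> a k \<le> b k \<and> {a k..b k} \<subseteq> {0..1};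
        disjoint_family_on (\<lambda>k. {a k<..<b k}) K; (\<Sum>k\<in>K. b k - a k) < \<delta>\<rbrakk>
      \<Longrightarrow> (\<Sum>k\<in>K. \<bar>F (b k) - F (a k)\<bar>) < e"
      by (rule abs_continuous_on_finite_family[OF F e]) blast
    have S: "A \<inter> {0..1} \<in> null_sets lborel"
      using A by (intro null_set_Int2) auto
    then have Sl: "A \<inter> {0..1} \<in> null_sets lebesgue"
      by (rule null_sets_completionI)
    then have neg: "negligible (A \<inter> {0..1})"
      by (simp add: negligible_iff_null_sets)
    obtain \<D> where \<D>: "countable \<D>"
        "\<And>K. K \<in> \<D> \<Longrightarrow> K \<subseteq> cbox 0 1 \<and> K \<noteq> {} \<and> (\<exists>c d. K = cbox c d)"
        "pairwise (\<lambda>A B. interior A \<inter> interior B = {}) \<D>"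
        "A \<inter> {0..1} \<subseteq> \<Union>\<D>" "\<Union>\<D> \<in> lmeasurable"
        "measure lebesgue (\<Union>\<D>) \<le> measure lebesgue (A \<inter> {0..1}) + \<delta>/2"
    proof (rule measurable_outer_intervals_bounded[of "A \<inter> {0..1}" 0 1 "\<delta>/2"])
      show "A \<inter> {0..1} \<in> lmeasurable" using neg by (rule negligible_imp_measurable)
      show "A \<inter> {0..1} \<subseteq> cbox 0 1" by auto
      show "0 < \<delta>/2" using \<delta> by simp
    qed blast
    have small: "measure lebesgue (\<Union>\<D>) \<le> \<delta>/2"
      using \<D>(6) negligible_imp_measure0[OF neg] by simp
    \<comment> \<open>Each interval is recovered from its infimum and supremum, so the intervals can
      serve as their own index set.\<close>
    have K: "K = {Inf K..Sup K}" "Inf K \<le> Sup K" "{Inf K..Sup K} \<subseteq> {0..1}" if KD: "K \<in> \<D>" for K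
    proof -
      obtain c d where cd: "K = {c..d}" "K \<noteq> {}" "K \<subseteq> {0..1}" using \<D>(2)[OF KD] by auto
      then have "c \<le> d" by auto
      then show "K = {Inf K..Sup K}" "Inf K \<le> Sup K" "{Inf K..Sup K} \<subseteq> {0..1}" using cd by auto
    qed
    have fin: "emeasure ?\<mu> (\<Union>\<F>) \<le> ennreal e" if \<F>: "finite \<F>" "\<F> \<subseteq> \<D>" for \<F>
    proof -
      have lm: "K \<in> lmeasurable" if "K \<in> \<F>" for K
        using K(1)[of K] that \<F> by (metis lmeasurable_cbox cbox_interval subsetD)
      have pw: "interior K \<inter> interior L = {}" if "K \<in> \<F>" "L \<in> \<F>" "K \<noteq> L" for K L
        using \<D>(3) that \<F> unfolding pairwise_def by blast
      have int: "interior K = {Inf K<..<Sup K}" if "K \<in> \<F>" for K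
        using K(1)[of K] that \<F> by (metis interior_atLeastAtMost_real subsetD)
      \<comment> \<open>Lengths add up to the measure of the union because two intervals with
        disjoint interiors share at most one point.\<close>
      have "(\<Sum>K\<in>\<F>. Sup K - Inf K) = (\<Sum>K\<in>\<F>. measure lebesgue K)"
      proof (rule sum.cong[OF refl])
        fix K assume "K \<in> \<F>"
        then have "K \<in> \<D>" using \<F> by blast
        have "measure lebesgue {Inf K..Sup K} = Sup K - Inf K"
          using K(2)[OF \<open>K \<in> \<D>\<close>] by (simp add: measure_completion)
        then show "Sup K - Inf K = measure lebesgue K"
          using K(1)[OF \<open>K \<in> \<D>\<close>] by simp
      qed
      also have "\<dots> = measure lebesgue (\<Union>\<F>)"
      proof (rule measure_negligible_finite_Union[OF \<F>(1) lm, symmetric])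
        show "pairwise (\<lambda>S T. negligible (S \<inter> T)) \<F>"
          unfolding pairwise_def
        proof (intro ballI impI)
          fix S T assume ST: "S \<in> \<F>" "T \<in> \<F>" "S \<noteq> T"
          obtain a b c d where "S = {a..b}" "T = {c..d}" using K(1) ST \<F> by blast
          then have "S \<inter> T = {max a c..min b d}" by auto
          moreover have "interior (S \<inter> T) = {}" using pw[OF ST] by simp
          ultimately have "\<not> max a c < min b d"
            by (metis interior_atLeastAtMost_real greaterThanLessThan_empty_iff not_le)
          then show "negligible (S \<inter> T)"
            using \<open>S \<inter> T = {max a c..min b d}\<close>
            by (cases "max a c = min b d") (auto simp del: max.bounded_iff min.bounded_iff)
        qed
      qed
      also have "\<dots> \<le> measure lebesgue (\<Union>\<D>)"
        using \<F> lm \<D>(5) by (intro measure_mono_fmeasurable) auto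
      finally have lt: "(\<Sum>K\<in>\<F>. Sup K - Inf K) < \<delta>" using small \<delta> by simp
      have sets: "K \<in> sets ?\<mu>" if "K \<in> \<F>" for K
        using K(1)[of K] that \<F> by (metis atLeastAtMost_borel sets_interval_measure subsetD)
      have "emeasure ?\<mu> (\<Union>\<F>) \<le> (\<Sum>K\<in>\<F>. emeasure ?\<mu> K)"
        using emeasure_subadditive_finite[OF \<F>(1), of "\<lambda>x. x" ?\<mu>] sets by auto
      also have "\<dots> = (\<Sum>K\<in>\<F>. ennreal \<bar>F (Sup K) - F (Inf K)\<bar>)"
      proof (rule sum.cong[OF refl])
        fix K assume "K \<in> \<F>"
        then have KD: "K \<in> \<D>" using \<F> by blast
        have "G (Inf K) \<le> G (Sup K)" using K(2)[OF KD] G_mono by (simp add: mono_def)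
        moreover have "Inf K \<in> {0..1}" "Sup K \<in> {0..1}" using K(2,3)[OF KD] by auto
        ultimately show "emeasure ?\<mu> K = ennreal \<bar>F (Sup K) - F (Inf K)\<bar>"
          using Icc[OF K(2)[OF KD]] K(1)[OF KD] FG by (metis abs_of_nonneg diff_ge_0_iff_ge)
      qed
      also have "\<dots> = ennreal (\<Sum>K\<in>\<F>. \<bar>F (Sup K) - F (Inf K)\<bar>)"
        by (rule sum_ennreal) simp
      also have "(\<Sum>K\<in>\<F>. \<bar>F (Sup K) - F (Inf K)\<bar>) \<le> e"
        by (rule less_imp_le, rule D) (use \<F> K lt pw int in \<open>auto simp: disjoint_family_on_def subset_iff\<close>)
      finally show ?thesis by (simp add: ennreal_leI)
    qed
    show ?thesis
    proof (cases "\<D> = {}")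
      case True
      then show ?thesis using \<D>(4) by simp
    next
      case False
      \<comment> \<open>\<open>from_nat_into\<close> may repeat members when the cover is finite;
        this is harmless, because \<open>E n\<close> is the union over an image set.\<close>
      define E where "E n = \<Union>(from_nat_into \<D> ` {..<n})" for n
      have sub: "from_nat_into \<D> ` {..<n} \<subseteq> \<D>" for n
        using from_nat_into[OF False] by auto
      have "from_nat_into \<D> i \<in> sets borel" for i
        using K(1)[OF from_nat_into[OF False]] by (metis atLeastAtMost_borel)
      then have Eb: "range E \<subseteq> sets ?\<mu>" unfolding E_def by auto
      have inc: "incseq E" unfolding E_def by (intro incseq_SucI) (auto simp: lessThan_Suc)
      have "\<Union>\<D> \<subseteq> (\<Union>n. E n)"
        using subset_range_from_nat_into[OF \<D>(1)] unfolding E_def by fastforce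
      then have "emeasure ?\<mu> (A \<inter> {0..1}) \<le> emeasure ?\<mu> (\<Union>n. E n)"
        using \<D>(4) Eb by (intro emeasure_mono) auto
      also have "\<dots> = (SUP n. emeasure ?\<mu> (E n))"
        using SUP_emeasure_incseq[OF Eb inc] by simp
      also have "\<dots> \<le> ennreal e"
        using fin[OF _ sub] unfolding E_def by (intro SUP_least) auto
      finally show ?thesis .
    qed
  qed
  then show ?thesis
    by (metis ennreal_le_epsilon add_0 le_zero_eq)
qed

text \<open>Lebesgue differentiation in its explicit form controls averages over
  \<open>{x..x+h}\<close>, that is, to the right. Averages to the left come from the reflected
  function \<open>g (- t)\<close>, whose exceptional set is carried back by
  \<open>uminus\<close>.\<close>

lemma indefinite_integral_AE_derivative:
  fixes g :: "real \<Rightarrow> real"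
  assumes g: "integrable lborel g"
    and f: "\<And>a b. \<lbrakk>c \<le> a; a \<le> b; b \<le> d\<rbrakk> \<Longrightarrow> (LINT t|lborel. indicator {a..b} t * g t) = f b - f a"
  shows "AE t in lebesgue. t \<in> {c<..<d} \<longrightarrow> (f has_real_derivative g t) (at t)"
proof -
  have int: "g integrable_on {a..b}" "integral {a..b} g = (LINT t|lborel. indicator {a..b} t * g t)" for a b
  proof -
    have "set_integrable lborel {a..b} g"
      unfolding set_integrable_def using g by (intro integrable_mult_indicator) auto
    from set_borel_integral_eq_integral[OF this]
    show "g integrable_on {a..b}" "integral {a..b} g = (LINT t|lborel. indicator {a..b} t * g t)"
      by (auto simp: set_lebesgue_integral_def)
  qed
  have int': "(\<lambda>t. g (- t)) integrable_on {a..b}" for a b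
    using Henstock_Kurzweil_Integration.integrable_reflect_real[where f=g and a="-b" and b="-a"] int(1)[of "-b" "-a"] by simp
  obtain N where N: "negligible N" "\<And>x e. \<lbrakk>x \<notin> N; 0 < e\<rbrakk> \<Longrightarrow>
       \<exists>r>0. \<forall>h. 0 < h \<and> h < r \<longrightarrow> norm(integral (cbox x (x + h *\<^sub>R One)) g /\<^sub>R h ^ DIM(real) - g x) < e"
    by (rule integrable_ccontinuous_explicit[of g]) (use int(1) in auto)
  obtain N' where N': "negligible N'" "\<And>x e. \<lbrakk>x \<notin> N'; 0 < e\<rbrakk> \<Longrightarrow>
       \<exists>r>0. \<forall>h. 0 < h \<and> h < r \<longrightarrow> norm(integral (cbox x (x + h *\<^sub>R One)) (\<lambda>t. g (- t)) /\<^sub>R h ^ DIM(real) - g (- x)) < e"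
    by (rule integrable_ccontinuous_explicit[of "\<lambda>t. g (- t)"]) (use int' in auto)
  have neg: "negligible (N \<union> uminus ` N')"
    by (intro negligible_Un N(1) negligible_differentiable_image_negligible[OF order_refl N'(1)]
        differentiable_on_minus differentiable_on_ident)
  have "(f has_real_derivative g t) (at t)" if t: "t \<in> {c<..<d}" "t \<notin> N \<union> uminus ` N'" for t
  proof -
    have "\<exists>r>0. \<forall>y. 0 < \<bar>y - t\<bar> \<and> \<bar>y - t\<bar> < r \<longrightarrow> \<bar>(f y - f t) / (y - t) - g t\<bar> < e" if e: "e > 0" for e
    proof -
      obtain r1 where r1: "r1 > 0" "\<And>h. 0 < h \<and> h < r1 \<Longrightarrow> \<bar>integral {t..t + h} g / h - g t\<bar> < e"
        using N(2)[of t e] t e by (auto simp: divide_inverse mult.commute)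
      have "- t \<notin> N'" using t(2) by force
      then obtain r2 where r2: "r2 > 0" "\<And>h. 0 < h \<and> h < r2 \<Longrightarrow>
          \<bar>integral {- t..- t + h} (\<lambda>t. g (- t)) / h - g t\<bar> < e"
        using N'(2)[of "- t" e] e by (auto simp: divide_inverse mult.commute)
      show ?thesis
      proof (intro exI[of _ "min (min r1 r2) (min (t - c) (d - t))"] conjI allI impI)
        fix y assume y: "0 < \<bar>y - t\<bar> \<and> \<bar>y - t\<bar> < min (min r1 r2) (min (t - c) (d - t))"
        show "\<bar>(f y - f t) / (y - t) - g t\<bar> < e"
        proof (cases "t < y")
          case True
          then have "integral {t..t + (y - t)} g = f y - f t"
            using int(2) f[of t y] y t by auto
          then show ?thesis using r1(2)[of "y - t"] y True by auto
        next
          case False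
          have "integral {- t..- t + (t - y)} (\<lambda>t. g (- t)) = integral {y..t} g"
            using integral_reflect_real[of t y] by simp
          also have "\<dots> = f t - f y"
            using int(2) f[of y t] y t False by auto
          finally show ?thesis using r2(2)[of "t - y"] y False
            by (auto simp: field_simps)
        qed
      qed (use r1(1) r2(1) t in auto)
    qed
    then show ?thesis
      unfolding has_field_derivative_iff LIM_def by (auto simp: dist_real_def)
  qed
  then have "{t. \<not> (t \<in> {c<..<d} \<longrightarrow> (f has_real_derivative g t) (at t))} \<subseteq> N \<union> uminus ` N'"
    by blast
  then show ?thesis
    using neg by (intro AE_I'[of "N \<union> uminus ` N'"]) (auto simp: negligible_iff_null_sets)
qed

text \<open>The density is the Radon-Nikodym derivative of the Stieltjes measure of
  \<open>F\<close>; the preceding null set lemma supplies the required absolute continuity of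
  measures.\<close>

lemma mono_abs_continuous_on_density:
  assumes F: "abs_continuous_on {0..1} F"
    and F_mono: "\<And>x y. \<lbrakk>0 \<le> x; x \<le> y; y \<le> 1\<rbrakk> \<Longrightarrow> F x \<le> F y"
  obtains g :: "real \<Rightarrow> real" where "integrable lborel g"
    "\<And>a b. \<lbrakk>0 \<le> a; a \<le> b; b \<le> 1\<rbrakk> \<Longrightarrow> (LINT t|lborel. indicator {a..b} t * g t) = F b - F a"
proof -
  \<comment> \<open>Constant extension beyond \<open>0\<close> and \<open>1\<close> keeps
    \<open>F\<close> monotone and continuous on the whole line, as \<open>interval_measure\<close>
    demands, and puts no mass outside.\<close>
  define G where "G x = F (max 0 (min 1 x))" for x
  have G_mono: "mono G" unfolding mono_def G_def by (auto intro!: F_mono)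
  have G_cont: "continuous_on UNIV G"
    unfolding G_def
    by (rule continuous_on_compose2[OF abs_continuous_on_imp_continuous_on[OF F]])
       (auto intro!: continuous_intros)
  have FG: "G x = F x" if "x \<in> {0..1}" for x using that by (simp add: G_def)
  let ?\<mu> = "interval_measure G"
  let ?N = "density ?\<mu> (indicator {0..1})"
  have em: "emeasure ?N A = emeasure ?\<mu> (A \<inter> {0..1})" if "A \<in> sets borel" for A
  proof -
    have "emeasure ?N A = (\<integral>\<^sup>+ x. indicator {0..1} x * indicator A x \<partial>?\<mu>)"
      using that by (simp add: emeasure_density)
    also have "\<dots> = (\<integral>\<^sup>+ x. indicator (A \<inter> {0..1}) x \<partial>?\<mu>)"
      by (intro nn_integral_cong) (auto simp: indicator_def)
    also have "\<dots> = emeasure ?\<mu> (A \<inter> {0..1})"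
      using that by simp
    finally show ?thesis .
  qed
  have "absolutely_continuous lborel ?N"
    unfolding absolutely_continuous_def
  proof
    fix A :: "real set" assume A: "A \<in> null_sets lborel"
    then have "A \<in> sets borel" by auto
    then show "A \<in> null_sets ?N"
      using em abs_continuous_on_null_interval_measure[OF F G_mono G_cont FG A]
      by (auto simp: null_sets_def)
  qed
  then obtain h where h: "h \<in> borel_measurable lborel" "density lborel h = ?N"
    using sigma_finite_measure.Radon_Nikodym[OF sigma_finite_lborel, of ?N] by auto
  have hI: "(\<integral>\<^sup>+t. h t * indicator {a..b} t \<partial>lborel) = ennreal (F b - F a)"
    if "0 \<le> a" "a \<le> b" "b \<le> 1" for a b
  proof -
    have "(\<integral>\<^sup>+t. h t * indicator {a..b} t \<partial>lborel) = emeasure ?N {a..b}"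
      unfolding h(2)[symmetric] using h(1) by (subst emeasure_density) auto
    also have "\<dots> = emeasure ?\<mu> {a..b}"
      using em[of "{a..b}"] that by (simp add: Int_absorb2)
    also have "\<dots> = ennreal (G b - G a)"
      using emeasure_interval_measure_Icc[of a b G] that G_mono G_cont by (auto simp: mono_def)
    finally show ?thesis using FG that by simp
  qed
  have "(\<integral>\<^sup>+t. h t \<partial>lborel) = emeasure (density lborel h) UNIV"
    using h(1) by (subst emeasure_density) auto
  also have "\<dots> = emeasure ?\<mu> {0..1}" using em[of UNIV] h(2) by simp
  also have "\<dots> = ennreal (G 1 - G 0)"
    using emeasure_interval_measure_Icc[of 0 1 G] G_mono G_cont by (auto simp: mono_def)
  finally have hfin: "(\<integral>\<^sup>+t. h t \<partial>lborel) < \<infinity>" by simp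
  \<comment> \<open>The total mass is finite, so \<open>h\<close> is finite almost everywhere and
    \<open>enn2real\<close> changes it on a null set at most.\<close>
  have hAE: "AE t in lborel. ennreal (enn2real (h t)) = h t"
    using nn_integral_PInf_AE[of h lborel] h hfin by (auto simp: less_top elim!: eventually_mono)
  define g where "g t = enn2real (h t)" for t
  have gm[measurable]: "g \<in> borel_measurable lborel" unfolding g_def using h by measurable
  have g_int: "integrable lborel g"
  proof (rule integrableI_nonneg[OF gm])
    show "AE t in lborel. 0 \<le> g t" by (simp add: g_def)
    have "(\<integral>\<^sup>+t. ennreal (g t) \<partial>lborel) = (\<integral>\<^sup>+t. h t \<partial>lborel)"
      unfolding g_def by (rule nn_integral_cong_AE[OF hAE])
    then show "(\<integral>\<^sup>+t. ennreal (g t) \<partial>lborel) < \<infinity>" using hfin by simp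
  qed
  show thesis
  proof (rule that[OF g_int])
    fix a b :: real assume ab: "0 \<le> a" "a \<le> b" "b \<le> 1"
    have "(\<integral>\<^sup>+t. ennreal (indicator {a..b} t * g t) \<partial>lborel) = (\<integral>\<^sup>+t. h t * indicator {a..b} t \<partial>lborel)"
      unfolding g_def
      by (rule nn_integral_cong_AE) (use hAE in \<open>auto simp: indicator_def elim!: eventually_mono\<close>)
    then have "(\<integral>\<^sup>+t. ennreal (indicator {a..b} t * g t) \<partial>lborel) = ennreal (F b - F a)"
      using hI[OF ab] by simp
    moreover have "0 \<le> F b - F a" using F_mono[OF ab] by simp
    ultimately show "(LINT t|lborel. indicator {a..b} t * g t) = F b - F a"
      using gm by (subst integral_eq_nn_integral) (auto simp: g_def[symmetric], simp add: g_def)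
  qed
qed

text \<open>Write \<open>f = V - (V - f)\<close>, where the increments of \<open>V\<close> dominate
  those of \<open>f\<close>. Both terms are monotone and absolutely continuous, so the difference of
  their densities integrates to \<open>f\<close>, and differentiating this integral identifies the
  derivative.\<close>

theorem abs_continuous_on_indefinite_integral:
  assumes f: "abs_continuous_on {0..1} f"
  obtains g :: "real \<Rightarrow> real" where "integrable (lebesgue_on {0..1}) g"
    "\<And>a b. \<lbrakk>0 \<le> a; a \<le> b; b \<le> 1\<rbrakk> \<Longrightarrow> (LINT t|lebesgue_on {0..1}. indicator {a..b} t * g t) = f b - f a"
    "AE t in lebesgue_on {0..1}. (f has_real_derivative g t) (at t)"
proof -
  obtain V where V: "abs_continuous_on {0..1} V"
    "\<And>x y. \<lbrakk>0 \<le> x; x \<le> y; y \<le> 1\<rbrakk> \<Longrightarrow> \<bar>f y - f x\<bar> \<le> V y - V x"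
    using abs_continuous_on_monotone_decomposition[OF f] by blast
  have W: "abs_continuous_on {0..1} (\<lambda>x. V x + - f x)"
    by (intro abs_continuous_on_add V abs_continuous_on_minus f)
  obtain v where v: "integrable lborel v"
    "\<And>a b. \<lbrakk>0 \<le> a; a \<le> b; b \<le> 1\<rbrakk> \<Longrightarrow> (LINT t|lborel. indicator {a..b} t * v t) = V b - V a"
  proof (rule mono_abs_continuous_on_density[OF V(1)])
    fix x y :: real assume "0 \<le> x" "x \<le> y" "y \<le> 1"
    then show "V x \<le> V y" using V(2)[of x y] by linarith
  qed blast
  obtain w where w: "integrable lborel w"
    "\<And>a b. \<lbrakk>0 \<le> a; a \<le> b; b \<le> 1\<rbrakk> \<Longrightarrow>
      (LINT t|lborel. indicator {a..b} t * w t) = (V b + - f b) - (V a + - f a)"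
  proof (rule mono_abs_continuous_on_density[OF W])
    fix x y :: real assume "0 \<le> x" "x \<le> y" "y \<le> 1"
    then show "V x + - f x \<le> V y + - f y" using V(2)[of x y] by linarith
  qed blast
  define g where "g t = v t - w t" for t
  have g: "integrable lborel g" unfolding g_def by (intro Bochner_Integration.integrable_diff v w)
  have gI: "(LINT t|lborel. indicator {a..b} t * g t) = f b - f a" if "0 \<le> a" "a \<le> b" "b \<le> 1" for a b
  proof -
    have "integrable lborel (\<lambda>t. indicator {a..b} t * v t)" "integrable lborel (\<lambda>t. indicator {a..b} t * w t)"
      using integrable_mult_indicator[OF _ v(1), of "{a..b}"]
        integrable_mult_indicator[OF _ w(1), of "{a..b}"] by auto
    then show ?thesis
      using v(2)[OF that] w(2)[OF that] by (simp add: g_def right_diff_distrib)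
  qed
  have gl: "integrable lebesgue g"
    using g by (simp add: integrable_completion)
  show thesis
  proof (rule that)
    show "integrable (lebesgue_on {0..1}) g"
      using integrable_mult_indicator[OF _ gl, of "{0..1}"] by (simp add: integrable_restrict_space)
    fix a b :: real assume ab: "0 \<le> a" "a \<le> b" "b \<le> 1"
    have "(LINT t|lebesgue_on {0..1}. indicator {a..b} t * g t)
        = (LINT t|lebesgue. indicator {a..b} t * g t)"
      using ab by (auto simp: integral_restrict_space indicator_def intro!: Bochner_Integration.integral_cong)
    also have "\<dots> = (LINT t|lborel. indicator {a..b} t * g t)"
      using g by (intro integral_completion) auto
    finally show "(LINT t|lebesgue_on {0..1}. indicator {a..b} t * g t) = f b - f a"
      using gI[OF ab] by simp
  next
    \<comment> \<open>The derivative is two-sided, so it is obtained in the open interval; the end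
      points form a null set.\<close>
    have "AE t in lebesgue. t \<in> {0<..<1} \<longrightarrow> (f has_real_derivative g t) (at t)"
      by (rule indefinite_integral_AE_derivative[OF g gI])
    moreover have "AE t in lebesgue. t \<noteq> 0 \<and> t \<noteq> (1::real)"
      by (intro AE_conjI AE_completion AE_lborel_singleton)
    ultimately have "AE t in lebesgue. t \<in> {0..1} \<longrightarrow> (f has_real_derivative g t) (at t)"
      by eventually_elim auto
    then show "AE t in lebesgue_on {0..1}. (f has_real_derivative g t) (at t)"
      by (simp add: AE_restrict_space_iff)
  qed
qed

subsection \<open>Functions of finite Dirichlet energy\<close>

abbreviation unit_measure :: "real measure" where
  "unit_measure \<equiv> lebesgue_on {0..1}"

lemma emeasure_unit_measure_subset:
  assumes "A \<in> sets borel" "A \<subseteq> {0..1}"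
  shows "emeasure unit_measure A = emeasure lborel A"
  using assms by (subst emeasure_restrict_space) (auto simp: emeasure_completion)

lemma finite_measure_unit: "finite_measure unit_measure"
  by (rule finite_measureI) (simp add: emeasure_restrict_space)

lemma measure_unit_measure_space: "measure unit_measure {0..1} = 1"
  by (simp add: measure_def emeasure_unit_measure_subset)

lemma integrable_unit_bounded:
  fixes f :: "real \<Rightarrow> real"
  assumes "f \<in> borel_measurable unit_measure" "\<And>t. t \<in> {0..1} \<Longrightarrow> \<bar>f t\<bar> \<le> B"
  shows "integrable unit_measure f"
  by (rule finite_measure.integrable_const_bound[OF finite_measure_unit, where B=B])
     (use assms in \<open>auto intro!: AE_I2\<close>)

lemma continuous_imp_measurable_unit:
  fixes f :: "real \<Rightarrow> real"
  assumes "continuous_on {0..1} f"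
  shows "f \<in> borel_measurable unit_measure"
  using assms by (intro continuous_imp_measurable_on_sets_lebesgue) auto

lemma AE_unit_neq: "AE t in unit_measure. t \<noteq> c"
proof -
  have "AE t in lebesgue. t \<noteq> (c::real)" by (intro AE_completion AE_lborel_singleton)
  then show ?thesis by (subst AE_restrict_space_iff) (auto elim: eventually_mono)
qed

lemma integrable_unit_indicator:
  fixes g :: "real \<Rightarrow> real"
  assumes "integrable unit_measure g" "A \<in> sets borel"
  shows "integrable unit_measure (\<lambda>t. indicator A t * g t)"
proof (rule Bochner_Integration.integrable_bound[OF assms(1)])
  have "(indicator A :: real \<Rightarrow> real) \<in> borel_measurable unit_measure"
    using assms(2) by (intro measurable_restrict_space1 measurable_completion) simp
  then show "(\<lambda>t. indicator A t * g t) \<in> borel_measurable unit_measure"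
    using assms(1) by (intro borel_measurable_times) auto
  show "AE t in unit_measure. norm (indicator A t * g t) \<le> norm (g t)"
    by (intro AE_I2) (simp add: indicator_def)
qed

text \<open>Kept apart from \<open>ac_derivative\<close>: the integral identity is linear and enough
  for energy bounds, so it is the form in which test functions enter. The pointwise derivative is
  added where a chain rule or \<open>deriv\<close> is involved.\<close>

definition primitive_of :: "(real \<Rightarrow> real) \<Rightarrow> (real \<Rightarrow> real) \<Rightarrow> bool" where
  "primitive_of f g \<longleftrightarrow> integrable unit_measure g \<and>
     (\<forall>a b. 0 \<le> a \<longrightarrow> a \<le> b \<longrightarrow> b \<le> 1 \<longrightarrow>
        (LINT t|unit_measure. indicator {a..b} t * g t) = f b - f a)"

definition ac_derivative :: "(real \<Rightarrow> real) \<Rightarrow> (real \<Rightarrow> real) \<Rightarrow> bool" where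
  "ac_derivative f g \<longleftrightarrow> primitive_of f g \<and>
     (AE t in unit_measure. (f has_real_derivative g t) (at t))"

lemma abs_continuous_on_obtain_derivative:
  assumes "abs_continuous_on {0..1} f"
  obtains g where "ac_derivative f g"
proof (rule abs_continuous_on_indefinite_integral[OF assms])
  fix g assume "integrable unit_measure g"
    "\<And>a b. \<lbrakk>0 \<le> a; a \<le> b; b \<le> 1\<rbrakk> \<Longrightarrow> (LINT t|unit_measure. indicator {a..b} t * g t) = f b - f a"
    "AE t in unit_measure. (f has_real_derivative g t) (at t)"
  then show thesis by (intro that[of g]) (simp add: ac_derivative_def primitive_of_def)
qed

text \<open>F. Riesz's criterion for a square integrable derivative. An interval with
  \<open>a i = b i\<close> contributes \<open>0\<close>, by division by zero.\<close>

definition energy_bound :: "(real \<Rightarrow> real) \<Rightarrow> real \<Rightarrow> bool" where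
  "energy_bound f B \<longleftrightarrow>
     (\<forall>(n::nat) (a :: nat \<Rightarrow> real) (b :: nat \<Rightarrow> real).
        (\<forall>i<n. a i \<le> b i \<and> {a i..b i} \<subseteq> {0..1}) \<and> disjoint_family_on (\<lambda>i. {a i<..<b i}) {..<n}
        \<longrightarrow> (\<Sum>i<n. (f (b i) - f (a i))\<^sup>2 / (b i - a i)) \<le> B)"

lemma energy_bound_nonneg: "energy_bound f B \<Longrightarrow> 0 \<le> B"
  unfolding energy_bound_def by (drule spec[of _ 0]) (auto simp: disjoint_family_on_def)

text \<open>With \<open>c = (f b - f a) / (b - a)\<close>, integrate \<open>2 c g - c\<^sup>2 \<le> g\<^sup>2\<close> over \<open>{a..b}\<close>.\<close>

lemma difference_quotient_le_energy:
  assumes g: "primitive_of f g" and g2: "integrable unit_measure (\<lambda>t. (g t)\<^sup>2)"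
    and ab: "0 \<le> a" "a \<le> b" "b \<le> 1"
  shows "(f b - f a)\<^sup>2 / (b - a) \<le> (LINT t|unit_measure. indicator {a<..<b} t * (g t)\<^sup>2)"
proof (cases "a = b")
  case False
  then have lt: "a < b" using ab by simp
  define c where "c = (f b - f a) / (b - a)"
  have gi: "integrable unit_measure g" using g by (simp add: primitive_of_def)
  have one: "(LINT t|unit_measure. indicator {a..b} t) = b - a"
    using ab by (simp add: measure_def emeasure_unit_measure_subset)
  have ii: "integrable unit_measure (\<lambda>t. indicator {a..b} t * (1::real))"
    by (rule integrable_unit_indicator) (auto intro: integrable_unit_bounded)
  have "(f b - f a)\<^sup>2 / (b - a) = 2 * c * (f b - f a) - c\<^sup>2 * (b - a)"
  proof -
    have "f b - f a = c * (b - a)" using lt by (simp add: c_def)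
    then show ?thesis using lt unfolding \<open>f b - f a = c * (b - a)\<close>
      by (simp add: power2_eq_square field_simps)
  qed
  also have "\<dots> = 2 * c * (LINT t|unit_measure. indicator {a..b} t * g t)
      - c\<^sup>2 * (LINT t|unit_measure. indicator {a..b} t)"
    using g ab one by (simp add: primitive_of_def)
  also have "\<dots> = (LINT t|unit_measure. 2 * c * (indicator {a..b} t * g t) - c\<^sup>2 * indicator {a..b} t)"
    using integrable_unit_indicator[OF gi, of "{a..b}"] ii
    by (subst Bochner_Integration.integral_diff) auto
  also have "\<dots> \<le> (LINT t|unit_measure. indicator {a<..<b} t * (g t)\<^sup>2)"
  proof (rule integral_mono_AE)
    show "integrable unit_measure (\<lambda>t. 2 * c * (indicator {a..b} t * g t) - c\<^sup>2 * indicator {a..b} t)"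
      using integrable_unit_indicator[OF gi, of "{a..b}"] ii
      by (intro Bochner_Integration.integrable_diff integrable_mult_right) auto
    show "integrable unit_measure (\<lambda>t. indicator {a<..<b} t * (g t)\<^sup>2)"
      using g2 by (intro integrable_unit_indicator) auto
    \<comment> \<open>The left side lives on the closed interval, the right side on the open one,
      which is the version that is disjoint over a family; the two differ at the null points
      \<open>a\<close> and \<open>b\<close>.\<close>
    show "AE t in unit_measure. 2 * c * (indicator {a..b} t * g t) - c\<^sup>2 * indicator {a..b} t
        \<le> indicator {a<..<b} t * (g t)\<^sup>2"
      using AE_unit_neq[of a] AE_unit_neq[of b]
    proof eventually_elim
      case (elim t)
      have "0 \<le> (g t - c)\<^sup>2" by simp
      then show ?case using elim by (auto simp: indicator_def power2_eq_square algebra_simps)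
    qed
  qed
  finally show ?thesis .
qed (simp add: integral_nonneg_AE)

lemma energy_bound_integral:
  assumes g: "primitive_of f g" and g2: "integrable unit_measure (\<lambda>t. (g t)\<^sup>2)"
  shows "energy_bound f (LINT t|unit_measure. (g t)\<^sup>2)"
  unfolding energy_bound_def
proof (intro allI impI)
  fix n :: nat and a b :: "nat \<Rightarrow> real"
  assume A: "(\<forall>i<n. a i \<le> b i \<and> {a i..b i} \<subseteq> {0..1}) \<and> disjoint_family_on (\<lambda>i. {a i<..<b i}) {..<n}"
  have int: "integrable unit_measure (\<lambda>t. indicator {a i<..<b i} t * (g t)\<^sup>2)" for i
    using g2 by (intro integrable_unit_indicator) auto
  have "(\<Sum>i<n. (f (b i) - f (a i))\<^sup>2 / (b i - a i))
      \<le> (\<Sum>i<n. LINT t|unit_measure. indicator {a i<..<b i} t * (g t)\<^sup>2)"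
    using A by (intro sum_mono difference_quotient_le_energy[OF g g2]) (auto simp: subset_iff)
  also have "\<dots> = (LINT t|unit_measure. (\<Sum>i<n. indicator {a i<..<b i} t * (g t)\<^sup>2))"
    using int by (subst Bochner_Integration.integral_sum) auto
  also have "\<dots> \<le> (LINT t|unit_measure. (g t)\<^sup>2)"
  proof (rule integral_mono[OF Bochner_Integration.integrable_sum g2])
    fix t
    have "(\<Sum>i<n. indicator {a i<..<b i} t) = (indicator (\<Union>i<n. {a i<..<b i}) t :: real)"
      using A by (subst indicator_UN_disjoint) auto
    also have "\<dots> \<le> 1" by (simp add: indicator_def)
    finally show "(\<Sum>i<n. indicator {a i<..<b i} t * (g t)\<^sup>2) \<le> (g t)\<^sup>2"
      by (simp add: sum_distrib_right[symmetric] mult_left_le_one_le sum_nonneg)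
  qed (rule int)
  finally show "(\<Sum>i<n. (f (b i) - f (a i))\<^sup>2 / (b i - a i)) \<le> (LINT t|unit_measure. (g t)\<^sup>2)" .
qed

text \<open>Cauchy-Schwarz: the square of the sum of increments is at most \<open>B\<close> times
  the total length. This dictates \<open>\<delta> = e\<^sup>2 / (B + 1)\<close>, where the
  \<open>1\<close> allows for \<open>B = 0\<close>.\<close>

lemma energy_bound_abs_continuous_on:
  assumes f: "energy_bound f B"
  shows "abs_continuous_on {0..1} f"
  unfolding abs_continuous_on_def
proof (intro allI impI)
  fix e :: real assume e: "e > 0"
  have B: "0 \<le> B" using f by (rule energy_bound_nonneg)
  show "\<exists>\<delta>>0. \<forall>(n::nat) a b. (\<forall>i<n. a i \<le> b i \<and> {a i..b i} \<subseteq> {0..1}) \<and>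
        disjoint_family_on (\<lambda>i. {a i<..<b i}) {..<n} \<and> (\<Sum>i<n. b i - a i) < \<delta>
        \<longrightarrow> (\<Sum>i<n. \<bar>f (b i) - f (a i)\<bar>) < e"
  proof (intro exI[of _ "e\<^sup>2 / (B + 1)"] conjI allI impI)
    show "0 < e\<^sup>2 / (B + 1)" using e B by simp
    fix n :: nat and a b :: "nat \<Rightarrow> real"
    assume A: "(\<forall>i<n. a i \<le> b i \<and> {a i..b i} \<subseteq> {0..1}) \<and>
        disjoint_family_on (\<lambda>i. {a i<..<b i}) {..<n} \<and> (\<Sum>i<n. b i - a i) < e\<^sup>2 / (B + 1)"
    have ab: "a i \<le> b i" if "i < n" for i using A that by blast
    have len: "(\<Sum>i<n. b i - a i) \<le> e\<^sup>2 / (B + 1)" "0 \<le> (\<Sum>i<n. b i - a i)"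
    proof -
      show "(\<Sum>i<n. b i - a i) \<le> e\<^sup>2 / (B + 1)" using A by (meson less_imp_le)
      show "0 \<le> (\<Sum>i<n. b i - a i)" using ab by (intro sum_nonneg) simp
    qed
    have bd: "(\<Sum>i<n. (f (b i) - f (a i))\<^sup>2 / (b i - a i)) \<le> B"
      using f A unfolding energy_bound_def by blast
    have summand: "\<bar>f (b i) - f (a i)\<bar> = (\<bar>f (b i) - f (a i)\<bar> / sqrt (b i - a i)) * sqrt (b i - a i)"
      if "i < n" for i
      using ab[OF that] by (cases "a i = b i") auto
    have sq: "(\<bar>f (b i) - f (a i)\<bar> / sqrt (b i - a i))\<^sup>2 = (f (b i) - f (a i))\<^sup>2 / (b i - a i)"
      "(sqrt (b i - a i))\<^sup>2 = b i - a i" if "i < n" for i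
      using ab[OF that] by (simp_all add: power_divide)
    have "(\<Sum>i<n. \<bar>f (b i) - f (a i)\<bar>)\<^sup>2
        = (\<Sum>i<n. (\<bar>f (b i) - f (a i)\<bar> / sqrt (b i - a i)) * sqrt (b i - a i))\<^sup>2"
      using summand by (intro arg_cong[where f="\<lambda>x. x\<^sup>2"] sum.cong refl) blast
    also have "\<dots> \<le> (\<Sum>i<n. (\<bar>f (b i) - f (a i)\<bar> / sqrt (b i - a i))\<^sup>2) * (\<Sum>i<n. (sqrt (b i - a i))\<^sup>2)"
      by (rule Cauchy_Schwarz_ineq_sum)
    also have "\<dots> = (\<Sum>i<n. (f (b i) - f (a i))\<^sup>2 / (b i - a i)) * (\<Sum>i<n. b i - a i)"
      using sq by (intro arg_cong2[where f="(*)"] sum.cong refl) auto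
    also have "\<dots> \<le> B * (\<Sum>i<n. b i - a i)"
      using bd len by (intro mult_right_mono) auto
    also have "\<dots> \<le> B * (e\<^sup>2 / (B + 1))"
      using len B by (intro mult_left_mono) auto
    also have "\<dots> < e\<^sup>2"
    proof -
      have "0 < e\<^sup>2" "B < B + 1" using e by simp_all
      then have "B * e\<^sup>2 < (B + 1) * e\<^sup>2" by (intro mult_strict_right_mono)
      then show ?thesis using B by (simp add: divide_less_eq mult.commute)
    qed
    finally show "(\<Sum>i<n. \<bar>f (b i) - f (a i)\<bar>) < e"
      using e by (rule power_less_imp_less_base[OF _ less_imp_le])
  qed
qed

text \<open>The case of one interval. The modulus of continuity depends on \<open>B\<close> alone,
  which yields the equicontinuity needed for Arzela-Ascoli.\<close>

lemma energy_bound_holder: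
  assumes f: "energy_bound f B" and xy: "x \<in> {0..1}" "y \<in> {0..1}"
  shows "(f y - f x)\<^sup>2 \<le> B * \<bar>y - x\<bar>"
proof -
  have *: "(f y - f x)\<^sup>2 \<le> B * (y - x)" if "0 \<le> x" "x \<le> y" "y \<le> 1" for x y
  proof (cases "x = y")
    case False
    have "(f y - f x)\<^sup>2 / (y - x) \<le> B"
      using f[unfolded energy_bound_def, rule_format, of 1 "\<lambda>_. x" "\<lambda>_. y"] that
      by (auto simp: disjoint_family_on_def)
    then show ?thesis using False that by (simp add: divide_simps)
  qed simp
  show ?thesis
    using *[of x y] *[of y x] xy by (cases "x \<le> y") (auto simp: power2_commute abs_if)
qed

text \<open>The two points are the ends \<open>x \<le> t < y\<close> of the cell of the grid of mesh
  \<open>1 / (n + 1)\<close> containing \<open>t\<close>. The errors of the expansions at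
  \<open>t\<close> are at most \<open>(r/2) (t - x)\<close> and \<open>(r/2) (y - t)\<close>; they
  add up to \<open>(r/2) (y - x)\<close> wherever \<open>t\<close> lies in the cell.\<close>

lemma difference_quotient_straddle:
  fixes f :: "real \<Rightarrow> real"
  assumes D: "(f has_real_derivative D) (at t)" and t: "0 \<le> t"
  shows "(\<lambda>n. (f ((real (nat \<lfloor>real (Suc n) * t\<rfloor>) + 1) / Suc n) - f (real (nat \<lfloor>real (Suc n) * t\<rfloor>) / Suc n)) * Suc n)
    \<longlonglongrightarrow> D"
proof (rule LIMSEQ_I)
  fix r :: real assume r: "0 < r"
  obtain d where d: "d > 0" "\<And>y. \<bar>y - t\<bar> < d \<Longrightarrow> \<bar>f y - f t - D * (y - t)\<bar> \<le> (r/2) * \<bar>y - t\<bar>"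
  proof -
    have "\<forall>e>0. \<exists>d>0. \<forall>y. \<bar>y - t\<bar> < d \<longrightarrow> \<bar>f y - f t - D * (y - t)\<bar> \<le> e * \<bar>y - t\<bar>"
      using D unfolding has_field_derivative_def has_derivative_at_alt by simp
    from this[rule_format, OF half_gt_zero[OF r]] show ?thesis using that by blast
  qed
  obtain m where m: "inverse (real (Suc m)) < d" using reals_Archimedean[OF d(1)] by auto
  show "\<exists>no. \<forall>n\<ge>no. norm ((f ((real (nat \<lfloor>real (Suc n) * t\<rfloor>) + 1) / Suc n)
      - f (real (nat \<lfloor>real (Suc n) * t\<rfloor>) / Suc n)) * Suc n - D) < r"
  proof (intro exI[of _ m] allI impI)
    fix n assume n: "n \<ge> m"
    define N where "N = real (Suc n)"
    define k where "k = real (nat \<lfloor>N * t\<rfloor>)"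
    define x where "x = k / N"
    define y where "y = (k + 1) / N"
    have N: "N > 0" by (simp add: N_def)
    have "inverse N \<le> inverse (real (Suc m))"
      unfolding N_def using n by (intro le_imp_inverse_le) auto
    then have Nd: "1 / N < d" using m by (simp add: inverse_eq_divide)
    have k: "k \<le> N * t" "N * t < k + 1"
      using t N by (auto simp: k_def of_nat_nat)
    have xy: "x \<le> t" "t < y" "y - x = 1 / N"
      using k N by (auto simp: x_def y_def field_simps)
    have "\<bar>f y - f x - D * (y - x)\<bar> \<le> (r/2) * (y - x)"
    proof -
      have 1: "\<bar>f x - f t - D * (x - t)\<bar> \<le> (r/2) * (t - x)"
        using d(2)[of x] xy Nd by (simp add: abs_minus_commute[of x t])
      have 2: "\<bar>f y - f t - D * (y - t)\<bar> \<le> (r/2) * (y - t)"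
        using d(2)[of y] xy Nd by (simp add: abs_if)
      have "f y - f x - D * (y - x) = (f y - f t - D * (y - t)) - (f x - f t - D * (x - t))"
        by (simp add: algebra_simps)
      moreover have "(r/2) * (y - x) = (r/2) * (y - t) + (r/2) * (t - x)"
        by (simp add: distrib_left[symmetric])
      ultimately show ?thesis using 1 2 by linarith
    qed
    then have le: "\<bar>f y - f x - D * (y - x)\<bar> * N \<le> (r/2) * (y - x) * N"
      using N by (intro mult_right_mono) auto
    then have "\<bar>(f y - f x) * N - D\<bar> \<le> r/2"
    proof -
      have "(f y - f x) * N - D = (f y - f x - D * (y - x)) * N"
        using xy(3) N by (simp add: left_diff_distrib)
      then have "\<bar>(f y - f x) * N - D\<bar> = \<bar>f y - f x - D * (y - x)\<bar> * N"
        using N by (simp add: abs_mult)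
      moreover have "(r/2) * (y - x) * N = r/2" using xy(3) N by simp
      ultimately show ?thesis using le by linarith
    qed
    then show "norm ((f ((real (nat \<lfloor>real (Suc n) * t\<rfloor>) + 1) / Suc n)
      - f (real (nat \<lfloor>real (Suc n) * t\<rfloor>) / Suc n)) * Suc n - D) < r"
      using r unfolding x_def y_def k_def N_def by simp
  qed
qed

text \<open>Fatou's lemma for the step functions \<open>v n\<close>, whose value on a grid cell is
  the squared difference quotient over it: their integrals are sums bounded by \<open>B\<close>, and
  they converge to \<open>(g t)\<^sup>2\<close> almost everywhere.\<close>

lemma energy_bound_imp_integral_le:
  assumes f: "energy_bound f B" and g: "ac_derivative f g"
  shows "integrable unit_measure (\<lambda>t. (g t)\<^sup>2)" "(LINT t|unit_measure. (g t)\<^sup>2) \<le> B"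
proof -
  define s where "s n k = (f ((real k + 1) / Suc n) - f (real k / Suc n)) * Suc n" for n k
  define v where "v n t = (\<Sum>k<Suc n. ennreal ((s n k)\<^sup>2) * indicator {real k / Suc n..<(real k + 1) / Suc n} t)" for n t
  have B: "0 \<le> B" using f by (rule energy_bound_nonneg)
  have vm[measurable]: "v n \<in> borel_measurable unit_measure" for n
  proof -
    have "v n \<in> borel_measurable borel" unfolding v_def by measurable
    then show ?thesis by (simp add: measurable_completion measurable_restrict_space1)
  qed
  have sub: "{real k / Suc n..(real k + 1) / Suc n} \<subseteq> {0..1}" if "k < Suc n" for n k
    using that by (auto simp: divide_simps)
  have vI: "(\<integral>\<^sup>+t. v n t \<partial>unit_measure) \<le> ennreal B" for n
  proof -
    have em: "emeasure unit_measure {real k / Suc n..<(real k + 1) / Suc n} = ennreal (1 / Suc n)"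
      if "k < Suc n" for k
    proof -
      have "{real k / Suc n..<(real k + 1) / Suc n} \<subseteq> {0..1}" using sub[OF that] by fastforce
      then show ?thesis
        by (simp add: emeasure_unit_measure_subset divide_right_mono diff_divide_distrib[symmetric])
    qed
    have "(\<integral>\<^sup>+t. v n t \<partial>unit_measure)
       = (\<Sum>k<Suc n. \<integral>\<^sup>+t. ennreal ((s n k)\<^sup>2) * indicator {real k / Suc n..<(real k + 1) / Suc n} t \<partial>unit_measure)"
      unfolding v_def
      by (rule nn_integral_sum) (auto intro!: borel_measurable_times_ennreal measurable_restrict_space1 measurable_completion)
    also have "\<dots> = (\<Sum>k<Suc n. ennreal ((s n k)\<^sup>2) * ennreal (1 / Suc n))"
    proof (rule sum.cong[OF refl])
      fix k assume "k \<in> {..<Suc n}"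
      then have k: "k < Suc n" by simp
      have "{real k / Suc n..<(real k + 1) / Suc n} \<subseteq> {0..1}" using sub[OF k] by fastforce
      then have "{real k / Suc n..<(real k + 1) / Suc n} \<in> sets unit_measure"
        by (auto simp: sets_restrict_space_iff)
      then show "(\<integral>\<^sup>+t. ennreal ((s n k)\<^sup>2) * indicator {real k / Suc n..<(real k + 1) / Suc n} t \<partial>unit_measure)
          = ennreal ((s n k)\<^sup>2) * ennreal (1 / Suc n)"
        using em[OF k] by (simp add: nn_integral_cmult_indicator)
    qed
    also have "\<dots> = ennreal (\<Sum>k<Suc n. (s n k)\<^sup>2 * (1 / Suc n))"
    proof -
      have "(\<Sum>k<Suc n. ennreal ((s n k)\<^sup>2) * ennreal (1 / Suc n))
          = (\<Sum>k<Suc n. ennreal ((s n k)\<^sup>2 * (1 / Suc n)))"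
        by (intro sum.cong refl ennreal_mult[symmetric]) auto
      then show ?thesis by (subst (asm) sum_ennreal) auto
    qed
    also have "(\<Sum>k<Suc n. (s n k)\<^sup>2 * (1 / Suc n))
        = (\<Sum>k<Suc n. (f ((real k + 1) / Suc n) - f (real k / Suc n))\<^sup>2 / ((real k + 1) / Suc n - real k / Suc n))"
    proof (intro sum.cong refl)
      fix k
      have "(real k + 1) / Suc n - real k / Suc n = 1 / Suc n" by (simp add: diff_divide_distrib[symmetric])
      then show "(s n k)\<^sup>2 * (1 / Suc n)
        = (f ((real k + 1) / Suc n) - f (real k / Suc n))\<^sup>2 / ((real k + 1) / Suc n - real k / Suc n)"
        by (simp add: s_def power_mult_distrib power2_eq_square)
    qed
    also have "\<dots> \<le> B"
    proof (rule f[unfolded energy_bound_def, rule_format])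
      have "{real k / Suc n<..<(real k + 1) / Suc n} \<inter> {real l / Suc n<..<(real l + 1) / Suc n} = {}"
        if "k \<noteq> l" for k l :: nat
      proof -
        have "k + 1 \<le> l \<or> l + 1 \<le> k" using that by linarith
        then have "real k + 1 \<le> real l \<or> real l + 1 \<le> real k" by linarith
        then have "(real k + 1) / Suc n \<le> real l / Suc n \<or> (real l + 1) / Suc n \<le> real k / Suc n"
          by (meson divide_right_mono of_nat_0_le_iff)
        then show ?thesis by auto
      qed
      then show "(\<forall>i<Suc n. real i / Suc n \<le> (real i + 1) / Suc n \<and> {real i / Suc n..(real i + 1) / Suc n} \<subseteq> {0..1}) \<and>
          disjoint_family_on (\<lambda>i. {real i / Suc n<..<(real i + 1) / Suc n}) {..<Suc n}"
        using sub by (auto simp: disjoint_family_on_def divide_right_mono)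
    qed
    finally show ?thesis by (simp add: ennreal_leI)
  qed
  have lim: "AE t in unit_measure. ennreal ((g t)\<^sup>2) \<le> liminf (\<lambda>n. v n t)"
  proof -
    have "AE t in unit_measure. (f has_real_derivative g t) (at t)"
      using g by (simp add: ac_derivative_def)
    moreover have "AE t in unit_measure. t \<in> {0..1}"
      by (rule AE_I2) simp
    \<comment> \<open>The half-open cells do not reach \<open>t = 1\<close>, so this point is
      discarded.\<close>
    ultimately show ?thesis using AE_unit_neq[of 1]
    proof eventually_elim
      case (elim t)
      have vt: "v n t = ennreal ((s n (nat \<lfloor>real (Suc n) * t\<rfloor>))\<^sup>2)" for n
      proof -
        let ?k = "nat \<lfloor>real (Suc n) * t\<rfloor>"
        have k: "?k < Suc n"
        proof -
          have "real (Suc n) * t < real (Suc n) * 1" using elim by (intro mult_strict_left_mono) auto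
          then have "\<lfloor>real (Suc n) * t\<rfloor> < int (Suc n)" by (simp add: floor_less_iff)
          then show ?thesis by (simp add: nat_less_iff elim)
        qed
        \<comment> \<open>Exactly one half-open cell contains \<open>t\<close>, so the sum collapses
          to a single term.\<close>
        have ind: "indicator {real k / Suc n..<(real k + 1) / Suc n} t = (if k = ?k then 1 else (0::ennreal))" for k
        proof -
          have "t \<in> {real k / Suc n..<(real k + 1) / Suc n} \<longleftrightarrow> real k \<le> real (Suc n) * t \<and> real (Suc n) * t < real k + 1"
            by (auto simp: field_simps)
          also have "\<dots> \<longleftrightarrow> \<lfloor>real (Suc n) * t\<rfloor> = int k" by (simp add: floor_eq_iff)
          also have "\<dots> \<longleftrightarrow> k = ?k" using elim by auto
          finally show ?thesis by (simp add: indicator_def)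
        qed
        show ?thesis unfolding v_def ind using k by (simp add: if_distrib cong: if_cong)
      qed
      have "(\<lambda>n. s n (nat \<lfloor>real (Suc n) * t\<rfloor>)) \<longlonglongrightarrow> g t"
        unfolding s_def using difference_quotient_straddle[of f "g t" t] elim by simp
      then have "(\<lambda>n. v n t) \<longlonglongrightarrow> ennreal ((g t)\<^sup>2)"
        unfolding vt by (intro tendsto_ennrealI tendsto_power)
      then show ?case
        by (simp add: lim_imp_Liminf)
    qed
  qed
  have "(\<integral>\<^sup>+t. ennreal ((g t)\<^sup>2) \<partial>unit_measure) \<le> (\<integral>\<^sup>+t. liminf (\<lambda>n. v n t) \<partial>unit_measure)"
    by (rule nn_integral_mono_AE[OF lim])
  also have "\<dots> \<le> liminf (\<lambda>n. \<integral>\<^sup>+t. v n t \<partial>unit_measure)"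
    by (rule nn_integral_liminf) simp
  also have "\<dots> \<le> ennreal B"
    using vI by (intro Liminf_le) auto
  finally have le: "(\<integral>\<^sup>+t. ennreal ((g t)\<^sup>2) \<partial>unit_measure) \<le> ennreal B" .
  have gm: "g \<in> borel_measurable unit_measure" using g by (auto simp: ac_derivative_def primitive_of_def)
  show int: "integrable unit_measure (\<lambda>t. (g t)\<^sup>2)"
    by (rule integrableI_nonneg) (use gm le in \<open>auto intro: le_less_trans\<close>)
  show "(LINT t|unit_measure. (g t)\<^sup>2) \<le> B"
    using le B by (simp add: nn_integral_eq_integral[OF int])
qed

subsection \<open>The functional in angular coordinates\<close>

text \<open>Splitting \<open>q - r\<close> into positive and negative parts, with every term moved
  to the side on which it is added. In this form the identity holds in \<open>ennreal\<close> even
  for \<open>q = \<infinity>\<close>.\<close>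

lemma e2ennreal_diff_identity:
  fixes q :: ereal and r :: real
  assumes "0 \<le> q"
  shows "e2ennreal (q - ereal r) + ennreal r = e2ennreal q + ennreal (- r) + e2ennreal (- (q - ereal r))"
proof (cases q)
  case (real x)
  then have "0 \<le> x" using assms by simp
  have "ennreal (x - r) + ennreal r = ennreal x + ennreal (- r) + ennreal (r - x)"
  proof (cases "0 \<le> r")
    case True
    then show ?thesis
      using \<open>0 \<le> x\<close> by (cases "r \<le> x") (auto simp: ennreal_neg ennreal_plus[symmetric] simp del: ennreal_plus)
  next
    case False
    then show ?thesis
      using \<open>0 \<le> x\<close> by (auto simp: ennreal_neg ennreal_plus[symmetric] simp del: ennreal_plus)
  qed
  then show ?thesis using real by (simp add: ennreal.abs_eq[symmetric])
qed (use assms in auto)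

text \<open>Integrate the preceding identity. The negative part of \<open>q - r\<close> is at most
  the positive part of \<open>r\<close>, so \<open>?B\<close>, \<open>?P\<close> and
  \<open>?Q\<close> are all finite and can be cancelled even when the integral of \<open>q\<close>
  is infinite.\<close>

lemma ereal_integral_diff_real:
  fixes q :: "'a \<Rightarrow> ereal" and r :: "'a \<Rightarrow> real"
  assumes q[measurable]: "q \<in> borel_measurable M" and q0: "\<And>x. 0 \<le> q x"
    and r: "integrable M r"
  shows "ereal_integral M (\<lambda>x. q x - ereal (r x)) =
    enn2ereal (\<integral>\<^sup>+x. e2ennreal (q x) \<partial>M) - ereal (LINT x|M. r x)"
proof -
  have [measurable]: "r \<in> borel_measurable M" using r by simp
  let ?A = "\<integral>\<^sup>+x. e2ennreal (q x - ereal (r x)) \<partial>M"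
  let ?B = "\<integral>\<^sup>+x. e2ennreal (- (q x - ereal (r x))) \<partial>M"
  let ?N = "\<integral>\<^sup>+x. e2ennreal (q x) \<partial>M"
  let ?P = "\<integral>\<^sup>+x. ennreal (r x) \<partial>M"
  let ?Q = "\<integral>\<^sup>+x. ennreal (- r x) \<partial>M"
  have "?A + ?P = (\<integral>\<^sup>+x. e2ennreal (q x - ereal (r x)) + ennreal (r x) \<partial>M)"
    by (subst nn_integral_add) auto
  also have "\<dots> = (\<integral>\<^sup>+x. e2ennreal (q x) + ennreal (- r x) + e2ennreal (- (q x - ereal (r x))) \<partial>M)"
    using e2ennreal_diff_identity[OF q0] by (intro nn_integral_cong) auto
  also have "\<dots> = ?N + ?Q + ?B"
    by (subst nn_integral_add, simp, simp, subst nn_integral_add, auto)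
  finally have eq: "?A + ?P = ?N + ?Q + ?B" .
  have fin: "?P < \<infinity>" "?Q < \<infinity>"
    using r by (auto simp: real_integrable_def less_top)
  have "?B \<le> ?P"
  proof (rule nn_integral_mono)
    fix x
    have "- (q x - ereal (r x)) \<le> ereal (r x)"
      using q0[of x] by (cases "q x") auto
    then show "e2ennreal (- (q x - ereal (r x))) \<le> ennreal (r x)"
      by (metis e2ennreal_mono e2ennreal_ereal)
  qed
  then have finB: "?B < \<infinity>" using fin(1) by (rule le_less_trans)
  have int: "(LINT x|M. r x) = enn2real ?P - enn2real ?Q"
    by (rule real_lebesgue_integral_def[OF r])
  obtain P where P: "?P = ennreal P" "0 \<le> P" using fin by (cases ?P) auto
  obtain Q where Q: "?Q = ennreal Q" "0 \<le> Q" using fin by (cases ?Q) auto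
  obtain B where B: "?B = ennreal B" "0 \<le> B" using finB by (cases ?B) auto
  have "enn2ereal ?A - enn2ereal ?B = enn2ereal ?N - ereal (P - Q)"
  proof (cases ?N)
    case (real n)
    then have "?A \<noteq> \<infinity>" using eq P Q B by (auto simp: ennreal_plus[symmetric] simp del: ennreal_plus)
    then obtain a where a: "?A = ennreal a" "0 \<le> a" by (cases ?A) auto
    have "ennreal (a + P) = ennreal (n + Q + B)"
      using eq a P Q B real by (simp add: ennreal_plus)
    then have "a + P = n + Q + B"
      using a P Q B real by (subst (asm) ennreal_inj) auto
    then show ?thesis using a B real by (simp add: enn2ereal_ennreal)
  next
    case top
    then have "?A = \<infinity>" using eq P by (auto simp: ennreal_add_eq_top)
    then show ?thesis using B top by (simp add: enn2ereal_ennreal)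
  qed
  then show ?thesis
    unfolding ereal_integral_def int using P Q by simp
qed

lemma e2ennreal_0: "e2ennreal 0 = 0"
  by (metis e2ennreal_ereal ennreal_0 zero_ereal_def)

lemma quotient_term_nonneg: "q \<in> {0..1} \<Longrightarrow> 0 \<le> quotient_term q v"
  by (auto simp: quotient_term_def)

text \<open>The derivative is an argument, so that a measurable representative can stand in for
  \<open>deriv p\<close>.\<close>

definition quotient_energy :: "(real \<Rightarrow> real) \<Rightarrow> (real \<Rightarrow> real) \<Rightarrow> ennreal" where
  "quotient_energy p g = (\<integral>\<^sup>+t. e2ennreal (quotient_term (p t) (g t)) \<partial>unit_measure)"

lemma admissible_measurable:
  assumes "admissible p"
  shows "p \<in> borel_measurable unit_measure"
  using assms unfolding admissible_def
  by (intro continuous_imp_measurable_unit abs_continuous_on_imp_continuous_on) auto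

lemma integrable_potential:
  fixes u p :: "real \<Rightarrow> real"
  assumes u: "u \<in> borel_measurable unit_measure" "\<And>t. t \<in> {0..1} \<Longrightarrow> \<bar>u t\<bar> \<le> C"
    and p: "p \<in> borel_measurable unit_measure" "\<And>t. t \<in> {0..1} \<Longrightarrow> \<bar>p t\<bar> \<le> D"
  shows "integrable unit_measure (\<lambda>t. u t * p t)"
proof (rule integrable_unit_bounded)
  show "(\<lambda>t. u t * p t) \<in> borel_measurable unit_measure"
    using u(1) p(1) by (intro borel_measurable_times)
  show "\<bar>u t * p t\<bar> \<le> C * D" if "t \<in> {0..1}" for t
    using u(2)[OF that] p(2)[OF that] by (simp add: abs_mult) (intro mult_mono; linarith)
qed

lemma J_eq_quotient_energy:
  assumes u: "u \<in> borel_measurable unit_measure" "\<And>t. t \<in> {0..1} \<Longrightarrow> \<bar>u t\<bar> \<le> C"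
    and p: "admissible p" and g: "ac_derivative p g"
  shows "J u p = enn2ereal (quotient_energy p g) - ereal (LINT t|unit_measure. u t * p t)"
proof -
  \<comment> \<open>Truncation makes the quotient nonnegative and its formula tractable at every
    real \<open>t\<close>, also outside the unit interval, as
    \<open>ereal_integral_diff_real\<close> requires.\<close>
  define p' where "p' t = max 0 (min 1 (p t))" for t
  have p'_eq: "p' t = p t" if "t \<in> {0..1}" for t
    using p that by (auto simp: admissible_def p'_def)
  have p'_in: "p' t \<in> {0..1}" for t by (simp add: p'_def)
  have [measurable]: "p \<in> borel_measurable unit_measure" by (rule admissible_measurable[OF p])
  then have [measurable]: "p' \<in> borel_measurable unit_measure" unfolding p'_def by measurable
  have [measurable]: "g \<in> borel_measurable unit_measure" using g by (auto simp: ac_derivative_def primitive_of_def)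
  have qm: "(\<lambda>t. quotient_term (p' t) (g t)) \<in> borel_measurable unit_measure"
    unfolding quotient_term_def by measurable
  have r: "integrable unit_measure (\<lambda>t. u t * p t)"
    using p by (intro integrable_potential[OF u] admissible_measurable) (auto simp: admissible_def)
  have AE: "AE t in unit_measure. p' t = p t \<and> deriv p t = g t"
  proof -
    have "AE t in unit_measure. (p has_real_derivative g t) (at t)"
      using g by (simp add: ac_derivative_def)
    moreover have "AE t in unit_measure. p' t = p t"
      by (rule AE_I2) (simp add: p'_eq)
    ultimately show ?thesis by eventually_elim (simp add: DERIV_imp_deriv)
  qed
  have "AE t in unit_measure. e2ennreal (quotient_term (p t) (deriv p t) - ereal (u t * p t))
      = e2ennreal (quotient_term (p' t) (g t) - ereal (u t * p t))"
    using AE by eventually_elim simp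
  moreover have "AE t in unit_measure. e2ennreal (- (quotient_term (p t) (deriv p t) - ereal (u t * p t)))
      = e2ennreal (- (quotient_term (p' t) (g t) - ereal (u t * p t)))"
    using AE by eventually_elim simp
  ultimately have "J u p = ereal_integral unit_measure (\<lambda>t. quotient_term (p' t) (g t) - ereal (u t * p t))"
    unfolding J_def ereal_integral_def
    by (simp only: nn_integral_cong_AE)
  also have "\<dots> = enn2ereal (\<integral>\<^sup>+t. e2ennreal (quotient_term (p' t) (g t)) \<partial>unit_measure)
      - ereal (LINT t|unit_measure. u t * p t)"
    by (rule ereal_integral_diff_real[OF qm quotient_term_nonneg[OF p'_in] r])
  also have "(\<integral>\<^sup>+t. e2ennreal (quotient_term (p' t) (g t)) \<partial>unit_measure) = quotient_energy p g"
    unfolding quotient_energy_def by (intro nn_integral_cong) (simp add: p'_eq)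
  finally show ?thesis .
qed

section \<open>Translation between a function and its angle\<close>

lemma energy_bound_mono: "energy_bound f B \<Longrightarrow> B \<le> C \<Longrightarrow> energy_bound f C"
  unfolding energy_bound_def by (meson order_trans)

text \<open>Each inequality in \<open>energy_bound\<close> involves finitely many points, so
  pointwise convergence is enough. This is the lower semicontinuity of the Dirichlet energy; letting
  the bounds vary with \<open>n\<close> makes it sharp along a minimizing sequence.\<close>

lemma energy_bound_limit:
  assumes f: "\<And>n. energy_bound (F n) (B n)"
    and lim: "\<And>t. t \<in> {0..1} \<Longrightarrow> (\<lambda>n. F n t) \<longlonglongrightarrow> f t" and B: "B \<longlonglongrightarrow> b"
  shows "energy_bound f b"
  unfolding energy_bound_def
proof (intro allI impI)
  fix n :: nat and x y :: "nat \<Rightarrow> real"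
  assume A: "(\<forall>i<n. x i \<le> y i \<and> {x i..y i} \<subseteq> {0..1}) \<and> disjoint_family_on (\<lambda>i. {x i<..<y i}) {..<n}"
  have mem: "x i \<in> {0..1}" "y i \<in> {0..1}" if "i < n" for i
  proof -
    have "x i \<le> y i" "{x i..y i} \<subseteq> {0..1}" using A that by auto
    then show "x i \<in> {0..1}" "y i \<in> {0..1}" by auto
  qed
  \<comment> \<open>As products with the fixed factors \<open>inverse (y i - x i)\<close> the
    quotients converge even for degenerate intervals.\<close>
  have "(\<lambda>k. \<Sum>i<n. (F k (y i) - F k (x i))\<^sup>2 / (y i - x i)) \<longlonglongrightarrow> (\<Sum>i<n. (f (y i) - f (x i))\<^sup>2 / (y i - x i))"
    unfolding divide_inverse
    by (intro tendsto_sum tendsto_mult tendsto_power tendsto_diff lim tendsto_const mem) auto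
  then show "(\<Sum>i<n. (f (y i) - f (x i))\<^sup>2 / (y i - x i)) \<le> b"
    by (rule LIMSEQ_le[OF _ B]) (use f A in \<open>auto simp: energy_bound_def\<close>)
qed

lemma ac_derivative_of_DERIV:
  assumes "ac_derivative f g" "AE t in unit_measure. (f has_real_derivative h t) (at t)"
  shows "AE t in unit_measure. g t = h t"
proof -
  have "AE t in unit_measure. (f has_real_derivative g t) (at t)"
    using assms(1) by (simp add: ac_derivative_def)
  then show ?thesis using assms(2) by eventually_elim (rule DERIV_unique)
qed

lemma sin_lipschitz: "1-lipschitz_on UNIV (sin :: real \<Rightarrow> real)"
  by (rule bounded_derivative_imp_lipschitz[where f'="\<lambda>x h. h * cos x"])
     (auto intro!: derivative_eq_intros onorm_le simp: abs_mult mult_left_le)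

definition of_angle :: "(real \<Rightarrow> real) \<Rightarrow> real \<Rightarrow> real" where
  "of_angle f t = (1 + sin (f t)) / 2"

lemma admissible_of_angle:
  assumes "abs_continuous_on {0..1} f"
  shows "admissible (of_angle f)"
proof -
  have "abs_continuous_on {0..1} (\<lambda>t. sin (f t))"
    by (rule abs_continuous_on_lipschitz_compose[OF assms sin_lipschitz]) simp
  moreover have "(1/2)-lipschitz_on UNIV (\<lambda>x::real. (1 + x) / 2)"
  proof (rule lipschitz_onI)
    fix x y :: real
    have half: "(1 + x) / 2 - (1 + y) / 2 = (x - y) / 2" by (simp add: field_simps)
    show "dist ((1 + x) / 2) ((1 + y) / 2) \<le> 1 / 2 * dist x y"
      unfolding dist_real_def half by simp
  qed simp
  ultimately have "abs_continuous_on {0..1} (\<lambda>t. (1 + sin (f t)) / 2)"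
    by (intro abs_continuous_on_lipschitz_compose[where h="\<lambda>x. (1 + x) / 2"]) auto
  moreover have "(1 + sin (f t)) / 2 \<in> {0..1}" for t
  proof -
    have "0 \<le> 1 + sin (f t)" using sin_ge_minus_one[of "f t"] by linarith
    then show ?thesis using sin_le_one[of "f t"] by simp
  qed
  ultimately show ?thesis unfolding admissible_def of_angle_def by auto
qed

text \<open>By the chain rule \<open>h = cos f * g / 2\<close>, while
  \<open>p (1 - p) = (cos f)\<^sup>2 / 4\<close>, so the quotient is \<open>g\<^sup>2\<close>. Where
  \<open>cos f = 0\<close> also \<open>h = 0\<close>, and the convention makes the quotient
  \<open>0\<close>; hence an inequality, with no restriction on the range of
  \<open>f\<close>.\<close>

lemma quotient_energy_of_angle_le:
  assumes f: "ac_derivative f g" and h: "ac_derivative (of_angle f) h"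
  shows "quotient_energy (of_angle f) h \<le> (\<integral>\<^sup>+t. ennreal ((g t)\<^sup>2) \<partial>unit_measure)"
  unfolding quotient_energy_def
proof (rule nn_integral_mono_AE)
  have "AE t in unit_measure. (f has_real_derivative g t) (at t)"
    using f by (simp add: ac_derivative_def)
  then have "AE t in unit_measure. (of_angle f has_real_derivative (cos (f t) * g t / 2)) (at t)"
    by eventually_elim (auto simp: of_angle_def[abs_def] intro!: derivative_eq_intros)
  from ac_derivative_of_DERIV[OF h this]
  show "AE t in unit_measure. e2ennreal (quotient_term (of_angle f t) (h t)) \<le> ennreal ((g t)\<^sup>2)"
  proof eventually_elim
    case (elim t)
    have pq: "of_angle f t * (1 - of_angle f t) = (cos (f t))\<^sup>2 / 4"
      unfolding cos_squared_eq by (simp add: of_angle_def field_simps power2_eq_square)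
    show ?case
    proof (cases "of_angle f t \<in> {0, 1}")
      case True
      then have "cos (f t) = 0" using pq by auto
      then show ?thesis using True elim by (simp add: quotient_term_def e2ennreal_0)
    next
      case False
      then have "cos (f t) \<noteq> 0" using pq by auto
      then have "(h t)\<^sup>2 / (of_angle f t * (1 - of_angle f t)) = (g t)\<^sup>2"
        unfolding pq elim by (simp add: power_mult_distrib power_divide)
      then show ?thesis using False by (simp add: quotient_term_def)
    qed
  qed
qed

text \<open>At points where \<open>p\<close> meets \<open>{0, 1}\<close> the function \<open>arcsin (2 p - 1)\<close> need not be differentiable;
  the factor \<open>1 + e\<close> keeps the argument inside the open interval \<open>(-1, 1)\<close>.\<close>

lemma energy_bound_regularized_angle:
  assumes p: "admissible p" and g: "ac_derivative p g" and K: "quotient_energy p g \<le> ennreal B"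
    and B: "0 \<le> B" and e: "0 < e"
  shows "energy_bound (\<lambda>t. arcsin ((2 * p t - 1) / (1 + e))) B"
proof -
  define c where "c = 1 / (1 + e)"
  have c: "0 < c" "c < 1" using e by (auto simp: c_def)
  define a where "a x = arcsin ((2 * x - 1) * c)" for x
  define a' where "a' x = 2 * c / sqrt (1 - ((2 * x - 1) * c)\<^sup>2)" for x
  have range: "\<bar>(2 * x - 1) * c\<bar> \<le> c" if "x \<in> {0..1}" for x
    using that c by (simp add: abs_mult mult_left_le_one_le abs_le_iff)
  have sq_le: "((2 * x - 1) * c)\<^sup>2 \<le> c\<^sup>2" if "x \<in> {0..1}" for x
    using range[OF that] c by (simp add: abs_le_square_iff[symmetric])
  have c2: "c\<^sup>2 < 1" using c by (simp add: power_less_one_iff abs_square_less_1)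
  have a_deriv: "(a has_real_derivative a' x) (at x)" if "x \<in> {0..1}" for x
  proof -
    have "- 1 < (2 * x - 1) * c" "(2 * x - 1) * c < 1" using range[OF that] c by linarith+
    then show ?thesis
      unfolding a_def[abs_def] a'_def by (auto intro!: derivative_eq_intros simp: divide_inverse)
  qed
  have a'_bound: "\<bar>a' x\<bar> \<le> 2 / sqrt (1 - c\<^sup>2)" if "x \<in> {0..1}" for x
  proof -
    have "0 < sqrt (1 - c\<^sup>2)" "sqrt (1 - c\<^sup>2) \<le> sqrt (1 - ((2 * x - 1) * c)\<^sup>2)"
      using sq_le[OF that] c2 by auto
    then show ?thesis unfolding a'_def abs_divide
      using c by (intro frac_le) auto
  qed
  have "(2 / sqrt (1 - c\<^sup>2))-lipschitz_on {0..1} a"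
  proof (rule bounded_derivative_imp_lipschitz[where f'="\<lambda>x h. a' x * h"])
    show "(a has_derivative (\<lambda>h. a' x * h)) (at x within {0..1})" if "x \<in> {0..1}" for x
      using a_deriv[OF that] unfolding has_field_derivative_def
      by (rule has_derivative_at_withinI)
    show "onorm (\<lambda>h. a' x * h) \<le> 2 / sqrt (1 - c\<^sup>2)" if "x \<in> {0..1}" for x
      using a'_bound[OF that] by (intro onorm_le, unfold real_norm_def abs_mult) (rule mult_right_mono, auto)
  qed (use c2 in auto)
  then have "abs_continuous_on {0..1} (\<lambda>t. a (p t))"
    using p by (intro abs_continuous_on_lipschitz_compose[where h=a]) (auto simp: admissible_def)
  then obtain k where k: "ac_derivative (\<lambda>t. a (p t)) k"
    by (rule abs_continuous_on_obtain_derivative)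
  have "AE t in unit_measure. (p has_real_derivative g t) (at t)"
    using g by (simp add: ac_derivative_def)
  moreover have p01: "AE t in unit_measure. p t \<in> {0..1}"
    using p by (intro AE_I2) (simp add: admissible_def)
  ultimately have "AE t in unit_measure. ((\<lambda>t. a (p t)) has_real_derivative (a' (p t) * g t)) (at t)"
    by eventually_elim (rule DERIV_chain2[OF a_deriv])
  from ac_derivative_of_DERIV[OF k this] p01
  have "AE t in unit_measure. ennreal ((k t)\<^sup>2) \<le> e2ennreal (quotient_term (p t) (g t))"
  proof eventually_elim
    case (elim t)
    show ?case
    proof (cases "p t \<in> {0, 1}")
      \<comment> \<open>For \<open>g t = 0\<close> the derivative \<open>k t\<close> vanishes too;
        otherwise the right side is infinite by convention.\<close>
      case True
      then show ?thesis using elim by (cases "g t = 0") (auto simp: quotient_term_def)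
    next
      case False
      then have pos: "0 < p t" "p t < 1" using elim by auto
      then have pp: "0 < p t * (1 - p t)" by simp
      have s: "((2 * p t - 1) * c)\<^sup>2 < 1" using sq_le[of "p t"] elim c2 by simp
      have "(a' (p t))\<^sup>2 = 4 * c\<^sup>2 / (1 - ((2 * p t - 1) * c)\<^sup>2)"
        unfolding a'_def using s by (simp add: power_divide power_mult_distrib)
      also have "\<dots> \<le> 1 / (p t * (1 - p t))"
      proof -
        \<comment> \<open>The regularization can only lower the energy density:
          \<open>c\<^sup>2\<close> is replaced by \<open>1\<close>. Hence the bound \<open>B\<close>
          does not depend on \<open>e\<close>.\<close>
        have "4 * c\<^sup>2 * (p t * (1 - p t)) = c\<^sup>2 - ((2 * p t - 1) * c)\<^sup>2"
          by (simp add: power2_eq_square algebra_simps)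
        also have "\<dots> \<le> 1 - ((2 * p t - 1) * c)\<^sup>2" using c2 by simp
        finally show ?thesis using pp s by (simp add: divide_simps)
      qed
      finally have "(a' (p t))\<^sup>2 * (g t)\<^sup>2 \<le> 1 / (p t * (1 - p t)) * (g t)\<^sup>2"
        by (rule mult_right_mono) simp
      then have "(k t)\<^sup>2 \<le> (g t)\<^sup>2 / (p t * (1 - p t))"
        using elim by (simp add: power_mult_distrib)
      then show ?thesis using False by (simp add: quotient_term_def ennreal_leI)
    qed
  qed
  then have "(\<integral>\<^sup>+t. ennreal ((k t)\<^sup>2) \<partial>unit_measure) \<le> quotient_energy p g"
    unfolding quotient_energy_def by (rule nn_integral_mono_AE)
  then have le: "(\<integral>\<^sup>+t. ennreal ((k t)\<^sup>2) \<partial>unit_measure) \<le> ennreal B" using K by simp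
  have km: "k \<in> borel_measurable unit_measure" using k by (auto simp: ac_derivative_def primitive_of_def)
  have int: "integrable unit_measure (\<lambda>t. (k t)\<^sup>2)"
    by (rule integrableI_nonneg) (use km le in \<open>auto intro: le_less_trans\<close>)
  have "(LINT t|unit_measure. (k t)\<^sup>2) \<le> B"
    using le B by (simp add: nn_integral_eq_integral[OF int])
  then have "energy_bound (\<lambda>t. a (p t)) B"
    using energy_bound_integral[of _ k] int k energy_bound_mono unfolding ac_derivative_def by blast
  then show ?thesis by (simp add: a_def c_def)
qed

definition angle :: "(real \<Rightarrow> real) \<Rightarrow> real \<Rightarrow> real" where
  "angle p t = arcsin (2 * p t - 1)"

text \<open>The regularized angles share the bound \<open>B\<close> and converge pointwise as
  \<open>e\<close> tends to \<open>0\<close>, because \<open>arcsin\<close> is continuous on the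
  closed interval, its end points included.\<close>

lemma energy_bound_angle:
  assumes p: "admissible p" and g: "ac_derivative p g" and K: "quotient_energy p g \<le> ennreal B"
    and B: "0 \<le> B"
  shows "energy_bound (angle p) B"
proof (rule energy_bound_limit)
  show "energy_bound (\<lambda>t. arcsin ((2 * p t - 1) / (1 + inverse (real (Suc n))))) B" for n
    by (rule energy_bound_regularized_angle[OF p g K B]) simp
  show "(\<lambda>n. arcsin ((2 * p t - 1) / (1 + inverse (real (Suc n))))) \<longlonglongrightarrow> angle p t" if "t \<in> {0..1}" for t
    unfolding angle_def
  proof (rule continuous_on_tendsto_compose[OF continuous_on_arcsin'])
    have "\<bar>2 * p t - 1\<bar> \<le> 1" using p that by (auto simp: admissible_def abs_le_iff)
    then have *: "\<bar>(2 * p t - 1) / (1 + e)\<bar> \<le> 1" if "0 < e" for e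
      using that by (simp add: abs_divide divide_le_eq)
    have "\<bar>(2 * p t - 1) / (1 + inverse (real (Suc n)))\<bar> \<le> 1" for n
      by (rule *) simp
    then show "\<forall>\<^sub>F n in sequentially. (2 * p t - 1) / (1 + inverse (real (Suc n))) \<in> {-1..1}"
      by (intro always_eventually allI) (metis abs_le_iff atLeastAtMost_iff minus_le_iff)
    show "2 * p t - 1 \<in> {-1..1}" using p that by (auto simp: admissible_def)
    have "(\<lambda>n. (2 * p t - 1) / (1 + inverse (real (Suc n)))) \<longlonglongrightarrow> (2 * p t - 1) / (1 + 0)"
      by (intro tendsto_intros LIMSEQ_inverse_real_of_nat) simp
    then show "(\<lambda>n. (2 * p t - 1) / (1 + inverse (real (Suc n)))) \<longlonglongrightarrow> 2 * p t - 1" by simp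
  qed
qed (rule tendsto_const)

lemma sin_angle: "admissible p \<Longrightarrow> t \<in> {0..1} \<Longrightarrow> sin (angle p t) = 2 * p t - 1"
  unfolding angle_def admissible_def by (intro sin_arcsin) auto

lemma of_angle_angle: "admissible p \<Longrightarrow> t \<in> {0..1} \<Longrightarrow> of_angle (angle p) t = p t"
  by (simp add: of_angle_def sin_angle)

lemma angle_bounds: "admissible p \<Longrightarrow> t \<in> {0..1} \<Longrightarrow> - (pi/2) \<le> angle p t \<and> angle p t \<le> pi/2"
  unfolding angle_def admissible_def by (intro arcsin_bounded[THEN conjunct1] arcsin_bounded conjI) auto

subsection \<open>Piecewise continuous functions\<close>

text \<open>The value of \<open>u\<close> at a break point is arbitrary, so the break points enter
  as singletons, where continuity and boundedness are trivial.\<close>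

lemma piecewise_continuous_cover:
  assumes "piecewise_continuous u"
  obtains \<C> :: "real set set" where "finite \<C>" "{0..1} \<subseteq> \<Union>\<C>"
    "\<And>S. S \<in> \<C> \<Longrightarrow> S \<in> sets borel \<and> continuous_on S u \<and> bounded (u ` S)"
proof -
  obtain N :: nat and \<tau> :: "nat \<Rightarrow> real" where \<tau>: "\<tau> 0 = 0" "\<tau> N = 1"
    and P: "\<And>i. i < N \<Longrightarrow> \<tau> i < \<tau> (Suc i) \<and> continuous_on {\<tau> i<..<\<tau> (Suc i)} u \<and>
               (\<exists>l::real. (u \<longlongrightarrow> l) (at_left (\<tau> (Suc i)))) \<and>
               (\<exists>r::real. (u \<longlongrightarrow> r) (at_right (\<tau> i)))"
    using assms unfolding piecewise_continuous_def by blast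
  define \<C> where "\<C> = (\<lambda>i. {\<tau> i<..<\<tau> (Suc i)}) ` {..<N} \<union> (\<lambda>i. {\<tau> i}) ` {..N}"
  have bdd: "bounded (u ` {\<tau> i<..<\<tau> (Suc i)})" if i: "i < N" for i
  proof -
    obtain l r where lr: "(u \<longlongrightarrow> l) (at_left (\<tau> (Suc i)))" "(u \<longlongrightarrow> r) (at_right (\<tau> i))"
      and c: "continuous_on {\<tau> i<..<\<tau> (Suc i)} u" and lt: "\<tau> i < \<tau> (Suc i)"
      using P[OF i] by blast
    let ?a = "\<tau> i" and ?b = "\<tau> (Suc i)"
    obtain b where b: "?a < b" "\<And>y. \<lbrakk>?a < y; y < b\<rbrakk> \<Longrightarrow> dist (u y) r < 1"
      using tendstoD[OF lr(2), of 1] unfolding eventually_at_right_field by auto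
    obtain a where a: "a < ?b" "\<And>y. \<lbrakk>a < y; y < ?b\<rbrakk> \<Longrightarrow> dist (u y) l < 1"
      using tendstoD[OF lr(1), of 1] unfolding eventually_at_left_field by auto
    \<comment> \<open>Midpoints that lie strictly inside the one-sided neighbourhoods where
      \<open>u\<close> is within \<open>1\<close> of its limits. What these neighbourhoods leave out
      is contained in the compact interval \<open>{b'..a'}\<close>.\<close>
    define b' where "b' = (?a + min b ?b) / 2"
    define a' where "a' = (max a ?a + ?b) / 2"
    have b': "?a < b'" "b' < b" "b' < ?b" using b(1) lt by (auto simp: b'_def min_def)
    have a': "a < a'" "a' < ?b" "?a < a'" using a(1) lt by (auto simp: a'_def max_def)
    have "bounded (u ` {b'..a'})"
      using b' a' by (intro compact_imp_bounded compact_continuous_image continuous_on_subset[OF c]) auto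
    moreover have "u ` {?a<..<?b} \<subseteq> ball r 1 \<union> ball l 1 \<union> u ` {b'..a'}"
    proof (rule image_subsetI)
      fix y assume y: "y \<in> {?a<..<?b}"
      then show "u y \<in> ball r 1 \<union> ball l 1 \<union> u ` {b'..a'}"
        using a(2)[of y] b(2)[of y] a' b'
        by (cases "y < b"; cases "a < y") (auto simp: dist_commute)
    qed
    ultimately show ?thesis
      by (meson bounded_Un bounded_ball bounded_subset)
  qed
  have cover: "{0..\<tau> n} \<subseteq> \<Union>\<C>" if "n \<le> N" for n
    using that
  proof (induction n)
    case 0
    then show ?case using \<tau> by (auto simp: \<C>_def intro!: bexI[of _ 0])
  next
    case (Suc n)
    then have "{0..\<tau> n} \<subseteq> \<Union>\<C>" "{\<tau> n<..<\<tau> (Suc n)} \<in> \<C>" "{\<tau> (Suc n)} \<in> \<C>"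
      by (auto simp: \<C>_def)
    moreover have "{0..\<tau> (Suc n)} \<subseteq> {0..\<tau> n} \<union> {\<tau> n<..<\<tau> (Suc n)} \<union> {\<tau> (Suc n)}" by auto
    ultimately show ?case by blast
  qed
  show thesis
  proof (rule that[of \<C>])
    show "finite \<C>" by (simp add: \<C>_def)
    show "{0..1} \<subseteq> \<Union>\<C>" using cover[of N] \<tau> by simp
    show "S \<in> sets borel \<and> continuous_on S u \<and> bounded (u ` S)" if "S \<in> \<C>" for S
      using that P bdd by (auto simp: \<C>_def)
  qed
qed

lemma piecewise_continuous_bounded_measurable:
  assumes "piecewise_continuous u"
  obtains C where "u \<in> borel_measurable unit_measure" "\<And>t. t \<in> {0..1} \<Longrightarrow> \<bar>u t\<bar> \<le> C"
proof -
  obtain \<C> :: "real set set" where \<C>: "finite \<C>" "{0..1} \<subseteq> \<Union>\<C>"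
    "\<And>S. S \<in> \<C> \<Longrightarrow> S \<in> sets borel \<and> continuous_on S u \<and> bounded (u ` S)"
    using piecewise_continuous_cover[OF assms] by blast
  have "bounded (\<Union>S\<in>\<C>. u ` S)"
    using \<C> by (intro bounded_UN) auto
  then obtain C where C: "\<And>x. x \<in> (\<Union>S\<in>\<C>. u ` S) \<Longrightarrow> \<bar>x\<bar> \<le> C"
    by (auto simp: bounded_iff)
  show thesis
  proof (rule that)
    show "\<bar>u t\<bar> \<le> C" if "t \<in> {0..1}" for t
      using that \<C>(2) by (intro C) blast
    show "u \<in> borel_measurable unit_measure"
    proof (rule measurable_piecewise_restrict[of \<C>])
      show "countable \<C>" using \<C>(1) by (rule countable_finite)
      show "space unit_measure \<subseteq> \<Union>\<C>" using \<C>(2) by simp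
      fix S assume S: "S \<in> \<C>"
      have "S \<in> sets lebesgue" using \<C>(3)[OF S] by (simp add: sets_completionI_sets)
      then have "S \<inter> {0..1} \<in> sets lebesgue" by (intro sets.Int) simp_all
      then show "S \<inter> space unit_measure \<in> sets unit_measure"
        by (simp add: sets_restrict_space_iff)
      have "continuous_on ({0..1} \<inter> S) u"
        using \<C>(3)[OF S] continuous_on_subset by blast
      moreover have "{0..1} \<inter> S \<in> sets lebesgue"
        using \<open>S \<inter> {0..1} \<in> sets lebesgue\<close> by (simp add: Int_commute)
      ultimately have "u \<in> borel_measurable (lebesgue_on ({0..1} \<inter> S))"
        by (rule continuous_imp_measurable_on_sets_lebesgue)
      moreover have "restrict_space unit_measure S = lebesgue_on ({0..1} \<inter> S)"
        using \<open>S \<in> sets lebesgue\<close> by (intro restrict_restrict_space) simp_all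
      ultimately show "u \<in> borel_measurable (restrict_space unit_measure S)" by simp
    qed
  qed
qed

subsection \<open>Existence of a minimizer\<close>

lemma abs_continuous_on_measurable:
  "abs_continuous_on {0..1} f \<Longrightarrow> f \<in> borel_measurable unit_measure"
  by (intro continuous_imp_measurable_unit abs_continuous_on_imp_continuous_on)

locale bounded_potential =
  fixes u :: "real \<Rightarrow> real" and C :: real
  assumes u_measurable: "u \<in> borel_measurable unit_measure"
    and u_bounded: "t \<in> {0..1} \<Longrightarrow> \<bar>u t\<bar> \<le> C"
begin

lemma C_nonneg: "0 \<le> C"
  using u_bounded[of 0] by simp

lemma integrable_u_mult:
  assumes "w \<in> borel_measurable unit_measure" "\<And>t. t \<in> {0..1} \<Longrightarrow> \<bar>w t\<bar> \<le> D"
  shows "integrable unit_measure (\<lambda>t. u t * w t)"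
  by (rule integrable_potential[OF u_measurable u_bounded assms])

lemma integrable_u_admissible:
  assumes "admissible p"
  shows "integrable unit_measure (\<lambda>t. u t * p t)"
  using assms by (intro integrable_u_mult[of _ 1] admissible_measurable) (auto simp: admissible_def)

lemma abs_potential_le:
  assumes "admissible p"
  shows "\<bar>LINT t|unit_measure. u t * p t\<bar> \<le> C"
proof -
  have "\<bar>LINT t|unit_measure. u t * p t\<bar> \<le> (LINT t|unit_measure. \<bar>u t * p t\<bar>)"
    using integral_norm_bound[of unit_measure "\<lambda>t. u t * p t"] by simp
  also have "\<dots> \<le> (LINT t|unit_measure. C)"
  proof (rule integral_mono)
    show "integrable unit_measure (\<lambda>t. \<bar>u t * p t\<bar>)"
      using integrable_u_admissible[OF assms] by (rule integrable_abs)
    show "integrable unit_measure (\<lambda>t. C)" by (rule integrable_unit_bounded[of _ "\<bar>C\<bar>"]) auto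
    fix t assume "t \<in> space unit_measure"
    then have t: "t \<in> {0..1}" by simp
    have "\<bar>u t\<bar> * \<bar>p t\<bar> \<le> C * 1"
      using u_bounded[OF t] assms t by (intro mult_mono) (auto simp: admissible_def)
    then show "\<bar>u t * p t\<bar> \<le> C" by (simp add: abs_mult)
  qed
  also have "\<dots> = C" by (simp add: measure_unit_measure_space)
  finally show ?thesis .
qed

lemma J_eq:
  assumes "admissible p" "ac_derivative p g"
  shows "J u p = enn2ereal (quotient_energy p g) - ereal (LINT t|unit_measure. u t * p t)"
  by (rule J_eq_quotient_energy[OF u_measurable u_bounded assms])

text \<open>\<open>B\<close> is the quotient energy itself, finite because the potential is. From
  \<open>p\<close> to its angle nothing is lost in \<open>J\<close>, and
  \<open>J_of_angle_le\<close> loses nothing on the way back; together they let values of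
  \<open>J\<close> be compared through angles.\<close>

lemma J_finite_angle:
  assumes p: "admissible p" and fin: "J u p < \<infinity>"
  obtains B where "energy_bound (angle p) B" "J u p = ereal (B - (LINT t|unit_measure. u t * p t))"
proof -
  obtain g where g: "ac_derivative p g"
    using p abs_continuous_on_obtain_derivative unfolding admissible_def by blast
  note J = J_eq[OF p g]
  have "quotient_energy p g \<noteq> \<infinity>" using fin unfolding J by (auto simp: top_ennreal.rep_eq)
  then obtain B where B: "quotient_energy p g = ennreal B" "0 \<le> B"
    by (cases "quotient_energy p g") auto
  show thesis
    by (rule that[of B]) (use energy_bound_angle[OF p g _ B(2)] B J in auto)
qed

text \<open>The bound \<open>B\<close> controls the integral of the squared derivative of
  \<open>f\<close>, which in turn dominates the quotient energy of \<open>of_angle f\<close>; the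
  potential term is the same on both sides.\<close>

lemma J_of_angle_le:
  assumes f: "energy_bound f B"
  shows "admissible (of_angle f)" "J u (of_angle f) \<le> ereal (B - (LINT t|unit_measure. u t * of_angle f t))"
proof -
  have ac: "abs_continuous_on {0..1} f" by (rule energy_bound_abs_continuous_on[OF f])
  then obtain g where g: "ac_derivative f g" by (rule abs_continuous_on_obtain_derivative)
  note g2 = energy_bound_imp_integral_le[OF f g]
  show adm: "admissible (of_angle f)" by (rule admissible_of_angle[OF ac])
  then obtain h where h: "ac_derivative (of_angle f) h"
    using abs_continuous_on_obtain_derivative unfolding admissible_def by blast
  have "quotient_energy (of_angle f) h \<le> (\<integral>\<^sup>+t. ennreal ((g t)\<^sup>2) \<partial>unit_measure)"
    by (rule quotient_energy_of_angle_le[OF g h])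
  also have "\<dots> = ennreal (LINT t|unit_measure. (g t)\<^sup>2)"
    by (rule nn_integral_eq_integral[OF g2(1)]) simp
  also have "\<dots> \<le> ennreal B" using g2(2) by (rule ennreal_leI)
  finally have "enn2ereal (quotient_energy (of_angle f) h) \<le> ereal B"
    using energy_bound_nonneg[OF f] by (metis enn2ereal_ennreal less_eq_ennreal.rep_eq)
  then show "J u (of_angle f) \<le> ereal (B - (LINT t|unit_measure. u t * of_angle f t))"
    unfolding J_eq[OF adm h]
    by (metis ereal_minus(1) ereal_minus_mono order_refl)
qed

lemma energy_bound_const: "energy_bound (\<lambda>_. c) 0"
  by (simp add: energy_bound_def)

lemma optimal_solution_exists: "\<exists>p. optimal_solution u p"
proof -
  \<comment> \<open>The finite values of \<open>J\<close>. They are bounded below by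
    \<open>- C\<close>, since the energy is nonnegative and the potential is at most
    \<open>C\<close> in modulus.\<close>
  define S where "S = {r. \<exists>p. admissible p \<and> J u p = ereal r}"
  have lower: "- C \<le> r" if "r \<in> S" for r
  proof -
    obtain p where p: "admissible p" "J u p = ereal r" using \<open>r \<in> S\<close> by (auto simp: S_def)
    then obtain B where B: "energy_bound (angle p) B" "J u p = ereal (B - (LINT t|unit_measure. u t * p t))"
      using J_finite_angle[of p] by auto
    then show ?thesis
      using p abs_potential_le[OF p(1)] energy_bound_nonneg[OF B(1)] by auto
  qed
  have inS: "\<exists>r\<in>S. J u p = ereal r" if "admissible p" "J u p < \<infinity>" for p
    using J_finite_angle[OF that] that unfolding S_def by blast
  have "J u (of_angle (\<lambda>_. 0)) < \<infinity>"
    by (rule le_less_trans[OF J_of_angle_le(2)[OF energy_bound_const]]) simp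
  then have "S \<noteq> {}"
    using inS[OF J_of_angle_le(1)[OF energy_bound_const, of 0]] by blast
  have bdd: "bdd_below S" using lower by (rule bdd_belowI)
  define m where "m = Inf S"
  have "\<exists>r\<in>S. r < m + inverse (real (Suc n))" for n
    unfolding m_def using cInf_less_iff[OF \<open>S \<noteq> {}\<close> bdd, of "Inf S + inverse (real (Suc n))"] by simp
  then obtain r where r: "\<And>n. r n \<in> S" "\<And>n. r n < m + inverse (real (Suc n))" by metis
  have "\<exists>p. admissible p \<and> J u p = ereal (r n)" for n using r(1)[of n] by (auto simp: S_def)
  then obtain p where p: "\<And>n. admissible (p n)" "\<And>n. J u (p n) = ereal (r n)" by metis
  define I where "I n = (LINT t|unit_measure. u t * p n t)" for n
  have "energy_bound (angle (p n)) (r n + I n)" for n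
  proof -
    obtain B where "energy_bound (angle (p n)) B" "J u (p n) = ereal (B - I n)"
      using J_finite_angle[OF p(1)[of n]] p(2)[of n] unfolding I_def by auto
    then show ?thesis using p(2)[of n] by simp
  qed
  note energy = this
  have m_le: "m \<le> r n" for n unfolding m_def by (rule cInf_lower[OF r(1) bdd])
  have "r \<longlonglongrightarrow> m"
  proof (rule tendsto_sandwich[of "\<lambda>_. m" r _ "\<lambda>n. m + inverse (real (Suc n))"])
    show "(\<lambda>n. m + inverse (real (Suc n))) \<longlonglongrightarrow> m"
      using tendsto_add[OF tendsto_const LIMSEQ_inverse_real_of_nat, of m] by simp
    show "\<forall>\<^sub>F n in sequentially. m \<le> r n" using m_le by simp
    show "\<forall>\<^sub>F n in sequentially. r n \<le> m + inverse (real (Suc n))" using r(2) by (simp add: less_imp_le)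
  qed (rule tendsto_const)
  \<comment> \<open>Bounds every energy \<open>r n + I n\<close>, because \<open>r n < m + 1\<close>
    and \<open>I n \<le> C\<close>; the remaining \<open>1\<close> makes \<open>D\<close>
    positive.\<close>
  define D where "D = \<bar>m\<bar> + 2 + C"
  have D: "D > 0" using C_nonneg by (simp add: D_def)
  have "r n + I n \<le> D" for n
  proof -
    have "inverse (real (Suc n)) \<le> 1" by (simp add: inverse_eq_divide)
    then show ?thesis using r(2)[of n] abs_potential_le[OF p(1)[of n]] by (simp add: D_def I_def)
  qed
  then have energyD: "energy_bound (angle (p n)) D" for n
    using energy energy_bound_mono by blast
  obtain \<phi> :: "real \<Rightarrow> real" and k :: "nat \<Rightarrow> nat" where k: "strict_mono k" and
    conv: "\<And>e. 0 < e \<Longrightarrow> \<exists>N. \<forall>n x. N \<le> n \<and> x \<in> {0..1} \<longrightarrow> norm (angle (p (k n)) x - \<phi> x) < e"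
  proof (rule Arzela_Ascoli[of "{0..1::real}" "\<lambda>n. angle (p n)" "pi/2"])
    show "norm (angle (p n) x) \<le> pi/2" if "x \<in> {0..1}" for n x
      using angle_bounds[OF p(1)[of n] that] unfolding real_norm_def by linarith
    show "\<exists>d>0. \<forall>n y. y \<in> {0..1} \<and> norm (x - y) < d \<longrightarrow> norm (angle (p n) x - angle (p n) y) < e"
      if "x \<in> {0..1}" "0 < e" for x e
    proof (intro exI[of _ "e\<^sup>2 / D"] conjI allI impI)
      show "0 < e\<^sup>2 / D" using that D by simp
      fix n y assume y: "y \<in> {0..1} \<and> norm (x - y) < e\<^sup>2 / D"
      have "(angle (p n) x - angle (p n) y)\<^sup>2 \<le> D * \<bar>x - y\<bar>"
        using energy_bound_holder[OF energyD] y that by auto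
      also have "\<dots> < e\<^sup>2" using y D by (simp add: field_simps)
      finally have "\<bar>angle (p n) x - angle (p n) y\<bar>\<^sup>2 < e\<^sup>2" by simp
      then show "norm (angle (p n) x - angle (p n) y) < e"
        unfolding real_norm_def by (rule power_less_imp_less_base) (use that in simp)
    qed
  qed auto
  have lim: "(\<lambda>n. angle (p (k n)) t) \<longlonglongrightarrow> \<phi> t" if "t \<in> {0..1}" for t
    unfolding LIMSEQ_iff using conv that by blast
  \<comment> \<open>A preliminary bound, which yields the measurability of \<open>\<phi>\<close>
    needed to pass to the limit in the potential term.\<close>
  have "energy_bound \<phi> D"
    by (rule energy_bound_limit[OF energyD lim tendsto_const])
  then have \<phi>m: "\<phi> \<in> borel_measurable unit_measure"
    by (intro abs_continuous_on_measurable energy_bound_abs_continuous_on)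
  then have um: "(\<lambda>t. u t * of_angle \<phi> t) \<in> borel_measurable unit_measure"
    unfolding of_angle_def using u_measurable by measurable
  have "(\<lambda>n. I (k n)) \<longlonglongrightarrow> (LINT t|unit_measure. u t * of_angle \<phi> t)"
    unfolding I_def
  proof (rule integral_dominated_convergence[where w="\<lambda>_. C"])
    show "integrable unit_measure (\<lambda>t. C)" by (rule integrable_unit_bounded[of _ "\<bar>C\<bar>"]) auto
    show "AE t in unit_measure. (\<lambda>n. u t * p (k n) t) \<longlonglongrightarrow> u t * of_angle \<phi> t"
    proof (rule AE_I2)
      fix t assume "t \<in> space unit_measure"
      then have t: "t \<in> {0..1}" by simp
      have "(\<lambda>n. of_angle (angle (p (k n))) t) \<longlonglongrightarrow> of_angle \<phi> t"
        unfolding of_angle_def by (intro tendsto_intros lim t) simp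
      then show "(\<lambda>n. u t * p (k n) t) \<longlonglongrightarrow> u t * of_angle \<phi> t"
        using of_angle_angle[OF p(1) t] by (intro tendsto_mult tendsto_const) simp
    qed
    show "AE t in unit_measure. norm (u t * p (k n) t) \<le> C" for n
    proof (rule AE_I2)
      fix t assume "t \<in> space unit_measure"
      then have t: "t \<in> {0..1}" by simp
      have "\<bar>u t\<bar> * \<bar>p (k n) t\<bar> \<le> C * 1"
        using u_bounded[OF t] p(1)[of "k n"] t by (intro mult_mono) (auto simp: admissible_def)
      then show "norm (u t * p (k n) t) \<le> C" by (simp add: abs_mult)
    qed
  qed (use um integrable_u_admissible[OF p(1)] in auto)
  then have "(\<lambda>n. r (k n) + I (k n)) \<longlonglongrightarrow> m + (LINT t|unit_measure. u t * of_angle \<phi> t)"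
    using LIMSEQ_subseq_LIMSEQ[OF \<open>r \<longlonglongrightarrow> m\<close> k] by (intro tendsto_add) (auto simp: o_def)
  \<comment> \<open>Now the bounds \<open>r n + I n\<close> themselves are passed to the limit, so
    that the potential cancels and \<open>J\<close> is at most the infimum \<open>m\<close>.\<close>
  then have "energy_bound \<phi> (m + (LINT t|unit_measure. u t * of_angle \<phi> t))"
    by (rule energy_bound_limit[where F="\<lambda>n. angle (p (k n))", rotated 2]) (fact energy lim)+
  from J_of_angle_le[OF this] have adm: "admissible (of_angle \<phi>)" and J: "J u (of_angle \<phi>) \<le> ereal m"
    by auto
  have "J u (of_angle \<phi>) \<le> J u q" if q: "admissible q" for q
  proof (cases "J u q < \<infinity>")
    case True
    then obtain s where "s \<in> S" "J u q = ereal s" using inS[OF q] by blast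
    then show ?thesis
      using J cInf_lower[OF \<open>s \<in> S\<close> bdd] unfolding m_def by (metis ereal_less_eq(3) order_trans)
  qed simp
  moreover have "J u (of_angle \<phi>) < \<infinity>" using J by (rule le_less_trans) simp
  ultimately show ?thesis using adm unfolding optimal_solution_def by blast
qed

end

subsection \<open>First variation\<close>

text \<open>Mean value inequality for \<open>sin y - y * cos x\<close>, whose derivative
  \<open>cos y - cos x\<close> is at most \<open>\<bar>h\<bar>\<close> between \<open>x\<close> and
  \<open>x + h\<close>.\<close>

lemma sin_first_order:
  fixes x h :: real
  shows "\<bar>sin (x + h) - sin x - h * cos x\<bar> \<le> h\<^sup>2"
proof -
  have cos_lipschitz: "\<bar>cos y - cos x\<bar> \<le> \<bar>y - x\<bar>" for y x :: real
  proof -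
    have "1-lipschitz_on UNIV (cos :: real \<Rightarrow> real)"
      by (rule bounded_derivative_imp_lipschitz[where f'="\<lambda>x h. h * - sin x"])
         (auto intro!: derivative_eq_intros onorm_le simp: abs_mult mult_left_le)
    from lipschitz_onD[OF this, of y x] show ?thesis by (simp add: dist_real_def)
  qed
  define f where "f y = sin y - y * cos x" for y
  have f': "(f has_real_derivative (cos y - cos x)) (at y)" for y
    unfolding f_def by (auto intro!: derivative_eq_intros)
  have "\<bar>f (x + h) - f x\<bar> \<le> \<bar>h\<bar> * \<bar>h\<bar>"
  proof -
    have "norm (f (x + h) - f x) \<le> \<bar>h\<bar> * norm ((x + h) - x)"
    proof (rule field_differentiable_bound[where S="closed_segment x (x + h)" and f'="\<lambda>y. cos y - cos x"])
      show "norm (cos y - cos x) \<le> \<bar>h\<bar>" if "y \<in> closed_segment x (x + h)" for y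
      proof -
        have "\<bar>y - x\<bar> \<le> \<bar>h\<bar>"
          using that by (auto simp: closed_segment_eq_real_ivl split: if_splits)
        then show ?thesis using cos_lipschitz[of y x] by simp
      qed
    qed (auto intro: DERIV_subset[OF f'])
    then show ?thesis by simp
  qed
  moreover have "f (x + h) - f x = sin (x + h) - sin x - h * cos x"
    by (simp add: f_def algebra_simps)
  ultimately show ?thesis by (simp add: power2_eq_square)
qed

text \<open>With \<open>M \<ge> K\<close> positive, the choice \<open>s = - L / (2 * M)\<close>
  minimizes \<open>s * L + s\<^sup>2 * M\<close>, and the minimum
  \<open>- L\<^sup>2 / (4 * M)\<close> is negative unless \<open>L = 0\<close>.\<close>

lemma linear_term_eq_0:
  fixes L K :: real
  assumes "\<And>s. 0 \<le> s * L + s\<^sup>2 * K"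
  shows "L = 0"
proof (rule ccontr)
  assume "L \<noteq> 0"
  define M where "M = \<bar>K\<bar> + 1"
  have M: "M > 0" "K \<le> M" by (auto simp: M_def)
  have "0 \<le> (- L / (2 * M)) * L + (- L / (2 * M))\<^sup>2 * K" by (rule assms)
  also have "\<dots> \<le> (- L / (2 * M)) * L + (- L / (2 * M))\<^sup>2 * M"
    using M by (intro add_left_mono mult_left_mono) auto
  also have "\<dots> = - (L\<^sup>2 / (4 * M))"
    using M by (simp add: field_simps power2_eq_square)
  also have "\<dots> < 0" using M \<open>L \<noteq> 0\<close> by simp
  finally show False by simp
qed

section \<open>Test functions and the Euler-Lagrange equation\<close>

lemma primitive_of_add_scaled:
  assumes f: "primitive_of f g" and h: "primitive_of h k"
  shows "primitive_of (\<lambda>t. f t + s * h t) (\<lambda>t. g t + s * k t)"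
  unfolding primitive_of_def
proof (intro conjI allI impI)
  have gi: "integrable unit_measure g" and ki: "integrable unit_measure k"
    using f h by (auto simp: primitive_of_def)
  show "integrable unit_measure (\<lambda>t. g t + s * k t)"
    using gi ki by (intro Bochner_Integration.integrable_add integrable_mult_right)
  fix a b :: real assume ab: "0 \<le> a" "a \<le> b" "b \<le> 1"
  have "(LINT t|unit_measure. indicator {a..b} t * (g t + s * k t))
      = (LINT t|unit_measure. indicator {a..b} t * g t + s * (indicator {a..b} t * k t))"
    by (intro Bochner_Integration.integral_cong) (auto simp: algebra_simps)
  also have "\<dots> = (LINT t|unit_measure. indicator {a..b} t * g t) + s * (LINT t|unit_measure. indicator {a..b} t * k t)"
    using integrable_unit_indicator[OF gi, of "{a..b}"] integrable_unit_indicator[OF ki, of "{a..b}"]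
    by (subst Bochner_Integration.integral_add) auto
  also have "\<dots> = f b + s * h b - (f a + s * h a)"
  proof -
    have "(LINT t|unit_measure. indicator {a..b} t * g t) = f b - f a"
      "(LINT t|unit_measure. indicator {a..b} t * k t) = h b - h a"
      using f h ab by (simp_all add: primitive_of_def)
    then show ?thesis by (simp add: right_diff_distrib)
  qed
  finally show "(LINT t|unit_measure. indicator {a..b} t * (g t + s * k t)) = f b + s * h b - (f a + s * h a)" .
qed

lemma primitive_of_const: "primitive_of (\<lambda>_. c) (\<lambda>_. 0)"
  by (simp add: primitive_of_def)

text \<open>A test function with derivative \<open>indicator {a..b}\<close>, against which the
  derivative of the angle integrates to its increment. The shift \<open>c\<close> will be
  \<open>a\<close>, which places the values in the unit interval.\<close>

lemma primitive_of_clamp: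
  assumes ab: "0 \<le> a" "a \<le> b" "b \<le> 1"
  shows "primitive_of (\<lambda>t. max a (min b t) - c) (indicator {a..b})"
  unfolding primitive_of_def
proof (intro conjI allI impI)
  show "integrable unit_measure (indicator {a..b} :: real \<Rightarrow> real)"
    by (rule integrable_unit_bounded[of _ 1])
       (auto intro!: measurable_restrict_space1 measurable_completion simp: indicator_def)
  fix x y :: real assume xy: "0 \<le> x" "x \<le> y" "y \<le> 1"
  have "(LINT t|unit_measure. indicator {x..y} t * indicator {a..b} t)
      = (LINT t|unit_measure. indicator {max x a..min y b} t :: real)"
    by (intro Bochner_Integration.integral_cong) (auto simp: indicator_def)
  also have "\<dots> = measure unit_measure ({max x a..min y b} \<inter> space unit_measure)"
    by (rule Bochner_Integration.integral_indicator)
  also have "{max x a..min y b} \<inter> space unit_measure = {max x a..min y b}"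
    using xy by auto
  also have "measure unit_measure {max x a..min y b} = max a (min b y) - c - (max a (min b x) - c)"
  proof (cases "max x a \<le> min y b")
    case True
    then have "measure unit_measure {max x a..min y b} = min y b - max x a"
      using xy ab by (subst measure_def, subst emeasure_unit_measure_subset) auto
    then show ?thesis using True xy ab by (auto simp: max_def min_def split: if_splits)
  next
    case False
    then have "{max x a..min y b} = {}" by simp
    moreover have "max a (min b y) = max a (min b x)"
      using False xy ab by (auto simp: max_def min_def split: if_splits)
    ultimately show ?thesis by simp
  qed
  finally show "(LINT t|unit_measure. indicator {x..y} t * indicator {a..b} t)
      = max a (min b y) - c - (max a (min b x) - c)" .
qed

context bounded_potential
begin

text \<open>The competitors are \<open>of_angle\<close> of \<open>f + s * h\<close>, allowed for
  \<open>s\<close> of either sign. The energy is exactly quadratic in \<open>s\<close>, and the sine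
  is expanded to first order, so the coefficient of \<open>s\<close> must vanish.\<close>

lemma first_variation:
  assumes opt: "optimal_solution u p"
  obtains g where "primitive_of (angle p) g"
    "\<And>h k. \<lbrakk>primitive_of h k; h \<in> borel_measurable unit_measure; \<And>t. t \<in> {0..1} \<Longrightarrow> \<bar>h t\<bar> \<le> 1;
        \<And>t. t \<in> {0..1} \<Longrightarrow> \<bar>k t\<bar> \<le> 1\<rbrakk> \<Longrightarrow>
      (LINT t|unit_measure. k t * g t) = (LINT t|unit_measure. u t * (cos (angle p t) * h t)) / 4"
proof -
  let ?f = "angle p"
  have p: "admissible p" and fin: "J u p < \<infinity>" and le: "\<And>q. admissible q \<Longrightarrow> J u p \<le> J u q"
    using opt by (auto simp: optimal_solution_def)
  obtain B where B: "energy_bound ?f B" and Jp: "J u p = ereal (B - (LINT t|unit_measure. u t * p t))"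
    using J_finite_angle[OF p fin] by blast
  have ac: "abs_continuous_on {0..1} ?f" by (rule energy_bound_abs_continuous_on[OF B])
  then obtain g where g: "ac_derivative ?f g" by (rule abs_continuous_on_obtain_derivative)
  have fm[measurable]: "?f \<in> borel_measurable unit_measure" by (rule abs_continuous_on_measurable[OF ac])
  have fg: "primitive_of ?f g" using g by (simp add: ac_derivative_def)
  have g2: "integrable unit_measure (\<lambda>t. (g t)\<^sup>2)" "(LINT t|unit_measure. (g t)\<^sup>2) \<le> B"
    by (rule energy_bound_imp_integral_le[OF B g])+
  have gi: "integrable unit_measure g" using fg by (simp add: primitive_of_def)
  have sin_f: "(LINT t|unit_measure. u t * p t) = (LINT t|unit_measure. u t * of_angle ?f t)"
    by (intro Bochner_Integration.integral_cong refl) (simp add: of_angle_angle[OF p])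
  show thesis
  proof (rule that[OF fg])
    fix h k assume hk: "primitive_of h k" and hm[measurable]: "h \<in> borel_measurable unit_measure"
      and h1: "\<And>t. t \<in> {0..1} \<Longrightarrow> \<bar>h t\<bar> \<le> 1" and k1: "\<And>t. t \<in> {0..1} \<Longrightarrow> \<bar>k t\<bar> \<le> 1"
    have ki: "integrable unit_measure k" using hk by (simp add: primitive_of_def)
    then have [measurable]: "k \<in> borel_measurable unit_measure" by simp
    have k2: "integrable unit_measure (\<lambda>t. (k t)\<^sup>2)"
      by (rule integrable_unit_bounded[of _ 1]) (use k1 in \<open>auto simp: abs_square_le_1\<close>)
    have kg: "integrable unit_measure (\<lambda>t. k t * g t)"
    proof (rule Bochner_Integration.integrable_bound[OF gi])
      show "(\<lambda>t. k t * g t) \<in> borel_measurable unit_measure" using gi by measurable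
      show "AE t in unit_measure. norm (k t * g t) \<le> norm (g t)"
        by (rule AE_I2) (use k1 in \<open>auto simp: abs_mult intro!: mult_left_le_one_le\<close>)
    qed
    have cosm: "(\<lambda>t. cos (?f t) * h t) \<in> borel_measurable unit_measure" by measurable
    have cos1: "\<bar>cos (?f t) * h t\<bar> \<le> 1" if "t \<in> {0..1}" for t
      using h1[OF that] by (simp add: abs_mult mult_le_one)
    note ucos = integrable_u_mult[OF cosm cos1]
    define G where "G = (LINT t|unit_measure. k t * g t)"
    define W where "W = (LINT t|unit_measure. u t * (cos (?f t) * h t))"
    define k2I where "k2I = (LINT t|unit_measure. (k t)\<^sup>2)"
    \<comment> \<open>The quadratic coefficient collects \<open>k2I\<close> from the energy and
      \<open>C / 2\<close> from the sine remainder; the half comes from the factor in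
      \<open>of_angle\<close>.\<close>
    have "0 \<le> s * (2 * G - W / 2) + s\<^sup>2 * (k2I + C / 2)" for s
    proof -
      let ?F = "\<lambda>t. ?f t + s * h t"
      have prim: "primitive_of ?F (\<lambda>t. g t + s * k t)" by (rule primitive_of_add_scaled[OF fg hk])
      have sq: "(\<lambda>t. (g t + s * k t)\<^sup>2) = (\<lambda>t. (g t)\<^sup>2 + (2 * s) * (k t * g t) + s\<^sup>2 * (k t)\<^sup>2)"
        by (auto simp: fun_eq_iff power2_eq_square algebra_simps)
      have int: "integrable unit_measure (\<lambda>t. (g t + s * k t)\<^sup>2)"
        unfolding sq using g2(1) kg k2
        by (intro Bochner_Integration.integrable_add integrable_mult_right)
      have I: "(LINT t|unit_measure. (g t + s * k t)\<^sup>2) = (LINT t|unit_measure. (g t)\<^sup>2) + 2 * s * G + s\<^sup>2 * k2I"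
        unfolding sq G_def k2I_def using g2(1) kg k2 by simp
      have eb: "energy_bound ?F (LINT t|unit_measure. (g t + s * k t)\<^sup>2)"
        by (rule energy_bound_integral[OF prim int])
      have "J u p \<le> ereal ((LINT t|unit_measure. (g t + s * k t)\<^sup>2) - (LINT t|unit_measure. u t * of_angle ?F t))"
        using le[OF J_of_angle_le(1)[OF eb]] J_of_angle_le(2)[OF eb] by (rule order_trans)
      \<comment> \<open>The \<open>B\<close> in \<open>J u p\<close> is an upper bound of the energy
        of \<open>?f\<close>, so it absorbs the energy term of the competitor.\<close>
      then have *: "(LINT t|unit_measure. u t * of_angle ?F t) - (LINT t|unit_measure. u t * of_angle ?f t)
          \<le> 2 * s * G + s\<^sup>2 * k2I"
        unfolding Jp sin_f I using g2(2) by simp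
      have uF: "integrable unit_measure (\<lambda>t. u t * of_angle ?F t)"
        by (rule integrable_u_admissible[OF J_of_angle_le(1)[OF eb]])
      have uf: "integrable unit_measure (\<lambda>t. u t * of_angle ?f t)"
        by (rule integrable_u_admissible[OF J_of_angle_le(1)[OF B]])
      have "s / 2 * W - s\<^sup>2 * (C / 2)
          = (LINT t|unit_measure. s / 2 * (u t * (cos (?f t) * h t)) - s\<^sup>2 * (C / 2))"
        using ucos unfolding W_def
        by (subst Bochner_Integration.integral_diff)
           (auto simp: measure_unit_measure_space intro!: integrable_unit_bounded)
      also have "\<dots> \<le> (LINT t|unit_measure. u t * of_angle ?F t - u t * of_angle ?f t)"
      proof (rule integral_mono)
        show "integrable unit_measure (\<lambda>t. s / 2 * (u t * (cos (?f t) * h t)) - s\<^sup>2 * (C / 2))"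
          using ucos by (intro Bochner_Integration.integrable_diff integrable_mult_right)
            (auto intro: integrable_unit_bounded)
        show "integrable unit_measure (\<lambda>t. u t * of_angle ?F t - u t * of_angle ?f t)"
          using uF uf by (rule Bochner_Integration.integrable_diff)
        fix t assume "t \<in> space unit_measure"
        then have t: "t \<in> {0..1}" by simp
        define d where "d = sin (?F t) - sin (?f t) - (s * h t) * cos (?f t)"
        have "\<bar>d\<bar> \<le> (s * h t)\<^sup>2" unfolding d_def by (rule sin_first_order)
        also have "\<dots> \<le> s\<^sup>2 * 1"
          unfolding power_mult_distrib using h1[OF t] by (intro mult_left_mono) (auto simp: abs_square_le_1)
        finally have d: "\<bar>d\<bar> \<le> s\<^sup>2" by simp
        have "\<bar>u t\<bar> * \<bar>d\<bar> \<le> C * s\<^sup>2"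
          using u_bounded[OF t] d by (intro mult_mono) auto
        then have "- (C * s\<^sup>2) \<le> u t * d" by (metis abs_le_iff abs_mult minus_le_iff)
        moreover have "u t * of_angle ?F t - u t * of_angle ?f t = s / 2 * (u t * (cos (?f t) * h t)) + u t * d / 2"
          unfolding of_angle_def d_def by (simp add: field_simps)
        ultimately show "s / 2 * (u t * (cos (?f t) * h t)) - s\<^sup>2 * (C / 2)
            \<le> u t * of_angle ?F t - u t * of_angle ?f t"
          by (simp add: algebra_simps)
      qed
      also have "\<dots> = (LINT t|unit_measure. u t * of_angle ?F t) - (LINT t|unit_measure. u t * of_angle ?f t)"
        by (rule Bochner_Integration.integral_diff[OF uF uf])
      finally show ?thesis using * by (simp add: algebra_simps)
    qed
    then have "2 * G - W / 2 = 0" by (rule linear_term_eq_0)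
    then show "(LINT t|unit_measure. k t * g t) = (LINT t|unit_measure. u t * (cos (?f t) * h t)) / 4"
      by (simp add: G_def W_def)
  qed
qed

text \<open>The Euler--Lagrange equation \<open>f'' = - u cos f / 4\<close> with \<open>f' = 0\<close> at both endpoints, for
  \<open>f = angle p\<close>, tested against truncations of the identity.\<close>

lemma euler_lagrange:
  assumes opt: "optimal_solution u p"
  shows "(LINT t|unit_measure. u t * cos (angle p t)) = 0"
    and "\<lbrakk>0 \<le> a; a \<le> b; b \<le> 1\<rbrakk> \<Longrightarrow>
      angle p b - angle p a = (LINT t|unit_measure. u t * cos (angle p t) * (max a (min b t) - a)) / 4"
proof -
  obtain g where g: "primitive_of (angle p) g"
    "\<And>h k. \<lbrakk>primitive_of h k; h \<in> borel_measurable unit_measure; \<And>t. t \<in> {0..1} \<Longrightarrow> \<bar>h t\<bar> \<le> 1;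
        \<And>t. t \<in> {0..1} \<Longrightarrow> \<bar>k t\<bar> \<le> 1\<rbrakk> \<Longrightarrow>
      (LINT t|unit_measure. k t * g t) = (LINT t|unit_measure. u t * (cos (angle p t) * h t)) / 4"
    by (rule first_variation[OF opt]) blast
  \<comment> \<open>The constant test function shifts the whole angle. Vanishing total force encodes
    the condition \<open>f' = 0\<close> at both ends.\<close>
  show "(LINT t|unit_measure. u t * cos (angle p t)) = 0"
    using g(2)[OF primitive_of_const[of 1]] by simp
  assume ab: "0 \<le> a" "a \<le> b" "b \<le> 1"
  have "(LINT t|unit_measure. indicator {a..b} t * g t)
      = (LINT t|unit_measure. u t * (cos (angle p t) * (max a (min b t) - a))) / 4"
  proof (rule g(2)[OF primitive_of_clamp[OF ab]])
    show "(\<lambda>t. max a (min b t) - a) \<in> borel_measurable unit_measure"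
      by (intro continuous_imp_measurable_unit continuous_intros)
    show "\<bar>max a (min b t) - a\<bar> \<le> 1" if "t \<in> {0..1}" for t using ab that by auto
  qed (simp add: indicator_def)
  then show "angle p b - angle p a = (LINT t|unit_measure. u t * cos (angle p t) * (max a (min b t) - a)) / 4"
    using g(1) ab by (simp add: primitive_of_def mult.assoc)
qed

end

subsection \<open>Regularity and contact with the boundary\<close>

text \<open>A substitute for Gronwall's inequality: a zero spreads to distance \<open>d\<close>, since there the maximum
  of \<open>z\<close> is at most half of itself.\<close>

lemma zero_spreads:
  fixes z :: "real \<Rightarrow> real"
  assumes cont: "continuous_on {0..1} z" and nonneg: "\<And>t. t \<in> {0..1} \<Longrightarrow> 0 \<le> z t"
    and K: "0 \<le> K" "K * d \<le> 1/2"
    and t0: "t0 \<in> {0..1}"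
    and right: "\<And>b. \<lbrakk>t0 \<le> b; b \<le> 1\<rbrakk> \<Longrightarrow> z b \<le> K * (LINT t|unit_measure. indicator {t0..b} t * z t)"
    and left: "\<And>a. \<lbrakk>0 \<le> a; a \<le> t0\<rbrakk> \<Longrightarrow> z a \<le> K * (LINT t|unit_measure. indicator {a..t0} t * z t)"
    and t: "t \<in> {0..1}" "\<bar>t - t0\<bar> \<le> d"
  shows "z t = 0"
proof -
  let ?I = "{0..1} \<inter> {t0 - d..t0 + d}"
  have "compact ?I" "?I \<noteq> {}" using t by (auto simp: abs_le_iff)
  then obtain m where m: "m \<in> ?I" "\<And>s. s \<in> ?I \<Longrightarrow> z s \<le> z m"
    using continuous_attains_sup[of ?I z] continuous_on_subset[OF cont] by blast
  have zi: "integrable unit_measure z"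
  proof -
    have "bounded (z ` {0..1})"
      by (intro compact_imp_bounded compact_continuous_image cont) simp
    then obtain D where "\<forall>x\<in>z ` {0..1}. norm x \<le> D"
      unfolding bounded_iff by blast
    then have "\<bar>z s\<bar> \<le> D" if "s \<in> {0..1}" for s using that by simp
    then show ?thesis
      by (intro integrable_unit_bounded[of z D] continuous_imp_measurable_unit cont)
  qed
  have bound: "(LINT t|unit_measure. indicator {x..y} t * z t) \<le> z m * (y - x)"
    if xy: "0 \<le> x" "x \<le> y" "y \<le> 1" "{x..y} \<subseteq> ?I" for x y
  proof -
    have "(LINT t|unit_measure. indicator {x..y} t * z t) \<le> (LINT t|unit_measure. z m * indicator {x..y} t)"
    proof (rule integral_mono)
      show "integrable unit_measure (\<lambda>t. indicator {x..y} t * z t)"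
        by (rule integrable_unit_indicator[OF zi]) simp
      have "integrable unit_measure (\<lambda>t. indicator {x..y} t * z m)"
        by (rule integrable_unit_indicator) (auto intro: integrable_unit_bounded)
      then show "integrable unit_measure (\<lambda>t. z m * indicator {x..y} t)" by (simp add: mult.commute)
      show "indicator {x..y} t * z t \<le> z m * indicator {x..y} t" for t
        using m(2)[of t] xy(4) by (auto simp: indicator_def)
    qed
    also have "\<dots> = z m * (y - x)"
      using xy by (simp add: measure_def emeasure_unit_measure_subset)
    finally show ?thesis .
  qed
  have m01: "m \<in> {0..1}" and md: "\<bar>m - t0\<bar> \<le> d" using m(1) by (auto simp: abs_le_iff)
  have "z m \<le> K * (z m * \<bar>m - t0\<bar>)"
  proof (cases "t0 \<le> m")
    case True
    have "z m \<le> K * (LINT t|unit_measure. indicator {t0..m} t * z t)" using right[OF True] m01 by simp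
    also have "\<dots> \<le> K * (z m * (m - t0))"
      using True t0 m(1) by (intro mult_left_mono[OF bound K(1)]) auto
    finally show ?thesis using True by simp
  next
    case False
    have "z m \<le> K * (LINT t|unit_measure. indicator {m..t0} t * z t)" using left[of m] m01 False by simp
    also have "\<dots> \<le> K * (z m * (t0 - m))"
      using False t0 m(1) by (intro mult_left_mono[OF bound K(1)]) auto
    finally show ?thesis using False by simp
  qed
  also have "\<dots> \<le> K * (z m * d)"
    using md K(1) nonneg[OF m01] by (intro mult_left_mono) auto
  also have "\<dots> = (K * d) * z m" by simp
  also have "\<dots> \<le> (1/2) * z m"
    using K(2) nonneg[OF m01] by (rule mult_right_mono)
  finally have "z m \<le> 0" by simp
  moreover have "t \<in> ?I" using t by (auto simp: abs_le_iff)
  ultimately show ?thesis using m(2)[of t] nonneg[OF t(1)] by linarith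
qed

lemma chain_in_unit_interval:
  fixes P :: "real \<Rightarrow> bool"
  assumes d: "0 < d" and t0: "t0 \<in> {0..1}" "P t0"
    and step: "\<And>s t. \<lbrakk>s \<in> {0..1}; P s; t \<in> {0..1}; \<bar>t - s\<bar> \<le> d\<rbrakk> \<Longrightarrow> P t"
    and t: "t \<in> {0..1}"
  shows "P t"
proof -
  have "P t" if "t \<in> {0..1}" "\<bar>t - t0\<bar> \<le> real n * d" for n t
    using that
  proof (induction n arbitrary: t)
    case 0
    then show ?case using t0 by simp
  next
    case (Suc n)
    \<comment> \<open>\<open>s\<close> lies on the segment from \<open>t0\<close> to
      \<open>t\<close> at the fraction \<open>n / (n + 1)\<close>: it stays in the unit interval,
      within \<open>n * d\<close> of \<open>t0\<close> and within \<open>d\<close> of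
      \<open>t\<close>.\<close>
    define r where "r = real n / real (Suc n)"
    have r: "0 \<le> r" "r \<le> 1" by (auto simp: r_def)
    define s where "s = (1 - r) * t0 + r * t"
    have s01: "s \<in> {0..1}"
      unfolding s_def using convexD_alt[OF convex_real_interval(5), of t0 0 1 t r] t0 Suc.prems(1) r by simp
    have "s - t0 = r * (t - t0)" by (simp add: s_def algebra_simps)
    then have "\<bar>s - t0\<bar> = r * \<bar>t - t0\<bar>" using r by (simp add: abs_mult)
    also have "\<dots> \<le> r * (real (Suc n) * d)" using Suc.prems(2) r by (intro mult_left_mono)
    also have "\<dots> = real n * d" by (simp add: r_def)
    finally have "P s" using Suc.IH s01 by blast
    have "t - s = (1 - r) * (t - t0)" by (simp add: s_def algebra_simps)
    then have "\<bar>t - s\<bar> = (1 - r) * \<bar>t - t0\<bar>" using r by (simp add: abs_mult)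
    also have "\<dots> \<le> (1 - r) * (real (Suc n) * d)" using Suc.prems(2) r by (intro mult_left_mono) auto
    also have "\<dots> = d" by (simp add: r_def field_simps)
    finally show ?case using step[OF s01 \<open>P s\<close> Suc.prems(1)] by simp
  qed
  moreover obtain n where "\<bar>t - t0\<bar> \<le> real n * d"
    using reals_Archimedean3[OF d, rule_format, of "\<bar>t - t0\<bar>"] less_imp_le by blast
  ultimately show ?thesis using t by blast
qed

text \<open>Division by \<open>x\<close> and \<open>x\<close> tending to \<open>0\<close>, made
  explicit: at the chosen \<open>x\<close> the right side divided by \<open>x\<close> is at most
  \<open>Y / 2\<close>.\<close>

lemma nonpos_of_linear_le_quadratic:
  fixes Y :: real
  assumes "0 < h" "\<And>x. \<lbrakk>0 < x; x \<le> h\<rbrakk> \<Longrightarrow> x * Y \<le> D * x * x"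
  shows "Y \<le> 0"
proof (rule ccontr)
  assume "\<not> Y \<le> 0"
  then have Y: "Y > 0" by simp
  define x where "x = min h (Y / (2 * (\<bar>D\<bar> + 1)))"
  have x: "0 < x" "x \<le> h" using assms(1) Y by (auto simp: x_def)
  have "x * Y \<le> x * (D * x)" using assms(2)[OF x] by (simp add: ac_simps)
  then have "Y \<le> D * x" using x by simp
  also have "\<dots> \<le> (\<bar>D\<bar> + 1) * x" using x by (intro mult_right_mono) auto
  also have "\<dots> \<le> (\<bar>D\<bar> + 1) * (Y / (2 * (\<bar>D\<bar> + 1)))" by (intro mult_left_mono) (auto simp: x_def)
  also have "\<dots> = Y / 2" by (simp add: field_simps)
  finally show False using Y by simp
qed

text \<open>Near the equilibrium \<open>\<sigma> * pi/2\<close> the force is at most linear in the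
  distance to it. The sign \<open>\<sigma>\<close> treats contact with \<open>1\<close> and contact
  with \<open>0\<close> at once.\<close>

lemma abs_cos_le_distance:
  assumes "\<sigma> = 1 \<or> \<sigma> = - 1"
  shows "\<bar>cos x\<bar> \<le> \<bar>pi/2 - \<sigma> * x\<bar>"
proof -
  have "cos x = sin (pi/2 - \<sigma> * x)" using assms by (auto simp: sin_diff)
  then show ?thesis using abs_sin_x_le_abs_x by metis
qed

context bounded_potential
begin

section \<open>Lipschitz bound for the angle and for the solution\<close>

lemma measurable_angle:
  assumes "optimal_solution u p"
  shows "angle p \<in> borel_measurable unit_measure"
proof -
  obtain B where "energy_bound (angle p) B"
    using assms J_finite_angle[of p] unfolding optimal_solution_def by blast
  then show ?thesis
    by (intro abs_continuous_on_measurable energy_bound_abs_continuous_on)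
qed

lemma force_bound: "t \<in> {0..1} \<Longrightarrow> \<bar>u t * cos (angle p t)\<bar> \<le> C * \<bar>cos (angle p t)\<bar>"
  using u_bounded by (simp add: abs_mult mult_right_mono)

lemma force_bound1: "t \<in> {0..1} \<Longrightarrow> \<bar>u t * cos (angle p t)\<bar> \<le> C"
  using force_bound[of t p] C_nonneg mult_left_mono[OF abs_cos_le_one, of C "angle p t"] by simp

lemma integrable_force:
  assumes opt: "optimal_solution u p" and w: "w \<in> borel_measurable unit_measure" "\<And>t. t \<in> {0..1} \<Longrightarrow> \<bar>w t\<bar> \<le> 1"
  shows "integrable unit_measure (\<lambda>t. u t * cos (angle p t) * w t)"
proof (rule integrable_unit_bounded[of _ C])
  show "(\<lambda>t. u t * cos (angle p t) * w t) \<in> borel_measurable unit_measure"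
    using u_measurable measurable_angle[OF opt] w(1) by measurable
  show "\<bar>u t * cos (angle p t) * w t\<bar> \<le> C" if "t \<in> {0..1}" for t
    using mult_mono[OF force_bound1[OF that] w(2)[OF that]] C_nonneg by (simp add: abs_mult[of _ "w t"])
qed

text \<open>Two uses: a weight of size \<open>b - a\<close> on the whole unit interval gives the
  Lipschitz bound, and a weight of size \<open>x\<close> on an interval of length \<open>x\<close>
  gives a remainder of order \<open>x * x\<close>.\<close>

lemma abs_integral_force_le:
  assumes opt: "optimal_solution u p" and w: "w \<in> borel_measurable unit_measure"
    and ab: "0 \<le> a" "a \<le> b" "b \<le> 1" "d \<le> 1"
    and wd: "\<And>t. t \<in> {0..1} \<Longrightarrow> \<bar>w t\<bar> \<le> d * indicator {a..b} t"
  shows "\<bar>LINT t|unit_measure. u t * cos (angle p t) * w t\<bar> \<le> C * d * (b - a)"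
proof -
  have w1: "\<bar>w t\<bar> \<le> 1" if "t \<in> {0..1}" for t
    using wd[OF that] ab(4) by (cases "t \<in> {a..b}") auto
  have ii: "integrable unit_measure (\<lambda>t. indicator {a..b} t * (C * d))"
    by (rule integrable_unit_indicator) (auto intro: integrable_unit_bounded)
  have "\<bar>LINT t|unit_measure. u t * cos (angle p t) * w t\<bar> \<le> (LINT t|unit_measure. \<bar>u t * cos (angle p t) * w t\<bar>)"
    using integral_norm_bound[of unit_measure "\<lambda>t. u t * cos (angle p t) * w t"] by simp
  also have "\<dots> \<le> (LINT t|unit_measure. indicator {a..b} t * (C * d))"
  proof (rule integral_mono[OF _ ii])
    show "integrable unit_measure (\<lambda>t. \<bar>u t * cos (angle p t) * w t\<bar>)"
      using integrable_force[OF opt w w1] by (rule integrable_abs)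
    fix t assume "t \<in> space unit_measure"
    then have t: "t \<in> {0..1}" by simp
    have "\<bar>u t * cos (angle p t)\<bar> * \<bar>w t\<bar> \<le> C * (d * indicator {a..b} t)"
      using force_bound1[OF t] wd[OF t] C_nonneg by (intro mult_mono) auto
    then show "\<bar>u t * cos (angle p t) * w t\<bar> \<le> indicator {a..b} t * (C * d)"
      unfolding abs_mult[of _ "w t"] by (simp add: ac_simps)
  qed
  also have "\<dots> = C * d * (b - a)"
    using ab by (simp add: measure_def emeasure_unit_measure_subset)
  finally show ?thesis .
qed

text \<open>The truncated identity minus \<open>a\<close> is at most \<open>b - a\<close>
  everywhere, and the force is at most \<open>C\<close>; the quarter is that of the Euler-Lagrange
  equation.\<close>

lemma angle_lipschitz:
  assumes opt: "optimal_solution u p"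
  shows "(C / 4)-lipschitz_on {0..1} (angle p)"
proof (rule lipschitz_onI)
  have *: "\<bar>angle p b - angle p a\<bar> \<le> C / 4 * (b - a)" if ab: "0 \<le> a" "a \<le> b" "b \<le> 1" for a b
  proof -
    have "\<bar>LINT t|unit_measure. u t * cos (angle p t) * (max a (min b t) - a)\<bar> \<le> C * (b - a) * (1 - 0)"
    proof (rule abs_integral_force_le[OF opt])
      show "(\<lambda>t. max a (min b t) - a) \<in> borel_measurable unit_measure"
        by (intro continuous_imp_measurable_unit continuous_intros)
    qed (use ab in \<open>auto simp: indicator_def\<close>)
    then show ?thesis unfolding euler_lagrange(2)[OF opt ab] by simp
  qed
  show "dist (angle p x) (angle p y) \<le> C / 4 * dist x y" if "x \<in> {0..1}" "y \<in> {0..1}" for x y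
    using *[of x y] *[of y x] that by (cases "x \<le> y") (auto simp: dist_real_def abs_minus_commute)
  show "0 \<le> C / 4" using C_nonneg by simp
qed

lemma optimal_solution_lipschitz:
  assumes opt: "optimal_solution u p"
  shows "\<exists>L. L-lipschitz_on {0..1} p"
proof -
  have p: "admissible p" using opt by (simp add: optimal_solution_def)
  have "(C / 4)-lipschitz_on {0..1} p"
  proof (rule lipschitz_onI)
    fix x y :: real assume xy: "x \<in> {0..1}" "y \<in> {0..1}"
    have "\<bar>sin (angle p x) - sin (angle p y)\<bar> \<le> \<bar>angle p x - angle p y\<bar>"
      using lipschitz_onD[OF sin_lipschitz, of "angle p x" "angle p y"] by (simp add: dist_real_def)
    also have "\<dots> \<le> C / 4 * \<bar>x - y\<bar>"
      using lipschitz_onD[OF angle_lipschitz[OF opt] xy] by (simp add: dist_real_def)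
    finally have "\<bar>2 * p x - 1 - (2 * p y - 1)\<bar> \<le> C / 4 * \<bar>x - y\<bar>"
      unfolding sin_angle[OF p xy(1)] sin_angle[OF p xy(2)] .
    moreover have "\<bar>p x - p y\<bar> \<le> \<bar>2 * p x - 1 - (2 * p y - 1)\<bar>" by linarith
    ultimately show "dist (p x) (p y) \<le> C / 4 * dist x y"
      unfolding dist_real_def by linarith
  qed (use C_nonneg in simp)
  then show ?thesis by blast
qed

text \<open>The derivative of \<open>angle p\<close> at \<open>x\<close> is a quarter of the integral of the force over
  \<open>{x..1}\<close>, or minus a quarter of the integral over \<open>{0..x}\<close>; the following two identities are the
  corresponding first-order Taylor expansions.\<close>

lemma angle_forward:
  assumes opt: "optimal_solution u p" and ab: "0 \<le> a" "a \<le> b" "b \<le> 1"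
  shows "4 * (angle p b - angle p a) =
    (b - a) * (LINT t|unit_measure. u t * cos (angle p t) * indicator {a..1} t)
    - (LINT t|unit_measure. u t * cos (angle p t) * (indicator {a..b} t * (b - t)))"
proof -
  let ?w = "\<lambda>t. u t * cos (angle p t)"
  have i1: "integrable unit_measure (\<lambda>t. ?w t * indicator {a..1} t)"
    by (rule integrable_force[OF opt])
       (auto intro!: measurable_restrict_space1 measurable_completion simp: indicator_def)
  have i2: "integrable unit_measure (\<lambda>t. ?w t * (indicator {a..b} t * (b - t)))"
    by (rule integrable_force[OF opt])
       (use ab in \<open>auto intro!: measurable_restrict_space1 measurable_completion simp: indicator_def abs_le_iff\<close>)
  have "(LINT t|unit_measure. ?w t * (max a (min b t) - a))
      = (LINT t|unit_measure. (b - a) * (?w t * indicator {a..1} t) - ?w t * (indicator {a..b} t * (b - t)))"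
    using ab by (intro Bochner_Integration.integral_cong refl)
      (auto simp: indicator_def algebra_simps max_def min_def)
  also have "\<dots> = (b - a) * (LINT t|unit_measure. ?w t * indicator {a..1} t)
      - (LINT t|unit_measure. ?w t * (indicator {a..b} t * (b - t)))"
    using i1 i2 by simp
  finally show ?thesis using euler_lagrange(2)[OF opt ab] by simp
qed

lemma angle_backward:
  assumes opt: "optimal_solution u p" and ab: "0 \<le> a" "a \<le> b" "b \<le> 1"
  shows "4 * (angle p b - angle p a) =
    (LINT t|unit_measure. u t * cos (angle p t) * (indicator {a..b} t * (t - a)))
    - (b - a) * (LINT t|unit_measure. u t * cos (angle p t) * indicator {0..b} t)"
proof -
  let ?w = "\<lambda>t. u t * cos (angle p t)"
  have i0: "integrable unit_measure ?w"
    using integrable_force[OF opt, of "\<lambda>_. 1"] by simp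
  have i1: "integrable unit_measure (\<lambda>t. ?w t * indicator {0..b} t)"
    by (rule integrable_force[OF opt])
       (auto intro!: measurable_restrict_space1 measurable_completion simp: indicator_def)
  have i2: "integrable unit_measure (\<lambda>t. ?w t * (indicator {a..b} t * (t - a)))"
    by (rule integrable_force[OF opt])
       (use ab in \<open>auto intro!: measurable_restrict_space1 measurable_completion simp: indicator_def abs_le_iff\<close>)
  \<comment> \<open>The truncation is written as the constant \<open>b - a\<close> minus what is
    missing to the left of \<open>b\<close>; the constant then drops out because the total force
    vanishes.\<close>
  have "(LINT t|unit_measure. ?w t * (max a (min b t) - a))
      = (LINT t|unit_measure. (b - a) * ?w t + (?w t * (indicator {a..b} t * (t - a))
          - (b - a) * (?w t * indicator {0..b} t)))"
    using ab by (intro Bochner_Integration.integral_cong refl)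
      (auto simp: indicator_def algebra_simps max_def min_def)
  also have "\<dots> = (LINT t|unit_measure. ?w t * (indicator {a..b} t * (t - a)))
      - (b - a) * (LINT t|unit_measure. ?w t * indicator {0..b} t)"
    using i0 i1 i2 euler_lagrange(1)[OF opt] by simp
  finally show ?thesis using euler_lagrange(2)[OF opt ab] by simp
qed

text \<open>At a contact point \<open>\<sigma> * angle p\<close> is maximal. Moving right gives
  \<open>\<sigma> * Y \<le> 0\<close> and moving left gives \<open>\<sigma> * Z \<le> 0\<close>,
  while \<open>Y + Z\<close> is the total force and vanishes, so both are zero. At an end point of
  the unit interval one of the two is an integral over a single point.\<close>

lemma contact_derivative_zero:
  assumes opt: "optimal_solution u p" and \<sigma>: "\<sigma> = 1 \<or> \<sigma> = - 1"
    and t0: "t0 \<in> {0..1}" and contact: "\<sigma> * angle p t0 = pi/2"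
  shows "(LINT t|unit_measure. u t * cos (angle p t) * indicator {t0..1} t) = 0"
    and "(LINT t|unit_measure. u t * cos (angle p t) * indicator {0..t0} t) = 0"
proof -
  let ?w = "\<lambda>t. u t * cos (angle p t)"
  define Y where "Y = (LINT t|unit_measure. ?w t * indicator {t0..1} t)"
  define Z where "Z = (LINT t|unit_measure. ?w t * indicator {0..t0} t)"
  have p: "admissible p" using opt by (simp add: optimal_solution_def)
  have max: "\<sigma> * angle p t \<le> \<sigma> * angle p t0" if "t \<in> {0..1}" for t
    unfolding contact using angle_bounds[OF p that] \<sigma> by auto
  have abs\<sigma>: "\<bar>\<sigma> * x\<bar> = \<bar>x\<bar>" for x using \<sigma> by auto
  have iY: "integrable unit_measure (\<lambda>t. ?w t * indicator {t0..1} t)"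
    and iZ: "integrable unit_measure (\<lambda>t. ?w t * indicator {0..t0} t)"
    by (rule integrable_force[OF opt];
        auto intro!: measurable_restrict_space1 measurable_completion simp: indicator_def)+
  \<comment> \<open>The two indicators overlap at \<open>t0\<close> alone.\<close>
  have "AE t in unit_measure. ?w t * indicator {t0..1} t + ?w t * indicator {0..t0} t = ?w t"
  proof -
    have "AE t in unit_measure. t \<in> {0..1}" by (rule AE_I2) simp
    with AE_unit_neq[of t0] show ?thesis
      by eventually_elim (auto simp: indicator_def)
  qed
  then have "Y + Z = (LINT t|unit_measure. ?w t)"
    unfolding Y_def Z_def Bochner_Integration.integral_add[OF iY iZ, symmetric]
    by (intro integral_cong_AE) (use iY iZ integrable_force[OF opt, of "\<lambda>_. 1"] in auto)
  then have YZ: "Y + Z = 0" using euler_lagrange(1)[OF opt] by simp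
  have Y: "\<sigma> * Y \<le> 0"
  proof (cases "t0 < 1")
    case True
    show ?thesis
    proof (rule nonpos_of_linear_le_quadratic)
      show "0 < 1 - t0" using True by simp
      fix x assume x: "0 < x" "x \<le> 1 - t0"
      define R where "R = (LINT t|unit_measure. ?w t * (indicator {t0..t0+x} t * (t0 + x - t)))"
      have "4 * (angle p (t0 + x) - angle p t0) = x * Y - R"
        unfolding Y_def R_def using angle_forward[OF opt, of t0 "t0 + x"] x t0 by simp
      then have "\<sigma> * (x * Y - R) = 4 * (\<sigma> * angle p (t0 + x) - \<sigma> * angle p t0)"
        by (metis mult.left_commute right_diff_distrib)
      also have "\<dots> \<le> 0" using max[of "t0 + x"] x t0 by simp
      finally have "x * (\<sigma> * Y) \<le> \<bar>R\<bar>"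
        using abs\<sigma>[of R] by (simp add: algebra_simps)
      also have "\<bar>R\<bar> \<le> C * x * (t0 + x - t0)"
        unfolding R_def by (rule abs_integral_force_le[OF opt])
          (use x t0 in \<open>auto intro!: measurable_restrict_space1 measurable_completion simp: indicator_def\<close>)
      finally show "x * (\<sigma> * Y) \<le> C * x * x" by simp
    qed
  next
    case False
    then have "t0 = 1" using t0 by simp
    have "Y = (LINT t|unit_measure. 0)"
      unfolding Y_def using iY AE_unit_neq[of 1] \<open>t0 = 1\<close>
      by (intro integral_cong_AE) (auto elim!: eventually_mono simp: indicator_def)
    then show ?thesis by simp
  qed
  have Z: "\<sigma> * Z \<le> 0"
  proof (cases "0 < t0")
    case True
    show ?thesis
    proof (rule nonpos_of_linear_le_quadratic)
      show "0 < t0" by (rule True)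
      fix x assume x: "0 < x" "x \<le> t0"
      define R where "R = (LINT t|unit_measure. ?w t * (indicator {t0-x..t0} t * (t - (t0 - x))))"
      have "4 * (angle p t0 - angle p (t0 - x)) = R - x * Z"
        unfolding Z_def R_def using angle_backward[OF opt, of "t0 - x" t0] x t0 by simp
      then have "\<sigma> * (R - x * Z) = 4 * (\<sigma> * angle p t0 - \<sigma> * angle p (t0 - x))"
        by (metis mult.left_commute right_diff_distrib)
      also have "\<dots> \<ge> 0" using max[of "t0 - x"] x t0 by simp
      finally have "x * (\<sigma> * Z) \<le> \<bar>R\<bar>"
        using abs\<sigma>[of R] by (simp add: algebra_simps)
      also have "\<bar>R\<bar> \<le> C * x * (t0 - (t0 - x))"
        unfolding R_def by (rule abs_integral_force_le[OF opt])
          (use x t0 in \<open>auto intro!: measurable_restrict_space1 measurable_completion simp: indicator_def\<close>)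
      finally show "x * (\<sigma> * Z) \<le> C * x * x" by simp
    qed
  next
    case False
    then have "t0 = 0" using t0 by simp
    have "Z = (LINT t|unit_measure. 0)"
      unfolding Z_def using iZ AE_unit_neq[of 0] \<open>t0 = 0\<close>
      by (intro integral_cong_AE) (auto elim!: eventually_mono simp: indicator_def)
    then show ?thesis by simp
  qed
  have "Y = 0 \<and> Z = 0" using Y Z YZ \<sigma> by auto
  then show "(LINT t|unit_measure. ?w t * indicator {t0..1} t) = 0" "(LINT t|unit_measure. ?w t * indicator {0..t0} t) = 0"
    by (auto simp: Y_def Z_def)
qed

text \<open>Let \<open>z\<close> be the distance to the equilibrium. At a contact point the
  first-order term vanishes, and since the force is at most \<open>C * z\<close> and the weights
  \<open>b - t\<close>, \<open>t - a\<close> are at most \<open>1\<close>, what remains is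
  \<open>z \<le> C / 4\<close> times an integral of \<open>z\<close>. So contact spreads by a fixed
  distance and then, step by step, to the whole interval.\<close>

lemma contact_everywhere:
  assumes opt: "optimal_solution u p" and \<sigma>: "\<sigma> = 1 \<or> \<sigma> = - 1"
    and t0: "t0 \<in> {0..1}" "\<sigma> * angle p t0 = pi/2" and t: "t \<in> {0..1}"
  shows "\<sigma> * angle p t = pi/2"
proof -
  let ?w = "\<lambda>t. u t * cos (angle p t)"
  have p: "admissible p" using opt by (simp add: optimal_solution_def)
  define z where "z t = pi/2 - \<sigma> * angle p t" for t
  have z_nonneg: "0 \<le> z t" if "t \<in> {0..1}" for t
    unfolding z_def using angle_bounds[OF p that] \<sigma> by auto
  have z_cont: "continuous_on {0..1} z"
    unfolding z_def using lipschitz_on_continuous_on[OF angle_lipschitz[OF opt]]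
    by (intro continuous_intros)
  have zi: "integrable unit_measure z"
  proof (rule integrable_unit_bounded)
    show "\<bar>z t\<bar> \<le> pi" if "t \<in> {0..1}" for t
      unfolding z_def using angle_bounds[OF p that] \<sigma> by (auto simp: abs_le_iff)
  qed (rule continuous_imp_measurable_unit[OF z_cont])
  have force_le: "\<bar>LINT t|unit_measure. ?w t * (indicator {a..b} t * v t)\<bar>
      \<le> C * (LINT t|unit_measure. indicator {a..b} t * z t)"
    if v: "v \<in> borel_measurable borel" "\<And>t. \<lbrakk>a \<le> t; t \<le> b\<rbrakk> \<Longrightarrow> \<bar>v t\<bar> \<le> 1" for a b v
  proof -
    have iz: "integrable unit_measure (\<lambda>t. indicator {a..b} t * z t)"
      by (rule integrable_unit_indicator[OF zi]) simp
    have iw: "integrable unit_measure (\<lambda>t. ?w t * (indicator {a..b} t * v t))"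
    proof (rule integrable_force[OF opt])
      show "(\<lambda>t. indicator {a..b} t * v t) \<in> borel_measurable unit_measure"
        using v(1) by (intro measurable_restrict_space1 measurable_completion) simp
    qed (use v(2) in \<open>auto simp: indicator_def\<close>)
    have "\<bar>LINT t|unit_measure. ?w t * (indicator {a..b} t * v t)\<bar>
        \<le> (LINT t|unit_measure. \<bar>?w t * (indicator {a..b} t * v t)\<bar>)"
      using integral_norm_bound[of unit_measure "\<lambda>t. ?w t * (indicator {a..b} t * v t)"] by simp
    also have "\<dots> \<le> (LINT t|unit_measure. C * (indicator {a..b} t * z t))"
    proof (rule integral_mono)
      show "integrable unit_measure (\<lambda>t. \<bar>?w t * (indicator {a..b} t * v t)\<bar>)"
        using iw by (rule integrable_abs)
      show "integrable unit_measure (\<lambda>t. C * (indicator {a..b} t * z t))"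
        using iz by (rule integrable_mult_right)
      fix t assume "t \<in> space unit_measure"
      then have t: "t \<in> {0..1}" by simp
      have "\<bar>?w t\<bar> \<le> C * \<bar>cos (angle p t)\<bar>" by (rule force_bound[OF t])
      also have "\<dots> \<le> C * z t"
        using abs_cos_le_distance[OF \<sigma>, of "angle p t"] z_nonneg[OF t] C_nonneg
        by (intro mult_left_mono) (auto simp: z_def)
      finally have w: "\<bar>?w t\<bar> \<le> C * z t" .
      have "\<bar>?w t\<bar> * \<bar>v t\<bar> \<le> (C * z t) * 1" if "t \<in> {a..b}"
        using w v(2)[of t] that by (intro mult_mono) auto
      then show "\<bar>?w t * (indicator {a..b} t * v t)\<bar> \<le> C * (indicator {a..b} t * z t)"
        by (auto simp: indicator_def abs_mult)
    qed
    also have "\<dots> = C * (LINT t|unit_measure. indicator {a..b} t * z t)" by simp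
    finally show ?thesis .
  qed
  \<comment> \<open>The step length depends on \<open>C\<close> alone, so finitely many steps cross
    the unit interval; \<open>C / 4 * d \<le> 1/2\<close> is what \<open>zero_spreads\<close>
    requires.\<close>
  define d where "d = 1 / (C + 1)"
  have d: "0 < d" "C / 4 * d \<le> 1/2" using C_nonneg by (auto simp: d_def field_simps)
  have "z t = 0"
  proof (rule chain_in_unit_interval[of d t0 "\<lambda>t. z t = 0"])
    show "z t0 = 0" using t0 by (simp add: z_def)
    fix s t assume s: "s \<in> {0..1}" "z s = 0" and t: "t \<in> {0..1}" "\<bar>t - s\<bar> \<le> d"
    have contact: "\<sigma> * angle p s = pi/2" using s(2) by (simp add: z_def)
    \<comment> \<open>Zero velocity need not be propagated: every new contact point is again a
      maximum, so it is available afresh at \<open>s\<close>.\<close>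
    note der = contact_derivative_zero[OF opt \<sigma> s(1) contact]
    have \<sigma>_abs: "x \<le> \<bar>y\<bar>" if "x = \<sigma> * y" for x y :: real using that \<sigma> by auto
    show "z t = 0"
    proof (rule zero_spreads[OF z_cont z_nonneg _ d(2) s(1) _ _ t])
      show "0 \<le> C / 4" using C_nonneg by simp
      show "z b \<le> C / 4 * (LINT t|unit_measure. indicator {s..b} t * z t)" if b: "s \<le> b" "b \<le> 1" for b
      proof -
        have eq: "4 * (angle p b - angle p s) = - (LINT t|unit_measure. ?w t * (indicator {s..b} t * (b - t)))"
          using angle_forward[OF opt, of s b] b s der by simp
        have "4 * z b = - (\<sigma> * (4 * (angle p b - angle p s)))"
          unfolding z_def contact[symmetric] by (simp add: algebra_simps)
        then have "4 * z b = \<sigma> * (LINT t|unit_measure. ?w t * (indicator {s..b} t * (b - t)))"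
          unfolding eq by simp
        then have "4 * z b \<le> \<bar>LINT t|unit_measure. ?w t * (indicator {s..b} t * (b - t))\<bar>" by (rule \<sigma>_abs)
        also have "\<dots> \<le> C * (LINT t|unit_measure. indicator {s..b} t * z t)"
          by (rule force_le) (use b s in \<open>auto simp: abs_le_iff\<close>)
        finally show ?thesis by simp
      qed
      show "z a \<le> C / 4 * (LINT t|unit_measure. indicator {a..s} t * z t)" if a: "0 \<le> a" "a \<le> s" for a
      proof -
        have eq: "4 * (angle p s - angle p a) = (LINT t|unit_measure. ?w t * (indicator {a..s} t * (t - a)))"
          using angle_backward[OF opt, of a s] a s der by simp
        have "4 * z a = \<sigma> * (4 * (angle p s - angle p a))"
          unfolding z_def contact[symmetric] by (simp add: algebra_simps)
        then have "4 * z a = \<sigma> * (LINT t|unit_measure. ?w t * (indicator {a..s} t * (t - a)))"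
          unfolding eq .
        then have "4 * z a \<le> \<bar>LINT t|unit_measure. ?w t * (indicator {a..s} t * (t - a))\<bar>" by (rule \<sigma>_abs)
        also have "\<dots> \<le> C * (LINT t|unit_measure. indicator {a..s} t * z t)"
          by (rule force_le) (use a s in \<open>auto simp: abs_le_iff\<close>)
        finally show ?thesis by simp
      qed
    qed
  qed (use d t0 t in auto)
  then show ?thesis by (simp add: z_def)
qed

lemma optimal_solution_dichotomy:
  assumes opt: "optimal_solution u p"
  shows "pure_boundary p \<or> strict_interior p"
proof (cases "\<exists>t0\<in>{0..1}. p t0 \<in> {0, 1}")
  case True
  then obtain t0 where t0: "t0 \<in> {0..1}" "p t0 = 0 \<or> p t0 = 1" by blast
  have p: "admissible p" using opt by (simp add: optimal_solution_def)
  have p_eq: "2 * p t - 1 = sin (angle p t)" if "t \<in> {0..1}" for t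
    using sin_angle[OF p that] by simp
  from t0(2) show ?thesis
  proof
    assume "p t0 = 1"
    then have "1 * angle p t0 = pi/2" by (simp add: angle_def)
    then have "angle p t = pi/2" if "t \<in> {0..1}" for t
      using contact_everywhere[OF opt _ t0(1) _ that, of 1] by simp
    then have "sin (angle p t) = 1" if "t \<in> {0..1}" for t using that sin_pi_half by metis
    then have "p t = 1" if "t \<in> {0..1}" for t using p_eq[OF that] that by simp
    then show ?thesis by (simp add: pure_boundary_def)
  next
    assume "p t0 = 0"
    then have "(- 1) * angle p t0 = pi/2" by (simp add: angle_def)
    then have "- angle p t = pi/2" if "t \<in> {0..1}" for t
      using contact_everywhere[OF opt _ t0(1) _ that, of "- 1"] by simp
    then have "angle p t = - (pi/2)" if "t \<in> {0..1}" for t using that by force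
    then have "sin (angle p t) = - 1" if "t \<in> {0..1}" for t using that by simp
    then have "p t = 0" if "t \<in> {0..1}" for t using p_eq[OF that] that by simp
    then show ?thesis by (simp add: pure_boundary_def)
  qed
next
  case False
  then have "strict_interior p"
    using opt unfolding optimal_solution_def admissible_def strict_interior_def
    by (metis atLeastAtMost_iff insertCI less_eq_real_def)
  then show ?thesis ..
qed

end

theorem theorem1:
  fixes u :: "real \<Rightarrow> real"
  assumes "piecewise_continuous u"
  shows "(\<exists>p. optimal_solution u p \<and> (\<exists>L. L-lipschitz_on {0..1} p)) \<and>
         (single_crossing u \<longrightarrow>
            (\<forall>p. optimal_solution u p \<longrightarrow> pure_boundary p \<or> strict_interior p))"
proof -
  obtain C where "u \<in> borel_measurable unit_measure" "\<And>t. t \<in> {0..1} \<Longrightarrow> \<bar>u t\<bar> \<le> C"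
    using piecewise_continuous_bounded_measurable[OF assms] by blast
  then interpret bounded_potential u C by unfold_locales
  show ?thesis
    using optimal_solution_exists optimal_solution_lipschitz optimal_solution_dichotomy by blast
qed

end
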